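(* Let $f,g$ satisfy Assumption (CPSO) and let $(x^*,u^* )\in\mathcal M\times\Omega$ be a point at which (RPD-i), (RPD-ii) and (ND) hold. Let $\psi:U\to\mathcal M$ be the local solution map around $u^*$ (with $U$ possibly reduced). Then for any $\alpha\in[\underline\alpha,\overline\alpha]$, $\tilde\varphi_\alpha$ is well-defined on a neighbourhood $V_\alpha$ of $(x^*,u^* )$ relative to $\mathcal M\times\Omega$, and $\tilde\varphi_\alpha(x,u)\to D\psi(u)$ as $x\to\psi(u)$. In particular, $$\tilde\varphi_\alpha(x,u)=-\big(\nabla^2_{\mathcal M}F(x,u)+\mathcal W_\alpha(x,u)\big)^\dagger D_u\nabla_{\mathcal M}F(x,u),$$ where $\mathcal W_\alpha(x,u):=-\alpha\,\mathfrak W_x\big(\cdot,\Pi^\perp(x)(\nu(x,u)+\nabla_xf(x,u))\big)$.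
   Context: $\mathcal X,\mathcal U$ are finite-dimensional Euclidean spaces, $\mathcal M\subset\mathcal X$ is a $C^2$-smooth embedded submanifold, $\Omega\subset\mathcal U$ is open. $T_x\mathcal M$, $N_x\mathcal M=(T_x\mathcal M)^\perp$ are the tangent and normal spaces, $\Pi(x)$, $\Pi^\perp(x)$ the orthogonal projections onto them. A linear operator defined on a subspace is extended to the whole space by composing it with the orthogonal projection onto that subspace; $\dagger$ is the pseudoinverse. Riemannian derivatives: for a function $h$ whose restriction to $\mathcal M$ is $C^2$ with $C^2$ extension $\tilde h$ near $x\in\mathcal M$, $\nabla_{\mathcal M}h(x)=\Pi(x)\nabla\tilde h(x)$ and $\nabla^2_{\mathcal M}h(x)=\Pi(x)\nabla^2\tilde h(x)+\mathfrak W_x(\cdot,\Pi^\perp(x)\nabla\tilde h(x))$ on $T_x\mathcal M$, where for $w\in N_x\mathcal M$ the Weingarten map $\mathfrak W_x(\cdot,w):T_x\mathcal M\to T_x\mathcal M$ is $v\mapsto-\Pi(x)\,\mathrm dW[v]$ with $W$ any local extension of $w$ to a normal vector field on $\mathcal M$. For $h(x,u)$, $\nabla_{\mathcal M}h,\nabla^2_{\mathcal M}h$ are taken in $x$ with $u$ fixed, and $D_u$ is the partial derivative in $u$. Partial smoothness: a proper lower semicontinuous $h$ is partly smooth at $x\in\mathcal M$ relative to $\mathcal M$ if $h$ is regular (in the sense of Rockafellar–Wets) at all points near $x$ and $\partial h(x)\ne\emptyset$; $\mathcal M$ is a $C^2$ manifold and $h|_{\mathcal M}$ is $C^2$ around $x$;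 $N_x\mathcal M=\mathrm{par}\,\partial h(x)$ (subspace parallel to the affine hull); and $\partial h$ is continuous at $x$ relative to $\mathcal M$. It is partly smooth relative to $\mathcal M$ if this holds at every $x\in\mathcal M$. Assumption (CPSO): $f:\mathcal X\times\mathcal U\to\mathbb R$ is $C^2$; $g:\mathcal X\times\mathcal U\to\overline{\mathbb R}$ is partly smooth relative to $\mathcal M\times\Omega$; for each $u\in\Omega$, $f(\cdot,u)$ and $g(\cdot,u)$ are convex and $\nabla_xf(\cdot,u)$ is $L$-Lipschitz. $F:=f+g$; $\partial_x$ is the convex subdifferential in $x$. Fixed step-size bounds: $0<\underline\alpha\le\overline\alpha<2/L$. Conditions at a point $(x^*,u^* )\in\mathcal M\times\Omega$: (RPD-i) $\nabla^2_{\mathcal M}F(x^*,u^* )$ is positive definite on $T_{x^*}\mathcal M$; (RPD-ii) $\Pi(x^* )\nabla_x^2f(x^*,u^* )|_{T_{x^*}\mathcal M}$ is positive definite on $T_{x^*}\mathcal M$; (ND) $0\in\mathrm{ri}\,\partial_xF(x^*,u^* )$. Local solution map (known fact): if (CPSO) holds and (RPD-i), (ND) hold at $(x^*,u^* )$, there are an open neighbourhood $U\subset\Omega$ of $u^*$ and a $C^1$ map $\psi:U\to\mathcal M$ with $\psi(u^* )=x^*$ such that for all $u\in U$: $\psi(u)$ is the unique minimizer of $F(\cdot,u)|_{\mathcal M}$, (ND) and (RPD-i) hold at $(\psi(u),u)$, and $D\psi(u)=-\nabla^2_{\mathcal M}F(\psi(u),u)^\dagger D_u\nabla_{\mathcal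 M}F(\psi(u),u)$. Definitions for $(x,u)\in\mathcal M\times\Omega$: $\nu(x,u):=\mathrm{proj}_{\partial_xg(x,u)}(-\nabla_xf(x,u))$ and $$\tilde Q_\alpha(x,u)=\Pi(x)-\alpha\,\mathfrak W_x(\cdot,\Pi^\perp(x)\nu(x,u))+\alpha\nabla^2_{\mathcal M}g(x,u),$$ $$\tilde R_\alpha(x,u)=\tilde Q_\alpha(x,u)^\dagger(I-\alpha\nabla_x^2f(x,u)),\qquad \tilde S_\alpha(x,u)=-\alpha\tilde Q_\alpha(x,u)^\dagger D_u\big(\nabla_xf(x,u)+\nabla_{\mathcal M}g(x,u)\big),$$ $$\tilde\varphi_\alpha(x,u)=\big(I-\tilde R_\alpha(x,u)\Pi(x)\big)^{-1}\tilde S_\alpha(x,u).$$ *)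

theory Defs
  imports "HOL-Analysis.Analysis"
begin

subsection \<open>Differentiability classes, gradients and Hessians\<close>

definition C1_on :: "'a::real_normed_vector set \<Rightarrow> ('a \<Rightarrow> 'b::real_normed_vector) \<Rightarrow> bool" where
  "C1_on S f \<longleftrightarrow> (\<exists>f' :: 'a \<Rightarrow> 'a \<Rightarrow>\<^sub>L 'b.
     (\<forall>x\<in>S. (f has_derivative blinfun_apply (f' x)) (at x)) \<and> continuous_on S f')"

definition C2_on :: "'a::real_normed_vector set \<Rightarrow> ('a \<Rightarrow> 'b::real_normed_vector) \<Rightarrow> bool" where
  "C2_on S f \<longleftrightarrow> (\<exists>f' :: 'a \<Rightarrow> 'a \<Rightarrow>\<^sub>L 'b.
     (\<forall>x\<in>S. (f has_derivative blinfun_apply (f' x)) (at x)) \<and> C1_on S f')"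

definition grad :: "('a::euclidean_space \<Rightarrow> real) \<Rightarrow> 'a \<Rightarrow> 'a" where
  "grad h x = (THE D. GDERIV h x :> D)"

definition hess :: "('a::euclidean_space \<Rightarrow> real) \<Rightarrow> 'a \<Rightarrow> 'a \<Rightarrow> 'a" where
  "hess h x = frechet_derivative (grad h) (at x)"

subsection \<open>Linear operators\<close>

definition pseudoinverse ::
  "('a::euclidean_space \<Rightarrow> 'b::euclidean_space) \<Rightarrow> 'b \<Rightarrow> 'a" where
  "pseudoinverse A = (THE B. linear B \<and> A \<circ> B \<circ> A = A \<and> B \<circ> A \<circ> B = B \<and>
     adjoint (A \<circ> B) = A \<circ> B \<and> adjoint (B \<circ> A) = B \<circ> A)"

definition pos_def_on :: "'a::euclidean_space set \<Rightarrow> ('a \<Rightarrow> 'a) \<Rightarrow> bool" where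
  "pos_def_on S A \<longleftrightarrow> (\<forall>v\<in>S. v \<noteq> 0 \<longrightarrow> 0 < A v \<bullet> v)"

subsection \<open>Embedded submanifolds\<close>

text \<open>The model subspaces all have the same dimension \<open>k\<close>, the dimension of the manifold.\<close>

definition C2_submanifold :: "'a::euclidean_space set \<Rightarrow> bool" where
  "C2_submanifold M \<longleftrightarrow> (\<exists>k. \<forall>x\<in>M. \<exists>V V' (\<Phi> :: 'a \<Rightarrow> 'a) \<Psi> E.
     open V \<and> x \<in> V \<and> open V' \<and> homeomorphism V V' \<Phi> \<Psi> \<and>
     C2_on V \<Phi> \<and> C2_on V' \<Psi> \<and>
     subspace E \<and> dim E = k \<and> \<Phi> ` (M \<inter> V) = E \<inter> V')"

definition tangent_space :: "'a::euclidean_space set \<Rightarrow> 'a \<Rightarrow> 'a set" where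
  "tangent_space M x = {v. \<exists>c e. 0 < e \<and> c C1_differentiable_on {-e<..<e} \<and>
     c ` {-e<..<e} \<subseteq> M \<and> c 0 = x \<and> (c has_vector_derivative v) (at 0)}"

definition normal_space :: "'a::euclidean_space set \<Rightarrow> 'a \<Rightarrow> 'a set" where
  "normal_space M x = orthogonal_comp (tangent_space M x)"

definition tproj :: "'a::euclidean_space set \<Rightarrow> 'a \<Rightarrow> 'a \<Rightarrow> 'a" where
  "tproj M x = closest_point (tangent_space M x)"

definition nproj :: "'a::euclidean_space set \<Rightarrow> 'a \<Rightarrow> 'a \<Rightarrow> 'a" where
  "nproj M x = closest_point (normal_space M x)"

text \<open>A local extension of \<open>w\<close> to a \<open>C\<^sup>1\<close> normal vector field, represented by a \<open>C\<^sup>1\<close> map on an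
  open subset of the ambient space. Only its derivative along tangent vectors is used, and this
  depends only on its restriction to \<open>M\<close>.\<close>

definition normal_extension ::
  "'a::euclidean_space set \<Rightarrow> 'a \<Rightarrow> 'a \<Rightarrow> ('a \<Rightarrow> 'a) \<Rightarrow> bool" where
  "normal_extension M x w W \<longleftrightarrow> W x = w \<and>
     (\<exists>V. open V \<and> x \<in> V \<and> C1_on V W \<and> (\<forall>y\<in>M \<inter> V. W y \<in> normal_space M y))"

text \<open>\<open>weingarten M x v w\<close> is the Weingarten map at \<open>x\<close> in the direction \<open>v\<close>, for the normal vector
  \<open>w\<close>. Like all operators on the tangent space below, it is extended to the whole space by
  composition with the orthogonal projection.\<close>

definition weingarten :: "'a::euclidean_space set \<Rightarrow> 'a \<Rightarrow> 'a \<Rightarrow> 'a \<Rightarrow> 'a" where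
  "weingarten M x v w =
     - tproj M x (frechet_derivative (SOME W. normal_extension M x w W) (at x) (tproj M x v))"

subsection \<open>Riemannian derivatives\<close>

definition is_C2_extension ::
  "'a::euclidean_space set \<Rightarrow> ('a \<Rightarrow> ereal) \<Rightarrow> 'a \<Rightarrow> ('a \<Rightarrow> real) \<Rightarrow> bool" where
  "is_C2_extension M h x ht \<longleftrightarrow>
     (\<exists>V. open V \<and> x \<in> V \<and> C2_on V ht \<and> (\<forall>y\<in>M \<inter> V. h y = ereal (ht y)))"

definition C2_extension ::
  "'a::euclidean_space set \<Rightarrow> ('a \<Rightarrow> ereal) \<Rightarrow> 'a \<Rightarrow> 'a \<Rightarrow> real" where
  "C2_extension M h x = (SOME ht. is_C2_extension M h x ht)"

definition rgrad :: "'a::euclidean_space set \<Rightarrow> ('a \<Rightarrow> ereal) \<Rightarrow> 'a \<Rightarrow> 'a" where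
  "rgrad M h x = tproj M x (grad (C2_extension M h x) x)"

definition rhess :: "'a::euclidean_space set \<Rightarrow> ('a \<Rightarrow> ereal) \<Rightarrow> 'a \<Rightarrow> 'a \<Rightarrow> 'a" where
  "rhess M h x v =
     tproj M x (hess (C2_extension M h x) x (tproj M x v))
     + weingarten M x v (nproj M x (grad (C2_extension M h x) x))"

subsection \<open>Variational analysis\<close>

definition epi :: "('a \<Rightarrow> ereal) \<Rightarrow> ('a \<times> real) set" where
  "epi h = {(x, r). h x \<le> ereal r}"

definition proper_fun :: "('a \<Rightarrow> ereal) \<Rightarrow> bool" where
  "proper_fun h \<longleftrightarrow> (\<forall>x. h x \<noteq> -\<infinity>) \<and> (\<exists>x. h x \<noteq> \<infinity>)"

definition lsc_fun :: "('a::topological_space \<Rightarrow> ereal) \<Rightarrow> bool" where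
  "lsc_fun h \<longleftrightarrow> (\<forall>x. h x \<le> Liminf (at x) h)"

definition convex_fun :: "('a::real_vector \<Rightarrow> ereal) \<Rightarrow> bool" where
  "convex_fun h \<longleftrightarrow> convex (epi h)"

definition convex_subdiff :: "('a::euclidean_space \<Rightarrow> ereal) \<Rightarrow> 'a \<Rightarrow> 'a set" where
  "convex_subdiff h x =
     {v. \<bar>h x\<bar> \<noteq> \<infinity> \<and> (\<forall>y. h x + ereal (v \<bullet> (y - x)) \<le> h y)}"

text \<open>Regular and general (limiting) normals, Clarke regularity of sets, and regular and general
  (limiting) subgradients, following Rockafellar and Wets.\<close>

definition regular_normals :: "'a::euclidean_space set \<Rightarrow> 'a \<Rightarrow> 'a set" where
  "regular_normals C z =
     {v. \<forall>e>0. \<forall>\<^sub>F y in at z within C. v \<bullet> (y - z) \<le> e * norm (y - z)}"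

definition limiting_normals :: "'a::euclidean_space set \<Rightarrow> 'a \<Rightarrow> 'a set" where
  "limiting_normals C z =
     {v. \<exists>zs vs. (\<forall>n. zs n \<in> C \<and> vs n \<in> regular_normals C (zs n)) \<and>
        zs \<longlonglongrightarrow> z \<and> vs \<longlonglongrightarrow> v}"

definition clarke_regular :: "'a::euclidean_space set \<Rightarrow> 'a \<Rightarrow> bool" where
  "clarke_regular C z \<longleftrightarrow> z \<in> C \<and> (\<exists>r>0. closed (C \<inter> cball z r)) \<and>
     limiting_normals C z = regular_normals C z"

definition regular_fun_at :: "('a::euclidean_space \<Rightarrow> ereal) \<Rightarrow> 'a \<Rightarrow> bool" where
  "regular_fun_at h x \<longleftrightarrow> \<bar>h x\<bar> \<noteq> \<infinity> \<and> clarke_regular (epi h) (x, real_of_ereal (h x))"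

definition regular_subdiff :: "('a::euclidean_space \<Rightarrow> ereal) \<Rightarrow> 'a \<Rightarrow> 'a set" where
  "regular_subdiff h x = {v. \<bar>h x\<bar> \<noteq> \<infinity> \<and>
     (\<forall>e>0. \<forall>\<^sub>F y in at x. h x + ereal (v \<bullet> (y - x) - e * norm (y - x)) \<le> h y)}"

definition limiting_subdiff :: "('a::euclidean_space \<Rightarrow> ereal) \<Rightarrow> 'a \<Rightarrow> 'a set" where
  "limiting_subdiff h x = {v. \<bar>h x\<bar> \<noteq> \<infinity> \<and>
     (\<exists>xs vs. (\<forall>n. vs n \<in> regular_subdiff h (xs n)) \<and>
        xs \<longlonglongrightarrow> x \<and> (\<lambda>n. h (xs n)) \<longlonglongrightarrow> h x \<and> vs \<longlonglongrightarrow> v)}"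

text \<open>Outer and inner semicontinuity in the sense of Painleve and Kuratowski.\<close>

definition set_continuous_at_within ::
  "('a::euclidean_space \<Rightarrow> 'b::euclidean_space set) \<Rightarrow> 'a \<Rightarrow> 'a set \<Rightarrow> bool" where
  "set_continuous_at_within S x M \<longleftrightarrow>
     (\<forall>xs vs v. (\<forall>n. xs n \<in> M \<and> vs n \<in> S (xs n)) \<and> xs \<longlonglongrightarrow> x \<and> vs \<longlonglongrightarrow> v \<longrightarrow> v \<in> S x) \<and>
     (\<forall>v\<in>S x. \<forall>xs. (\<forall>n. xs n \<in> M) \<and> xs \<longlonglongrightarrow> x \<longrightarrow>
        (\<exists>vs. (\<forall>\<^sub>F n in sequentially. vs n \<in> S (xs n)) \<and> vs \<longlonglongrightarrow> v))"

definition parallel_subspace :: "'a::euclidean_space set \<Rightarrow> 'a set" where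
  "parallel_subspace C = {a - b | a b. a \<in> affine hull C \<and> b \<in> affine hull C}"

text \<open>Regularity of a function at a point presupposes a finite value there, so it is required at
  the points near \<open>x\<close> at which \<open>h\<close> is finite.\<close>

definition partly_smooth_at ::
  "('a::euclidean_space \<Rightarrow> ereal) \<Rightarrow> 'a set \<Rightarrow> 'a \<Rightarrow> bool" where
  "partly_smooth_at h M x \<longleftrightarrow>
     proper_fun h \<and> lsc_fun h \<and>
     (\<forall>\<^sub>F y in nhds x. \<bar>h y\<bar> \<noteq> \<infinity> \<longrightarrow> regular_fun_at h y) \<and>
     limiting_subdiff h x \<noteq> {} \<and>
     C2_submanifold M \<and> (\<exists>ht. is_C2_extension M h x ht) \<and>
     normal_space M x = parallel_subspace (limiting_subdiff h x) \<and>
     set_continuous_at_within (limiting_subdiff h) x M"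

definition partly_smooth :: "('a::euclidean_space \<Rightarrow> ereal) \<Rightarrow> 'a set \<Rightarrow> bool" where
  "partly_smooth h M \<longleftrightarrow> proper_fun h \<and> lsc_fun h \<and> (\<forall>x\<in>M. partly_smooth_at h M x)"

subsection \<open>The parametric composite problem\<close>

definition CPSO ::
  "'a::euclidean_space set \<Rightarrow> 'b::euclidean_space set \<Rightarrow> real \<Rightarrow>
   ('a \<times> 'b \<Rightarrow> real) \<Rightarrow> ('a \<times> 'b \<Rightarrow> ereal) \<Rightarrow> bool" where
  "CPSO M \<Omega> L f g \<longleftrightarrow>
     C2_submanifold M \<and> open \<Omega> \<and> C2_on UNIV f \<and> partly_smooth g (M \<times> \<Omega>) \<and>
     (\<forall>u\<in>\<Omega>. convex_on UNIV (\<lambda>x. f (x, u)) \<and> convex_fun (\<lambda>x. g (x, u)) \<and>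
        L-lipschitz_on UNIV (grad (\<lambda>x. f (x, u))))"

definition Fsum :: "('a \<times> 'b \<Rightarrow> real) \<Rightarrow> ('a \<times> 'b \<Rightarrow> ereal) \<Rightarrow> 'a \<times> 'b \<Rightarrow> ereal" where
  "Fsum f g z = ereal (f z) + g z"

definition RPD_i ::
  "'a::euclidean_space set \<Rightarrow> ('a \<times> 'b \<Rightarrow> real) \<Rightarrow> ('a \<times> 'b \<Rightarrow> ereal) \<Rightarrow> 'a \<Rightarrow> 'b \<Rightarrow> bool" where
  "RPD_i M f g x u \<longleftrightarrow>
     pos_def_on (tangent_space M x) (rhess M (\<lambda>x. Fsum f g (x, u)) x)"

definition RPD_ii ::
  "'a::euclidean_space set \<Rightarrow> ('a \<times> 'b \<Rightarrow> real) \<Rightarrow> 'a \<Rightarrow> 'b \<Rightarrow> bool" where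
  "RPD_ii M f x u \<longleftrightarrow>
     pos_def_on (tangent_space M x) (\<lambda>v. tproj M x (hess (\<lambda>x. f (x, u)) x v))"

definition ND ::
  "('a::euclidean_space \<times> 'b \<Rightarrow> real) \<Rightarrow> ('a \<times> 'b \<Rightarrow> ereal) \<Rightarrow> 'a \<Rightarrow> 'b \<Rightarrow> bool" where
  "ND f g x u \<longleftrightarrow> 0 \<in> rel_interior (convex_subdiff (\<lambda>x. Fsum f g (x, u)) x)"

text \<open>These properties determine \<open>\<psi>\<close> on \<open>U\<close>. Its derivative formula, and (RPD-i) and (ND) at
  \<open>(\<psi> u, u)\<close> for \<open>u\<close> near \<open>us\<close>, are consequences and are not part of the definition.\<close>

definition local_solution_map ::
  "'a::euclidean_space set \<Rightarrow> 'b::euclidean_space set \<Rightarrow>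
   ('a \<times> 'b \<Rightarrow> real) \<Rightarrow> ('a \<times> 'b \<Rightarrow> ereal) \<Rightarrow> 'a \<Rightarrow> 'b \<Rightarrow> 'b set \<Rightarrow> ('b \<Rightarrow> 'a) \<Rightarrow> bool" where
  "local_solution_map M \<Omega> f g xs us U \<psi> \<longleftrightarrow>
     open U \<and> us \<in> U \<and> U \<subseteq> \<Omega> \<and> C1_on U \<psi> \<and> \<psi> ` U \<subseteq> M \<and> \<psi> us = xs \<and>
     (\<forall>u\<in>U. \<forall>y\<in>M. y \<noteq> \<psi> u \<longrightarrow> Fsum f g (\<psi> u, u) < Fsum f g (y, u))"

subsection \<open>The approximate derivative\<close>

definition nu ::
  "('a::euclidean_space \<times> 'b \<Rightarrow> real) \<Rightarrow> ('a \<times> 'b \<Rightarrow> ereal) \<Rightarrow> 'a \<Rightarrow> 'b \<Rightarrow> 'a" where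
  "nu f g x u =
     closest_point (convex_subdiff (\<lambda>x. g (x, u)) x) (- grad (\<lambda>x. f (x, u)) x)"

definition Qt ::
  "'a::euclidean_space set \<Rightarrow> ('a \<times> 'b \<Rightarrow> real) \<Rightarrow> ('a \<times> 'b \<Rightarrow> ereal) \<Rightarrow>
   real \<Rightarrow> 'a \<Rightarrow> 'b \<Rightarrow> 'a \<Rightarrow> 'a" where
  "Qt M f g \<alpha> x u v =
     tproj M x v - \<alpha> *\<^sub>R weingarten M x v (nproj M x (nu f g x u))
     + \<alpha> *\<^sub>R rhess M (\<lambda>x. g (x, u)) x v"

definition Rt ::
  "'a::euclidean_space set \<Rightarrow> ('a \<times> 'b \<Rightarrow> real) \<Rightarrow> ('a \<times> 'b \<Rightarrow> ereal) \<Rightarrow>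
   real \<Rightarrow> 'a \<Rightarrow> 'b \<Rightarrow> 'a \<Rightarrow> 'a" where
  "Rt M f g \<alpha> x u v =
     pseudoinverse (Qt M f g \<alpha> x u) (v - \<alpha> *\<^sub>R hess (\<lambda>x. f (x, u)) x v)"

definition mixed_grad ::
  "'a::euclidean_space set \<Rightarrow> ('a \<times> 'b \<Rightarrow> real) \<Rightarrow> ('a \<times> 'b \<Rightarrow> ereal) \<Rightarrow> 'a \<Rightarrow> 'b \<Rightarrow> 'a" where
  "mixed_grad M f g x u = grad (\<lambda>x. f (x, u)) x + rgrad M (\<lambda>x. g (x, u)) x"

definition St ::
  "'a::euclidean_space set \<Rightarrow> ('a \<times> 'b \<Rightarrow> real) \<Rightarrow> ('a \<times> 'b \<Rightarrow> ereal) \<Rightarrow>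
   real \<Rightarrow> 'a \<Rightarrow> 'b::euclidean_space \<Rightarrow> 'b \<Rightarrow> 'a" where
  "St M f g \<alpha> x u w =
     - (\<alpha> *\<^sub>R pseudoinverse (Qt M f g \<alpha> x u)
          (frechet_derivative (mixed_grad M f g x) (at u) w))"

definition phit ::
  "'a::euclidean_space set \<Rightarrow> ('a \<times> 'b \<Rightarrow> real) \<Rightarrow> ('a \<times> 'b \<Rightarrow> ereal) \<Rightarrow>
   real \<Rightarrow> 'a \<Rightarrow> 'b::euclidean_space \<Rightarrow> 'b \<Rightarrow> 'a" where
  "phit M f g \<alpha> x u w =
     inv (\<lambda>v. v - Rt M f g \<alpha> x u (tproj M x v)) (St M f g \<alpha> x u w)"

text \<open>All ingredients of \<open>phit\<close> exist: the extension defining the Riemannian derivatives of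
  \<open>g(\<cdot>, u)\<close>, the projection onto the subdifferential, the partial derivative in \<open>u\<close>, and the
  inverse operator. The function \<open>inv\<close> is total, so bijectivity has to be stated.\<close>

definition phit_well_defined ::
  "'a::euclidean_space set \<Rightarrow> ('a \<times> 'b \<Rightarrow> real) \<Rightarrow> ('a \<times> 'b \<Rightarrow> ereal) \<Rightarrow>
   real \<Rightarrow> 'a \<Rightarrow> 'b::euclidean_space \<Rightarrow> bool" where
  "phit_well_defined M f g \<alpha> x u \<longleftrightarrow>
     (\<exists>ht. is_C2_extension M (\<lambda>x. g (x, u)) x ht) \<and>
     convex_subdiff (\<lambda>x. g (x, u)) x \<noteq> {} \<and>
     mixed_grad M f g x differentiable (at u) \<and>
     linear (\<lambda>v. v - Rt M f g \<alpha> x u (tproj M x v)) \<and>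
     bij (\<lambda>v. v - Rt M f g \<alpha> x u (tproj M x v)) \<and>
     linear (phit M f g \<alpha> x u)"

definition Wcorr ::
  "'a::euclidean_space set \<Rightarrow> ('a \<times> 'b \<Rightarrow> real) \<Rightarrow> ('a \<times> 'b \<Rightarrow> ereal) \<Rightarrow>
   real \<Rightarrow> 'a \<Rightarrow> 'b \<Rightarrow> 'a \<Rightarrow> 'a" where
  "Wcorr M f g \<alpha> x u v =
     - (\<alpha> *\<^sub>R weingarten M x v (nproj M x (nu f g x u + grad (\<lambda>x. f (x, u)) x)))"

end

(* Idea. On the product M x Omega the subdifferential of g has a constant u-component, because its
   affine hull is parallel to N_x M x {0}; regularity then forces every partial subgradient of
   g(., u) to lift to a joint one, so d_x g inherits inner semicontinuity along M x Omega. With (ND) this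
   makes nu + grad_x f tangent near (xs, us). Hence the correction term W_alpha vanishes there, and
   normal part of nu = - normal part of grad_x f.

   Since x minimises g(., u) - <nu, .> along M, the operator Hess_M g - Weingarten(., normal part of nu) is positive
   semidefinite on T_x M. So Q_alpha >= identity on T_x M, and Hess_M F >= Pi (Hess_x f) Pi, which is
   uniformly positive definite near (xs, us) by (RPD-ii). The identity
   Q_alpha - Pi (I - alpha Hess_x f) Pi = alpha Hess_M F gives the inverse and the formula.
   Everything second order is computed in one chart at xs: tangent vectors are DPsi a with a in the
   model space, and <Weingarten(DPsi a, w), DPsi b> = <w, D^2 Psi (a, b)>. Differentiating the stationarity
   condition <grad_x F(psi(u), u), DPsi b> = 0 in u identifies the limit with D psi. *)

theory Submission
  imports Defs
begin

section \<open>Orthogonal projections and pseudoinverses\<close>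

text \<open>Two mismatches shape the proof. Partial smoothness concerns the joint limiting
  subdifferential of \<open>g\<close>, whereas \<open>nu\<close> and (ND) refer to convex
  subdifferentials in \<open>x\<close> alone; lifting partial subgradients bridges them. Moreover,
  \<open>weingarten\<close> and \<open>rhess\<close> pick extensions by \<open>SOME\<close> and act
  on tangent spaces that move with \<open>x\<close>. Tangent vectors are therefore compared through
  their pairings with the vectors \<open>\<Psi>' (\<Phi> x) b\<close>, \<open>b \<in> E\<close>,
  which depend continuously on \<open>x\<close> and involve no choice of extension.

  The selection \<open>nu\<close> is a projection onto a moving set, with no continuity at hand;
  only its normal part enters, and that part is traded for the continuous normal part of the
  gradient of \<open>f\<close>. In place of continuity of pseudoinverses, the uniform lower bound
  \<open>c\<close> on the Hessian of \<open>F\<close> turns a small residual of a linear equation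
  into a small error. Since \<psi> is given by minimality and C^1 smoothness, its derivative is
  found by showing that it solves the same equation.\<close>

lemma closest_point_orthogonal:
  fixes S :: "'a::euclidean_space set"
  assumes "subspace S" "s \<in> S"
  shows "(v - closest_point S v) \<bullet> s = 0"
proof -
  let ?p = "closest_point S v"
  have S: "convex S" "closed S" "S \<noteq> {}"
    using assms subspace_imp_convex closed_subspace by auto
  have p: "?p \<in> S" using closest_point_in_set S by blast
  \<comment> \<open>The variational inequality of the projection, tested at both
    \<open>?p + s\<close> and \<open>?p - s\<close>, becomes an equality.\<close>
  have "(v - ?p) \<bullet> ((?p + s) - ?p) \<le> 0" "(v - ?p) \<bullet> ((?p - s) - ?p) \<le> 0"
    using closest_point_dot[OF S(1,2)] assms p subspace_add subspace_diff by blast+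
  then show ?thesis by (simp add: inner_diff_right)
qed

lemma closest_point_subspace_in:
  fixes S :: "'a::euclidean_space set"
  assumes "subspace S"
  shows "closest_point S v \<in> S"
  using assms closest_point_in_set closed_subspace subspace_0 by blast

lemma closest_point_subspace_unique:
  fixes S :: "'a::euclidean_space set"
  assumes "subspace S" "p \<in> S" "\<And>s. s \<in> S \<Longrightarrow> (v - p) \<bullet> s = 0"
  shows "closest_point S v = p"
proof -
  let ?q = "closest_point S v"
  have q: "?q \<in> S" using closest_point_subspace_in assms by blast
  have d: "?q - p \<in> S" using q assms subspace_diff by blast
  have "(?q - p) \<bullet> (?q - p) = (v - p) \<bullet> (?q - p) - (v - ?q) \<bullet> (?q - p)"
    by (simp add: inner_diff_left)
  also have "\<dots> = 0" using assms(3)[OF d] closest_point_orthogonal[OF assms(1) d] by simp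
  finally show ?thesis by simp
qed

lemma closest_point_subspace_inner:
  fixes S :: "'a::euclidean_space set"
  assumes "subspace S" "s \<in> S"
  shows "closest_point S v \<bullet> s = v \<bullet> s"
  using closest_point_orthogonal[OF assms, of v] by (simp add: inner_diff_left)

lemma linear_closest_point_subspace:
  fixes S :: "'a::euclidean_space set"
  assumes "subspace S"
  shows "linear (closest_point S)"
proof (rule linearI)
  note [simp] = closest_point_subspace_inner[OF assms]
  fix a b :: 'a and r :: real
  show "closest_point S (a + b) = closest_point S a + closest_point S b"
    by (rule closest_point_subspace_unique[OF assms])
      (simp_all add: assms closest_point_subspace_in subspace_add inner_diff_left inner_add_left)
  show "closest_point S (r *\<^sub>R a) = r *\<^sub>R closest_point S a"
    by (rule closest_point_subspace_unique[OF assms])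
      (simp_all add: assms closest_point_subspace_in subspace_scale inner_diff_left)
qed

lemma closest_point_orthogonal_comp:
  fixes S :: "'a::euclidean_space set"
  assumes "subspace S"
  shows "closest_point (orthogonal_comp S) v = v - closest_point S v"
proof (rule closest_point_subspace_unique[OF subspace_orthogonal_comp])
  show "v - closest_point S v \<in> orthogonal_comp S"
    using closest_point_orthogonal[OF assms]
    by (auto simp: orthogonal_comp_def orthogonal_def inner_commute)
  fix s assume "s \<in> orthogonal_comp S"
  then show "(v - (v - closest_point S v)) \<bullet> s = 0"
    using closest_point_subspace_in[OF assms, of v]
    by (simp add: orthogonal_comp_def orthogonal_def)
qed

lemma norm_closest_point_subspace_le:
  fixes S :: "'a::euclidean_space set"
  assumes "subspace S"
  shows "norm (closest_point S v) \<le> norm v"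
proof -
  let ?p = "closest_point S v"
  have "norm ?p * norm ?p = v \<bullet> ?p"
    using closest_point_subspace_inner[OF assms closest_point_subspace_in[OF assms], of v v]
    by (simp flip: power2_eq_square add: power2_norm_eq_inner)
  also have "\<dots> \<le> norm v * norm ?p" by (rule norm_cauchy_schwarz)
  finally show ?thesis by (metis mult_right_le_imp_le norm_ge_zero order_le_less)
qed

text \<open>Makes the \<open>THE\<close> in \<open>pseudoinverse\<close> legitimate.
  \<open>A \<circ> B\<close> and \<open>A \<circ> C\<close> are both the orthogonal projection onto
  the range of \<open>A\<close>, and \<open>B \<circ> A\<close> and \<open>C \<circ> A\<close> both
  the one onto the orthogonal complement of its kernel; then
  \<open>B = B \<circ> A \<circ> B = C \<circ> A \<circ> C = C\<close>.\<close>

lemma Moore_Penrose_unique: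
  fixes A :: "'a::euclidean_space \<Rightarrow> 'b::euclidean_space"
  assumes A: "linear A" and lB: "linear B" and lC: "linear C"
    and B: "A \<circ> B \<circ> A = A" "B \<circ> A \<circ> B = B" "adjoint (A \<circ> B) = A \<circ> B" "adjoint (B \<circ> A) = B \<circ> A"
    and C: "A \<circ> C \<circ> A = A" "C \<circ> A \<circ> C = C" "adjoint (A \<circ> C) = A \<circ> C" "adjoint (C \<circ> A) = C \<circ> A"
  shows "B = C"
proof -
  have lAB: "linear (A \<circ> B)" "linear (A \<circ> C)" "linear (B \<circ> A)" "linear (C \<circ> A)"
    using A lB lC linear_compose by blast+
  have p: "A (B (A v)) = A v" "A (C (A v)) = A v" for v
    using fun_cong[OF B(1)] fun_cong[OF C(1)] by simp_all
  have AB: "A (B v) = A (C v)" for v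
  proof (rule vector_eq_ldot[THEN iffD1], rule allI)
    fix y
    have s: "x \<bullet> A (B y) = A (B x) \<bullet> y" "x \<bullet> A (C y) = A (C x) \<bullet> y" for x y
      using adjoint_works[OF lAB(1), of x y] adjoint_works[OF lAB(2), of x y] B(3) C(3) by simp_all
    have "y \<bullet> A (B v) = y \<bullet> A (C (A (B v)))" by (simp add: p)
    also have "\<dots> = A (B (A (C y))) \<bullet> v" by (simp add: s)
    also have "\<dots> = y \<bullet> A (C v)" by (simp add: p s)
    finally show "y \<bullet> A (B v) = y \<bullet> A (C v)" .
  qed
  have BA: "B (A v) = C (A v)" for v
  proof (rule vector_eq_ldot[THEN iffD1], rule allI)
    fix y
    have s: "x \<bullet> B (A y) = B (A x) \<bullet> y" "x \<bullet> C (A y) = C (A x) \<bullet> y" for x y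
      using adjoint_works[OF lAB(3), of x y] adjoint_works[OF lAB(4), of x y] B(4) C(4) by simp_all
    have "y \<bullet> B (A v) = y \<bullet> B (A (C (A v)))" by (simp add: p)
    also have "\<dots> = C (A (B (A y))) \<bullet> v" by (simp only: s)
    also have "\<dots> = y \<bullet> C (A v)" by (simp add: p s)
    finally show "y \<bullet> B (A v) = y \<bullet> C (A v)" .
  qed
  show ?thesis
  proof
    fix v
    have "B v = B (A (B v))" using fun_cong[OF B(2)] by simp
    also have "\<dots> = C (A (C v))" by (simp add: AB BA)
    also have "\<dots> = C v" using fun_cong[OF C(2)] by simp
    finally show "B v = C v" .
  qed
qed

text \<open>In the applications \<open>S\<close> is a tangent space and \<open>A\<close> an operator
  on it, extended by the projection. Injectivity on \<open>S\<close> gives bijectivity there, and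
  the pseudoinverse is the projection followed by the inverse of the restriction: both composites
  equal \<open>closest_point S\<close>, which makes the Penrose equations immediate.\<close>

lemma pseudoinverse_on_subspace:
  fixes A :: "'a::euclidean_space \<Rightarrow> 'a" and S :: "'a set"
  assumes S: "subspace S" and A: "linear A" and AS: "\<And>v. A v \<in> S"
    and AP: "\<And>v. A (closest_point S v) = A v"
    and inj: "\<forall>v\<in>S. A v = 0 \<longrightarrow> v = 0"
  shows "linear (pseudoinverse A)"
    and "pseudoinverse A v \<in> S"
    and "A (pseudoinverse A v) = closest_point S v"
    and "pseudoinverse A (A v) = closest_point S v"
    and "pseudoinverse A (closest_point S v) = pseudoinverse A v"
proof -
  interpret A: linear A by fact
  let ?P = "closest_point S"
  interpret P: linear ?P using linear_closest_point_subspace[OF S] .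
  have inS [simp]: "?P w \<in> S" for w using closest_point_subspace_in[OF S] .
  have PS: "?P w = w" if "w \<in> S" for w using closest_point_self that .
  have injS: "inj_on A (span S)"
    using inj S linear_injective_on_subspace_0[OF A S] by (metis span_eq_iff)
  obtain C where C: "linear C" "\<forall>x\<in>S. C (A x) = x" "range C \<subseteq> S"
    using linear_exists_left_inverse_on[OF A S] injS S[unfolded span_eq_iff[symmetric]] by auto
  have "A ` S = S"
  proof (rule subspace_dim_equal)
    show "subspace (A ` S)" by (rule linear_subspace_image[OF A S])
    show "subspace S" by (rule S)
    show "A ` S \<subseteq> S" using AS by auto
    show "dim (A ` S) \<ge> dim S" using dim_image_eq[OF A injS] by simp
  qed
  then have AC: "A (C w) = w" if "w \<in> S" for w
    using that C(2) by (metis imageE)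
  define B where "B = C \<circ> ?P"
  have lB: "linear B" unfolding B_def by (intro linear_compose P.linear_axioms C)
  have AB: "A \<circ> B = ?P" by (auto simp: B_def AC)
  have BA: "B \<circ> A = ?P"
  proof
    fix w
    have "(B \<circ> A) w = C (A (?P w))" by (simp add: B_def PS[OF AS] AP)
    then show "(B \<circ> A) w = ?P w" using C(2) by simp
  qed
  have adjP: "adjoint ?P = ?P"
    by (rule adjoint_unique) (metis closest_point_subspace_inner[OF S inS] inner_commute)
  have BS: "B w \<in> S" for w using C(3) by (auto simp: B_def)
  have ABA: "A \<circ> B \<circ> A = A" by (simp add: AB fun_eq_iff PS[OF AS])
  have BAB: "B \<circ> A \<circ> B = B" by (simp add: BA fun_eq_iff PS[OF BS])
  have eq: "pseudoinverse A = B"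
    unfolding pseudoinverse_def
  proof (rule the_equality)
    show "linear B \<and> A \<circ> B \<circ> A = A \<and> B \<circ> A \<circ> B = B \<and>
        adjoint (A \<circ> B) = A \<circ> B \<and> adjoint (B \<circ> A) = B \<circ> A"
      using lB ABA BAB by (simp add: AB BA adjP)
    fix B'
    assume "linear B' \<and> A \<circ> B' \<circ> A = A \<and> B' \<circ> A \<circ> B' = B' \<and>
        adjoint (A \<circ> B') = A \<circ> B' \<and> adjoint (B' \<circ> A) = B' \<circ> A"
    then show "B' = B"
      by (elim conjE) (rule Moore_Penrose_unique[OF A _ lB], simp_all add: ABA BAB, simp_all add: AB BA adjP)
  qed
  show "linear (pseudoinverse A)" "pseudoinverse A v \<in> S"
    unfolding eq by (fact lB, fact BS)
  show "A (pseudoinverse A v) = ?P v" "pseudoinverse A (A v) = ?P v"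
    unfolding eq using fun_cong[OF AB, of v] fun_cong[OF BA, of v] unfolding comp_def .
  show "pseudoinverse A (?P v) = pseudoinverse A v"
    unfolding eq by (simp add: B_def PS[OF inS])
qed

section \<open>Gradients and Hessians of twice differentiable functions\<close>

lemma C1_onE:
  assumes "C1_on S f"
  obtains f' where "\<And>x. x \<in> S \<Longrightarrow> (f has_derivative blinfun_apply (f' x)) (at x)" "continuous_on S f'"
  using assms unfolding C1_on_def by auto

lemma C2_onE:
  assumes "C2_on S f"
  obtains f' where "\<And>x. x \<in> S \<Longrightarrow> (f has_derivative blinfun_apply (f' x)) (at x)" "C1_on S f'"
  using assms unfolding C2_on_def by auto

lemma C1_on_subset: "C1_on S f \<Longrightarrow> T \<subseteq> S \<Longrightarrow> C1_on T f"
  unfolding C1_on_def using continuous_on_subset by blast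

lemma C2_on_subset: "C2_on S f \<Longrightarrow> T \<subseteq> S \<Longrightarrow> C2_on T f"
  unfolding C2_on_def using C1_on_subset by blast

lemma C1_on_imp_continuous_on: "C1_on S f \<Longrightarrow> continuous_on S f"
  unfolding C1_on_def
  by (meson continuous_at_imp_continuous_on has_derivative_continuous)

lemma C1_on_cong:
  assumes "C1_on S f" "open S" "\<And>x. x \<in> S \<Longrightarrow> f x = g x"
  shows "C1_on S g"
  using assms unfolding C1_on_def
  by (metis (no_types, lifting) has_derivative_transform_within_open)

lemma C1_on_add:
  assumes "C1_on S f" "C1_on S g"
  shows "C1_on S (\<lambda>x. f x + g x)"
proof -
  obtain f' g' where "\<And>x. x \<in> S \<Longrightarrow> (f has_derivative blinfun_apply (f' x)) (at x)" "continuous_on S f'"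
    "\<And>x. x \<in> S \<Longrightarrow> (g has_derivative blinfun_apply (g' x)) (at x)" "continuous_on S g'"
    using C1_onE[OF assms(1)] C1_onE[OF assms(2)] by metis
  then show ?thesis unfolding C1_on_def
    by (intro exI[of _ "\<lambda>x. f' x + g' x"])
      (auto simp: plus_blinfun.rep_eq intro!: has_derivative_add continuous_intros)
qed

lemma C2_on_add:
  assumes "C2_on S f" "C2_on S g"
  shows "C2_on S (\<lambda>x. f x + g x)"
proof -
  obtain f' g' where "\<And>x. x \<in> S \<Longrightarrow> (f has_derivative blinfun_apply (f' x)) (at x)" "C1_on S f'"
    "\<And>x. x \<in> S \<Longrightarrow> (g has_derivative blinfun_apply (g' x)) (at x)" "C1_on S g'"
    using C2_onE[OF assms(1)] C2_onE[OF assms(2)] by metis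
  then show ?thesis unfolding C2_on_def
    by (intro exI[of _ "\<lambda>x. f' x + g' x"])
      (auto simp: plus_blinfun.rep_eq intro!: has_derivative_add C1_on_add)
qed

lemma C1_on_bounded_linear:
  assumes "C1_on S f" "bounded_linear T"
  shows "C1_on S (\<lambda>x. T (f x))"
proof -
  obtain f' where f': "\<And>x. x \<in> S \<Longrightarrow> (f has_derivative blinfun_apply (f' x)) (at x)" "continuous_on S f'"
    using C1_onE[OF assms(1)] by metis
  have *: "blinfun_apply (Blinfun T) = T" using assms(2) by (rule bounded_linear_Blinfun_apply)
  show ?thesis unfolding C1_on_def
  proof (intro exI[of _ "\<lambda>x. Blinfun T o\<^sub>L f' x"] conjI ballI)
    fix x assume "x \<in> S"
    show "((\<lambda>x. T (f x)) has_derivative blinfun_apply (Blinfun T o\<^sub>L f' x)) (at x)"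
      using bounded_linear.has_derivative[OF assms(2) f'(1)[OF \<open>x \<in> S\<close>]]
      by (simp add: * comp_def blinfun_compose.rep_eq)
  qed (intro continuous_intros f'(2))
qed

lemma C1_on_affine:
  assumes "C1_on S f"
  shows "C1_on {x. c + blinfun_apply T x \<in> S} (\<lambda>x. f (c + blinfun_apply T x))"
proof -
  obtain f' where f': "\<And>x. x \<in> S \<Longrightarrow> (f has_derivative blinfun_apply (f' x)) (at x)" "continuous_on S f'"
    using C1_onE[OF assms(1)] by metis
  show ?thesis unfolding C1_on_def
  proof (intro exI[of _ "\<lambda>x. f' (c + blinfun_apply T x) o\<^sub>L T"] conjI ballI)
    fix x assume x: "x \<in> {x. c + blinfun_apply T x \<in> S}"
    have "((\<lambda>x. c + blinfun_apply T x) has_derivative blinfun_apply T) (at x)"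
      by (auto intro!: derivative_eq_intros bounded_linear_imp_has_derivative blinfun.bounded_linear_right)
    then show "((\<lambda>x. f (c + blinfun_apply T x)) has_derivative
        blinfun_apply (f' (c + blinfun_apply T x) o\<^sub>L T)) (at x)"
      using has_derivative_compose f'(1) x by (fastforce simp: blinfun_compose.rep_eq comp_def)
  qed (auto intro!: continuous_intros continuous_on_compose2[OF f'(2)])
qed

lemma C2_on_affine:
  assumes "C2_on S f"
  shows "C2_on {x. c + blinfun_apply T x \<in> S} (\<lambda>x. f (c + blinfun_apply T x))"
proof -
  obtain f' where f': "\<And>x. x \<in> S \<Longrightarrow> (f has_derivative blinfun_apply (f' x)) (at x)" "C1_on S f'"
    using C2_onE[OF assms(1)] by metis
  show ?thesis unfolding C2_on_def
  proof (intro exI[of _ "\<lambda>x. f' (c + blinfun_apply T x) o\<^sub>L T"] conjI ballI)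
    fix x assume x: "x \<in> {x. c + blinfun_apply T x \<in> S}"
    have "((\<lambda>x. c + blinfun_apply T x) has_derivative blinfun_apply T) (at x)"
      by (auto intro!: derivative_eq_intros bounded_linear_imp_has_derivative blinfun.bounded_linear_right)
    then show "((\<lambda>x. f (c + blinfun_apply T x)) has_derivative
        blinfun_apply (f' (c + blinfun_apply T x) o\<^sub>L T)) (at x)"
      using has_derivative_compose f'(1) x by (fastforce simp: blinfun_compose.rep_eq comp_def)
  next
    show "C1_on {x. c + blinfun_apply T x \<in> S} (\<lambda>x. f' (c + blinfun_apply T x) o\<^sub>L T)"
      by (rule C1_on_bounded_linear[OF C1_on_affine[OF f'(2)]])
        (rule bounded_bilinear.bounded_linear_left[OF bounded_bilinear_blinfun_compose])
  qed
qed

lemma grad_eqI: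
  assumes "(h has_derivative (\<lambda>v. v \<bullet> d)) (at x)"
  shows "grad h x = d"
  unfolding grad_def gderiv_def
proof (rule the_equality[of _ d])
  fix d' assume "(h has_derivative (\<lambda>v. v \<bullet> d')) (at x)"
  then have "(\<lambda>v. v \<bullet> d') = (\<lambda>v. v \<bullet> d)" using assms has_derivative_unique by blast
  then show "d' = d" by (metis vector_eq_ldot)
qed (rule assms)

lemma has_derivative_grad:
  assumes "(h has_derivative h') (at x)"
  shows "(h has_derivative (\<lambda>v. v \<bullet> grad h x)) (at x)"
proof -
  have l: "linear h'" using assms has_derivative_linear by blast
  have "h' = (\<lambda>v. v \<bullet> adjoint h' 1)" using adjoint_works[OF l, of _ 1] by (simp add: fun_eq_iff)
  then have "(h has_derivative (\<lambda>v. v \<bullet> adjoint h' 1)) (at x)" using assms by metis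
  then show ?thesis using grad_eqI by metis
qed

text \<open>Exhibits the gradient as a bounded linear image of the derivative, so that smoothness
  passes from the derivative to \<open>grad\<close>.\<close>

lemma grad_eq_sum_Basis:
  fixes x :: "'a::euclidean_space"
  assumes "(h has_derivative h') (at x)"
  shows "grad h x = (\<Sum>b\<in>Basis. h' b *\<^sub>R b)"
proof -
  have "h' = (\<lambda>v. v \<bullet> grad h x)" using has_derivative_unique[OF assms has_derivative_grad[OF assms]] .
  then show ?thesis using euclidean_representation[of "grad h x"] by (metis (no_types, lifting) inner_commute sum.cong)
qed

lemma C2_on_has_derivative_grad:
  "C2_on S h \<Longrightarrow> x \<in> S \<Longrightarrow> (h has_derivative (\<lambda>v. v \<bullet> grad h x)) (at x)"
  using has_derivative_grad C2_onE by metis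

lemma C2_on_imp_C1_on_grad:
  assumes "C2_on S h" "open S"
  shows "C1_on S (grad h)"
proof -
  obtain h' where h': "\<And>x. x \<in> S \<Longrightarrow> (h has_derivative blinfun_apply (h' x)) (at x)" "C1_on S h'"
    using C2_onE[OF assms(1)] by metis
  have "bounded_linear (\<lambda>A. \<Sum>b\<in>Basis. blinfun_apply A b *\<^sub>R (b::'a))"
    by (intro bounded_linear_intros blinfun.bounded_linear_left)
  from C1_on_bounded_linear[OF h'(2) this]
  show ?thesis
    using C1_on_cong[OF _ assms(2)] grad_eq_sum_Basis[OF h'(1)] by (metis (no_types, lifting))
qed

lemma C2_on_hess:
  assumes "C2_on S h" "open S"
  obtains H :: "'a::euclidean_space \<Rightarrow> 'a \<Rightarrow>\<^sub>L 'a"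
  where "\<And>x. x \<in> S \<Longrightarrow> hess h x = blinfun_apply (H x)"
    "\<And>x. x \<in> S \<Longrightarrow> (grad h has_derivative blinfun_apply (H x)) (at x)"
    "continuous_on S H"
proof -
  obtain H where H: "\<And>x. x \<in> S \<Longrightarrow> (grad h has_derivative blinfun_apply (H x)) (at x)" "continuous_on S H"
    using C1_onE[OF C2_on_imp_C1_on_grad[OF assms]] by metis
  show thesis
    by (rule that[OF _ H]) (simp_all add: hess_def frechet_derivative_at[OF H(1), symmetric])
qed

lemma grad_add:
  assumes "(f has_derivative f') (at x)" "(g has_derivative g') (at x)"
  shows "grad (\<lambda>x. f x + g x) x = grad f x + grad g x"
  using has_derivative_add[OF has_derivative_grad[OF assms(1)] has_derivative_grad[OF assms(2)]]
  by (intro grad_eqI) (simp add: inner_add_right)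

section \<open>Partial gradients and Hessians of functions on a product\<close>

lemma C2_on_slice:
  assumes "C2_on S F"
  shows "C2_on {x. (x, u) \<in> S} (\<lambda>x. F (x, u))"
proof -
  have "blinfun_apply (Blinfun (\<lambda>x::'a. (x, 0::'b))) = (\<lambda>x. (x, 0))"
    by (intro bounded_linear_Blinfun_apply bounded_linear_intros)
  then show ?thesis
    using C2_on_affine[OF assms, of "(0, u)" "Blinfun (\<lambda>x::'a. (x, 0::'b))"] by simp
qed

lemma C2_on_slice_grad:
  assumes "C2_on S F" "(x, u) \<in> S"
  shows "grad (\<lambda>x. F (x, u)) x = fst (grad F (x, u))"
proof (rule grad_eqI)
  have d: "((\<lambda>x. (x, u)) has_derivative (\<lambda>v. (v, 0))) (at x)"
    by (auto intro!: derivative_eq_intros)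
  show "((\<lambda>x. F (x, u)) has_derivative (\<lambda>v. v \<bullet> fst (grad F (x, u)))) (at x)"
    using has_derivative_compose[OF d C2_on_has_derivative_grad[OF assms]] by (simp add: inner_prod_def)
qed

text \<open>A single continuous \<open>H\<close>, the joint derivative of the partial gradient,
  yields the partial Hessian on vectors \<open>(v, 0)\<close> and the mixed derivative on
  \<open>(0, w)\<close>. This allows one chain rule along \<open>u \<mapsto> (\<psi> u, u)\<close>
  and one continuity statement in \<open>(x, u)\<close>.\<close>

lemma C2_on_slice_hess:
  assumes "C2_on S F" "open S"
  obtains H :: "'a::euclidean_space \<times> 'b::euclidean_space \<Rightarrow> ('a \<times> 'b) \<Rightarrow>\<^sub>L 'a"
  where "\<And>x u. (x, u) \<in> S \<Longrightarrow> hess (\<lambda>x. F (x, u)) x = (\<lambda>v. blinfun_apply (H (x, u)) (v, 0))"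
    "\<And>z. z \<in> S \<Longrightarrow> ((\<lambda>z. grad (\<lambda>x. F (x, snd z)) (fst z)) has_derivative blinfun_apply (H z)) (at z)"
    "\<And>x u. (x, u) \<in> S \<Longrightarrow>
      ((\<lambda>u. grad (\<lambda>x. F (x, u)) x) has_derivative (\<lambda>w. blinfun_apply (H (x, u)) (0, w))) (at u)"
    "continuous_on S H"
proof -
  let ?G = "\<lambda>z. grad (\<lambda>x. F (x, snd z)) (fst z)"
  have "C1_on S (\<lambda>z. fst (grad F z))"
    by (intro C1_on_bounded_linear[OF C2_on_imp_C1_on_grad[OF assms]] bounded_linear_fst)
  then have G: "C1_on S ?G"
    by (rule C1_on_cong[OF _ assms(2)]) (metis C2_on_slice_grad[OF assms(1)] prod.collapse)
  obtain H where H: "\<And>z. z \<in> S \<Longrightarrow> (?G has_derivative blinfun_apply (H z)) (at z)" "continuous_on S H"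
    by (rule C1_onE[OF G]) blast
  show thesis
  proof (rule that[of H])
    fix x u assume z: "(x, u) \<in> S"
    have "((\<lambda>x. (x, u)) has_derivative (\<lambda>v. (v, 0))) (at x)"
      by (auto intro!: derivative_eq_intros)
    from has_derivative_compose[OF this H(1)[OF z]]
    have "(grad (\<lambda>x. F (x, u)) has_derivative (\<lambda>v. H (x, u) (v, 0))) (at x)" by simp
    then show "hess (\<lambda>x. F (x, u)) x = (\<lambda>v. blinfun_apply (H (x, u)) (v, 0))"
      unfolding hess_def by (metis frechet_derivative_at)
    have "((\<lambda>u. (x, u)) has_derivative (\<lambda>w. (0, w))) (at u)"
      by (auto intro!: derivative_eq_intros)
    from has_derivative_compose[OF this H(1)[OF z]]
    show "((\<lambda>u. grad (\<lambda>x. F (x, u)) x) has_derivative (\<lambda>w. blinfun_apply (H (x, u)) (0, w))) (at u)"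
      by simp
  qed (use H in auto)
qed

text \<open>If \<open>D\<close> were negative, \<open>q'\<close> would be negative just to the right
  of 0, and the mean value theorem would put \<open>q s\<close> below \<open>q 0\<close>.\<close>

lemma second_derivative_local_min_nonneg:
  fixes q q' :: "real \<Rightarrow> real"
  assumes e: "0 < e" and q: "\<And>s. \<bar>s\<bar> < e \<Longrightarrow> (q has_real_derivative q' s) (at s)"
    and q': "(q' has_real_derivative D) (at 0)"
    and min: "\<And>s. \<bar>s\<bar> < e \<Longrightarrow> q 0 \<le> q s"
  shows "q' 0 = 0" and "0 \<le> D"
proof -
  show 0: "q' 0 = 0" using DERIV_local_min[of q "q' 0" 0 e] q[of 0] e min by auto
  show "0 \<le> D"
  proof (rule ccontr)
    assume "\<not> 0 \<le> D"
    then obtain d where d: "0 < d" "\<And>h. 0 < h \<Longrightarrow> h < d \<Longrightarrow> q' h < 0"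
      using DERIV_neg_dec_right[OF q'] 0 by auto
    define s where "s = min d e / 2"
    have s: "0 < s" "s < d" "s < e" using d(1) e by (auto simp: s_def)
    have "\<exists>z. 0 < z \<and> z < s \<and> q s - q 0 = (s - 0) * q' z"
      using s by (intro MVT2) (auto intro!: q)
    then obtain z where z: "0 < z" "z < s" "q s - q 0 = (s - 0) * q' z" by blast
    have "q' z < 0" using d(2) z s by auto
    then have "q s < q 0" using z s by (smt (verit) mult_pos_neg)
    then show False using min[of s] s by auto
  qed
qed

section \<open>Subgradients of regular functions\<close>

text \<open>Later normalises the last component of an epigraph normal to -1.\<close>

lemma regular_normals_scale:
  assumes "v \<in> regular_normals C z" "0 \<le> (c::real)"
  shows "c *\<^sub>R v \<in> regular_normals C z"
proof (cases "c = 0")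
  case False
  then have c: "0 < c" using assms by simp
  show ?thesis unfolding regular_normals_def
  proof (intro CollectI allI impI)
    fix e :: real assume "0 < e"
    then have "0 < e / c" using c by simp
    then have "\<forall>\<^sub>F y in at z within C. v \<bullet> (y - z) \<le> e / c * norm (y - z)"
      using assms(1) unfolding regular_normals_def by blast
    then show "\<forall>\<^sub>F y in at z within C. (c *\<^sub>R v) \<bullet> (y - z) \<le> e * norm (y - z)"
      by eventually_elim (use c in \<open>simp add: field_simps\<close>)
  qed
qed (simp add: regular_normals_def)

lemma regular_normals_add:
  assumes "v \<in> regular_normals C z" "w \<in> regular_normals C z"
  shows "v + w \<in> regular_normals C z"
  unfolding regular_normals_def
proof (intro CollectI allI impI)
  fix e :: real assume "0 < e"
  then have "0 < e / 2" by simp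
  then have "\<forall>\<^sub>F y in at z within C. v \<bullet> (y - z) \<le> e / 2 * norm (y - z)"
    "\<forall>\<^sub>F y in at z within C. w \<bullet> (y - z) \<le> e / 2 * norm (y - z)"
    using assms unfolding regular_normals_def by blast+
  then show "\<forall>\<^sub>F y in at z within C. (v + w) \<bullet> (y - z) \<le> e * norm (y - z)"
    by eventually_elim (simp add: inner_add_left)
qed

lemma regular_subdiff_imp_regular_normal:
  assumes "p \<in> regular_subdiff h z"
  shows "(p, -1) \<in> regular_normals (epi h) (z, real_of_ereal (h z))"
  unfolding regular_normals_def
proof (intro CollectI allI impI)
  obtain r0 where r0: "h z = ereal r0" using assms unfolding regular_subdiff_def by (cases "h z") auto
  fix e :: real assume e: "0 < e"
  then have "\<forall>\<^sub>F y in at z. h z + ereal (p \<bullet> (y - z) - e * norm (y - z)) \<le> h y"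
    using assms unfolding regular_subdiff_def by blast
  then obtain d where d: "0 < d"
    "\<And>y. y \<noteq> z \<Longrightarrow> dist y z < d \<Longrightarrow> h z + ereal (p \<bullet> (y - z) - e * norm (y - z)) \<le> h y"
    unfolding eventually_at by blast
  show "\<forall>\<^sub>F Y in at (z, real_of_ereal (h z)) within epi h.
      (p, - 1) \<bullet> (Y - (z, real_of_ereal (h z))) \<le> e * norm (Y - (z, real_of_ereal (h z)))"
    unfolding eventually_at
  proof (intro exI[of _ d] conjI ballI impI d(1), elim conjE)
    fix Y assume Y: "Y \<in> epi h" "dist Y (z, real_of_ereal (h z)) < d"
    obtain y r where yr: "Y = (y, r)" by (cases Y)
    have hy: "h y \<le> ereal r" using Y yr by (simp add: epi_def)
    have dy: "dist y z < d" using Y(2) dist_fst_le[of Y "(z, real_of_ereal (h z))"] by (simp add: yr)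
    have n: "norm (y - z) \<le> norm (Y - (z, r0))"
      using norm_fst_le[of "y - z" "r - r0"] by (simp add: yr)
    have "p \<bullet> (y - z) - (r - r0) \<le> e * norm (y - z)"
    proof (cases "y = z")
      case True then show ?thesis using hy r0 by simp
    next
      case False
      then have "ereal (r0 + (p \<bullet> (y - z) - e * norm (y - z))) \<le> ereal r"
        using d(2)[OF _ dy] hy r0 by (metis order_trans plus_ereal.simps(1))
      then show ?thesis by simp
    qed
    also have "\<dots> \<le> e * norm (Y - (z, r0))" using n e by simp
    finally show "(p, - 1) \<bullet> (Y - (z, real_of_ereal (h z))) \<le> e * norm (Y - (z, real_of_ereal (h z)))"
      by (simp add: r0 yr)
  qed
qed

text \<open>The error must shrink from the norm of a pair to that of its first component. This is
  possible because a violation of the subgradient inequality at \<open>y\<close> yields an epigraph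
  point whose height differs from \<open>r0\<close> by at most a multiple of
  \<open>norm (y - z)\<close>.\<close>

lemma regular_normal_imp_regular_subdiff:
  assumes fin: "\<bar>h z\<bar> \<noteq> \<infinity>" and p: "(p, -1) \<in> regular_normals (epi h) (z, real_of_ereal (h z))"
  shows "p \<in> regular_subdiff h z"
proof -
  obtain r0 where r0: "h z = ereal r0" using fin by (cases "h z") auto
  have "\<forall>\<^sub>F y in at z. h z + ereal (p \<bullet> (y - z) - e * norm (y - z)) \<le> h y" if e: "0 < e" for e
  proof -
    \<comment> \<open>\<open>K * norm (y - z)\<close> bounds the norm of the pair at a violating
      point; with precision \<open>e / (2 * K)\<close> the normal inequality would force
      \<open>e\<close> to be at most \<open>e / 2\<close>.\<close>
    define K where "K = 1 + norm p + e"
    have K: "0 < K" using e unfolding K_def by (simp add: add_nonneg_pos)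
    have "0 < e / (2 * K)" using e K by simp
    then obtain d where d: "0 < d" and dY: "\<And>Y. Y \<in> epi h \<Longrightarrow> Y \<noteq> (z, r0) \<Longrightarrow> dist Y (z, r0) < d \<Longrightarrow>
        (p, -1) \<bullet> (Y - (z, r0)) \<le> e / (2 * K) * norm (Y - (z, r0))"
      using p unfolding regular_normals_def eventually_at r0 by fastforce
    show ?thesis
      unfolding eventually_at
    proof (intro exI[of _ "d / K"] conjI ballI impI, goal_cases)
      case 1 show ?case using d K by simp
    next
      case (2 y)
      show ?case
      proof (rule ccontr)
        \<comment> \<open>A violation places this height in the epigraph over \<open>y\<close>;
          there the left side of the normal inequality is exactly
          \<open>e * norm (y - z)\<close>.\<close>
        define r where "r = r0 + (p \<bullet> (y - z) - e * norm (y - z))"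
        assume "\<not> ?case"
        then have "h y < ereal r" by (simp add: r0 r_def)
        then have Y: "(y, r) \<in> epi h" by (simp add: epi_def)
        have pos: "0 < norm (y - z)" using 2 by simp
        have "norm ((y, r) - (z, r0)) \<le> norm (y - z) + \<bar>r - r0\<bar>"
          using norm_Pair_le[of "y - z" "r - r0"] by simp
        also have "\<bar>r - r0\<bar> \<le> norm p * norm (y - z) + e * norm (y - z)"
        proof -
          have "\<bar>r - r0\<bar> = \<bar>p \<bullet> (y - z) - e * norm (y - z)\<bar>" by (simp add: r_def)
          also have "\<dots> \<le> \<bar>p \<bullet> (y - z)\<bar> + \<bar>e * norm (y - z)\<bar>" by (rule abs_triangle_ineq4)
          also have "\<dots> \<le> norm p * norm (y - z) + e * norm (y - z)"
            using Cauchy_Schwarz_ineq2[of p "y - z"] e by (simp add: abs_mult)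
          finally show ?thesis .
        qed
        finally have nK: "norm ((y, r) - (z, r0)) \<le> K * norm (y - z)"
          by (simp add: K_def algebra_simps)
        also have "\<dots> < d" using 2 K by (simp add: dist_norm field_simps)
        finally have "dist (y, r) (z, r0) < d" by (simp add: dist_norm)
        then have "p \<bullet> (y - z) - (r - r0) \<le> e / (2 * K) * norm ((y, r) - (z, r0))"
          using dY[OF Y] 2 by simp
        also have "\<dots> \<le> e / (2 * K) * (K * norm (y - z))"
          using e K nK by (intro mult_left_mono) auto
        also have "\<dots> = e / 2 * norm (y - z)" using K by simp
        finally show False using e pos by (simp add: r_def)
      qed
    qed
  qed
  then show ?thesis using fin unfolding regular_subdiff_def by blast
qed

text \<open>Regularity is stated for normals of the epigraph. A limiting subgradient gives a
  limiting normal with last component -1, whose base points converge because the definition includes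
  convergence of values; regularity makes this normal regular, and it translates back.\<close>

lemma limiting_subdiff_eq_regular_subdiff:
  assumes "regular_fun_at h z"
  shows "limiting_subdiff h z = regular_subdiff h z"
proof (intro equalityI subsetI)
  fix p assume "p \<in> limiting_subdiff h z"
  then obtain xs vs where s: "\<And>n. vs n \<in> regular_subdiff h (xs n)" "xs \<longlonglongrightarrow> z"
      "(\<lambda>n. h (xs n)) \<longlonglongrightarrow> h z" "vs \<longlonglongrightarrow> p"
    unfolding limiting_subdiff_def by blast
  have fin: "\<bar>h z\<bar> \<noteq> \<infinity>" and cl: "clarke_regular (epi h) (z, real_of_ereal (h z))"
    using assms unfolding regular_fun_at_def by auto
  have fin': "\<bar>h (xs n)\<bar> \<noteq> \<infinity>" for n using s(1)[of n] by (simp add: regular_subdiff_def)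
  have r: "(\<lambda>n. real_of_ereal (h (xs n))) \<longlonglongrightarrow> real_of_ereal (h z)"
    by (rule lim_real_of_ereal) (use s(3) fin in \<open>simp add: ereal_real\<close>)
  have "(p, -1) \<in> limiting_normals (epi h) (z, real_of_ereal (h z))"
    unfolding limiting_normals_def
  proof (intro CollectI exI conjI allI)
    show "(\<lambda>n. (xs n, real_of_ereal (h (xs n)))) \<longlonglongrightarrow> (z, real_of_ereal (h z))"
      by (intro tendsto_Pair s r)
    show "(\<lambda>n. (vs n, -1)) \<longlonglongrightarrow> (p, -1)" by (intro tendsto_Pair s tendsto_const)
    show "(xs n, real_of_ereal (h (xs n))) \<in> epi h" for n using fin' by (simp add: epi_def ereal_real)
    show "(vs n, -1) \<in> regular_normals (epi h) (xs n, real_of_ereal (h (xs n)))" for n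
      by (rule regular_subdiff_imp_regular_normal[OF s(1)])
  qed
  then show "p \<in> regular_subdiff h z"
    by (intro regular_normal_imp_regular_subdiff) (use fin cl in \<open>auto simp: clarke_regular_def\<close>)
next
  fix p assume "p \<in> regular_subdiff h z"
  then have "\<exists>xs vs. (\<forall>n. vs n \<in> regular_subdiff h (xs n)) \<and>
      xs \<longlonglongrightarrow> z \<and> (\<lambda>n. h (xs n)) \<longlonglongrightarrow> h z \<and> vs \<longlonglongrightarrow> p"
    by (intro exI[of _ "\<lambda>_. p"] exI[of _ "\<lambda>_. z"]) simp
  then show "p \<in> limiting_subdiff h z"
    using assms unfolding limiting_subdiff_def regular_fun_at_def by simp
qed

text \<open>On the segment from \<open>x\<close> to \<open>y\<close>, convexity bounds
  \<open>h\<close> by linear interpolation, so the local inequality at a small step \<open>t\<close>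
  can be divided by \<open>t\<close> and becomes the inequality at \<open>y\<close> up to an
  arbitrary error \<open>k\<close>.\<close>

lemma regular_subdiff_subset_convex_subdiff:
  assumes cv: "convex_fun h" and nm: "\<And>y. h y \<noteq> -\<infinity>"
  shows "regular_subdiff h x \<subseteq> convex_subdiff h x"
proof
  fix v assume v: "v \<in> regular_subdiff h x"
  then have fin: "\<bar>h x\<bar> \<noteq> \<infinity>" by (simp add: regular_subdiff_def)
  then obtain r0 where r0: "h x = ereal r0" by (cases "h x") auto
  have "h x + ereal (v \<bullet> (y - x)) \<le> h y" for y
  proof (cases "h y = \<infinity> \<or> y = x")
    case False
    then obtain r where r: "h y = ereal r" using nm[of y] by (cases "h y") auto
    have pos: "0 < norm (y - x)" using False by simp
    have "v \<bullet> (y - x) \<le> r - r0 + k" if k: "0 < k" for k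
    proof -
      define e where "e = k / norm (y - x)"
      have e: "0 < e" using k pos by (simp add: e_def)
      then have "\<forall>\<^sub>F y in at x. h x + ereal (v \<bullet> (y - x) - e * norm (y - x)) \<le> h y"
        using v unfolding regular_subdiff_def by blast
      then obtain d where d: "0 < d"
        "\<And>y. y \<noteq> x \<Longrightarrow> dist y x < d \<Longrightarrow> h x + ereal (v \<bullet> (y - x) - e * norm (y - x)) \<le> h y"
        unfolding eventually_at by blast
      \<comment> \<open>At most 1, for convexity, and short enough to stay within distance
        \<open>d\<close> of \<open>x\<close>.\<close>
      define t where "t = min 1 (d / (2 * norm (y - x)))"
      have t: "0 < t" "t \<le> 1" "t * norm (y - x) < d"
        using d(1) pos by (auto simp: t_def min_def field_simps)
      define yt where "yt = x + t *\<^sub>R (y - x)"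
      have yt: "yt \<noteq> x" "dist yt x < d" "yt - x = t *\<^sub>R (y - x)"
        using t False by (auto simp: yt_def dist_norm)
      have "(1 - t) *\<^sub>R (x, r0) + t *\<^sub>R (y, r) \<in> epi h"
        using cv t unfolding convex_fun_def
        by (intro convexD) (auto simp: epi_def r0 r)
      then have "h yt \<le> ereal ((1 - t) * r0 + t * r)"
        by (simp add: epi_def yt_def algebra_simps)
      then have "ereal (r0 + (v \<bullet> (yt - x) - e * norm (yt - x))) \<le> ereal ((1 - t) * r0 + t * r)"
        using d(2)[OF yt(1,2)] r0 by (metis order_trans plus_ereal.simps(1))
      then have "r0 + (t * (v \<bullet> (y - x)) - e * (t * norm (y - x))) \<le> (1 - t) * r0 + t * r"
        using t by (simp add: yt(3))
      then have "t * (v \<bullet> (y - x) - e * norm (y - x)) \<le> t * (r - r0)"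
        by (simp add: algebra_simps)
      then have "v \<bullet> (y - x) - e * norm (y - x) \<le> r - r0" using t by simp
      then show ?thesis using pos by (simp add: e_def)
    qed
    then have "v \<bullet> (y - x) \<le> r - r0" by (rule field_le_epsilon)
    then show ?thesis by (simp add: r r0)
  qed (auto simp: r0)
  then show "v \<in> convex_subdiff h x" using fin unfolding convex_subdiff_def by blast
qed

lemma regular_subdiff_slice:
  assumes "(v, w) \<in> regular_subdiff g (x, u)"
  shows "v \<in> regular_subdiff (\<lambda>x. g (x, u)) x"
proof -
  have "filterlim (\<lambda>y. (y, u)) (at (x, u)) (at x)"
    by (auto simp: filterlim_at eventually_at_filter intro!: tendsto_intros)
  note lim = this
  have ev: "\<forall>\<^sub>F y in at x. P (y, u)" if "\<forall>\<^sub>F z in at (x, u). P z" for P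
    by (rule eventually_compose_filterlim[OF that lim])
  show ?thesis unfolding regular_subdiff_def
  proof (intro CollectI conjI allI impI)
    fix e :: real assume "0 < e"
    then have "\<forall>\<^sub>F z in at (x, u). g (x, u) + ereal ((v, w) \<bullet> (z - (x, u)) - e * norm (z - (x, u))) \<le> g z"
      using assms unfolding regular_subdiff_def by blast
    from ev[OF this] show "\<forall>\<^sub>F y in at x. g (x, u) + ereal (v \<bullet> (y - x) - e * norm (y - x)) \<le> g (y, u)"
      by simp
  qed (use assms in \<open>auto simp: regular_subdiff_def\<close>)
qed

section \<open>Minimisers of lower semicontinuous functions and lifting of partial
  subgradients\<close>

lemma lsc_funD:
  assumes "lsc_fun h" "c < h x"
  shows "\<forall>\<^sub>F y in nhds x. c < h y"
proof -
  have "h x \<le> Liminf (at x) h" using assms unfolding lsc_fun_def by blast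
  then have "\<forall>\<^sub>F y in at x. c < h y" using assms(2) unfolding le_Liminf_iff by blast
  then show ?thesis using assms(2) by (auto simp: eventually_at_filter elim: eventually_mono)
qed

text \<open>Otherwise each \<open>x\<close> has a better \<open>Y x\<close>, and \<open>q\<close>
  exceeds \<open>q (Y x)\<close> on a neighbourhood \<open>T x\<close>. In a finite subcover the
  \<open>Y c\<close> with the least value lies in some \<open>T d\<close>, so \<open>Y d\<close> has
  a smaller value still.\<close>

lemma lsc_attains_inf:
  fixes q :: "'a::topological_space \<Rightarrow> ereal"
  assumes "compact K" "K \<noteq> {}"
    and lsc: "\<And>x y. x \<in> K \<Longrightarrow> y \<in> K \<Longrightarrow> q y < q x \<Longrightarrow> \<forall>\<^sub>F z in nhds x. q y < q z"
  obtains x where "x \<in> K" "\<And>y. y \<in> K \<Longrightarrow> q x \<le> q y"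
proof (rule ccontr)
  assume "\<not> thesis"
  then have "\<forall>x\<in>K. \<exists>y\<in>K. q y < q x" using that by (metis not_le)
  then obtain Y where Y: "\<And>x. x \<in> K \<Longrightarrow> Y x \<in> K \<and> q (Y x) < q x" by metis
  have "\<forall>x\<in>K. \<exists>T. open T \<and> x \<in> T \<and> (\<forall>z\<in>T. q (Y x) < q z)"
    using lsc Y unfolding eventually_nhds by blast
  then obtain T where T: "\<And>x. x \<in> K \<Longrightarrow> open (T x) \<and> x \<in> T x \<and> (\<forall>z\<in>T x. q (Y x) < q z)" by metis
  obtain C where C: "C \<subseteq> K" "finite C" "K \<subseteq> (\<Union>c\<in>C. T c)"
    using compactE_image[OF assms(1), of K T] T by blast
  have "C \<noteq> {}" using C assms(2) by blast
  then obtain c where c: "c \<in> C" "\<forall>d\<in>C. q (Y c) \<le> q (Y d)"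
    using arg_min_if_finite[OF C(2), of "\<lambda>d. q (Y d)"] by (meson not_le)
  have "Y c \<in> K" using c C Y by blast
  then obtain d where "d \<in> C" "Y c \<in> T d" using C by blast
  then have "q (Y d) < q (Y c)" using T C by blast
  then show False using c \<open>d \<in> C\<close> by (metis not_le)
qed

text \<open>Fermat's rule with a smooth perturbation \<open>s\<close>: the remainder of its first
  order expansion is absorbed by \<open>e * norm (y - z)\<close>.\<close>

lemma local_min_imp_regular_subdiff:
  assumes fin: "\<bar>h z\<bar> \<noteq> \<infinity>" and s: "(s has_derivative (\<lambda>k. k \<bullet> d)) (at z)"
    and min: "\<forall>\<^sub>F y in nhds z. h z + ereal (s z) \<le> h y + ereal (s y)"
  shows "- d \<in> regular_subdiff h z"
  unfolding regular_subdiff_def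
proof (intro CollectI conjI allI impI fin)
  obtain r0 where r0: "h z = ereal r0" using fin by (cases "h z") auto
  fix e :: real assume e: "0 < e"
  have "\<forall>\<^sub>F y in at z. norm (s y - s z - (y - z) \<bullet> d) \<le> e * norm (y - z)"
    using s e unfolding has_derivative_within_alt2 by auto
  moreover have "\<forall>\<^sub>F y in at z. h z + ereal (s z) \<le> h y + ereal (s y)"
    unfolding eventually_at_filter by (rule eventually_mono[OF min]) simp
  ultimately show "\<forall>\<^sub>F y in at z. h z + ereal (- d \<bullet> (y - z) - e * norm (y - z)) \<le> h y"
  proof eventually_elim
    case (elim y)
    then show ?case by (cases "h y") (auto simp: r0 inner_commute)
  qed
qed

text \<open>Every partial subgradient lifts to a joint one. A partial subgradient \<open>v\<close> makes \<open>(x, u)\<close> the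
  limit of the minimisers of \<open>g - v \<bullet> (\<cdot> - x) + |\<cdot> - x|\<^sup>2 + n |\<cdot> - u|\<^sup>2\<close>. The subgradients of \<open>g\<close>
  at these minimisers are close to \<open>v\<close> in the first component. If the second components stay bounded,
  a limit lifts \<open>v\<close>; if not, they yield a horizontal normal \<open>((0, \<omega>), 0)\<close> of the epigraph, which by
  regularity is a recession direction of the subdifferential, contradicting the last assumption.\<close>

proposition convex_subdiff_slice_lifts:
  fixes g :: "'a::euclidean_space \<times> 'b::euclidean_space \<Rightarrow> ereal"
  assumes pr: "proper_fun g" and lsc: "lsc_fun g" and reg: "regular_fun_at g (x, u)"
    and v: "v \<in> convex_subdiff (\<lambda>x. g (x, u)) x"
    and ne: "limiting_subdiff g (x, u) \<noteq> {}"
    and par: "\<And>w. (0, w) \<in> parallel_subspace (limiting_subdiff g (x, u)) \<Longrightarrow> w = 0"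
  shows "\<exists>w. (v, w) \<in> limiting_subdiff g (x, u)"
proof -
  define z where "z = (x, u)"
  have fin: "\<bar>g z\<bar> \<noteq> \<infinity>" using reg unfolding regular_fun_at_def z_def by simp
  then obtain r0 where r0: "g z = ereal r0" by (cases "g z") auto
  have nm: "g y \<noteq> -\<infinity>" for y using pr unfolding proper_fun_def by blast
  \<comment> \<open>The factor \<open>n\<close> drives the second components of the minimisers to
    \<open>u\<close>; the square in the first component makes the comparison with the subgradient
    inequality of \<open>v\<close> strict away from \<open>x\<close>, so no other limit is
    possible.\<close>
  define s where "s = (\<lambda>(n::nat) y. - (v \<bullet> (fst y - x)) + (fst y - x) \<bullet> (fst y - x)
    + real n * ((snd y - u) \<bullet> (snd y - u)))"
  have s0: "s n z = 0" for n by (simp add: s_def z_def)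
  have s_cont: "isCont (s n) y" for n y unfolding s_def by (intro continuous_intros)
  define K where "K = cball z 1"
  have K: "compact K" "K \<noteq> {}" "z \<in> K" by (auto simp: K_def)
  have "\<exists>y\<in>K. \<forall>y'\<in>K. g y + ereal (s n y) \<le> g y' + ereal (s n y')" for n
  proof -
    have *: "\<forall>\<^sub>F t in nhds a. g b + ereal (s n b) < g t + ereal (s n t)"
      if less: "g b + ereal (s n b) < g a + ereal (s n a)" for a b
    proof -
      have "g b \<noteq> \<infinity>" using less by auto
      then obtain B where B: "g b = ereal B" using nm[of b] by (cases "g b") auto
      \<comment> \<open>The margin \<open>e\<close> covers the variation of \<open>s n\<close> near
        \<open>a\<close>; when \<open>g a\<close> is infinite any \<open>e\<close> will do.\<close>
      have "\<exists>e>0. ereal (B + s n b - s n a + e) < g a"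
      proof (cases "g a")
        case (real A)
        then show ?thesis using less by (intro exI[of _ "(A + s n a - B - s n b) / 2"]) (simp add: B field_simps)
      qed (use nm[of a] in \<open>auto intro: exI[of _ 1]\<close>)
      then obtain e where e: "0 < e" "ereal (B + s n b - s n a + e) < g a" by blast
      have "\<forall>\<^sub>F t in nhds a. ereal (B + s n b - s n a + e) < g t" by (rule lsc_funD[OF lsc e(2)])
      moreover have "\<forall>\<^sub>F t in nhds a. s n a - e < s n t"
        using s_cont[of a n] e(1) unfolding isCont_def tendsto_at_iff_tendsto_nhds
        by (intro order_tendstoD(1)) auto
      ultimately show ?thesis
      proof eventually_elim
        case (elim t)
        then show ?case by (cases "g t") (auto simp: B)
      qed
    qed
    obtain y where "y \<in> K" "\<And>y'. y' \<in> K \<Longrightarrow> g y + ereal (s n y) \<le> g y' + ereal (s n y')"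
      by (rule lsc_attains_inf[OF K(1,2), of "\<lambda>y. g y + ereal (s n y)"]) (use * in auto)
    then show ?thesis by blast
  qed
  then obtain Z where Z: "\<And>n. Z n \<in> K" "\<And>n y. y \<in> K \<Longrightarrow> g (Z n) + ereal (s n (Z n)) \<le> g y + ereal (s n y)"
    by metis
  obtain y0 where y0: "y0 \<in> K" "\<And>y. y \<in> K \<Longrightarrow> g y0 \<le> g y"
    using lsc_attains_inf[OF K(1,2), of g] lsc_funD[OF lsc] by metis
  have "g y0 \<noteq> \<infinity>" using y0(2)[OF K(3)] r0 by auto
  then obtain m where m: "g y0 = ereal m" using nm[of y0] by (cases "g y0") auto
  have upper: "g (Z n) + ereal (s n (Z n)) \<le> ereal r0" for n
    using Z(2)[OF K(3), of n] by (simp add: s0 r0)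
  define G where "G n = real_of_ereal (g (Z n))" for n
  have G: "g (Z n) = ereal (G n)" for n
    using upper[of n] nm[of "Z n"] unfolding G_def by (cases "g (Z n)") auto
  have up: "G n + s n (Z n) \<le> r0" and lo: "m \<le> G n" for n
    using upper[of n] y0(2)[OF Z(1), of n] by (simp_all add: G m)
  obtain l \<rho> where l: "l \<in> K" "strict_mono (\<rho> :: nat \<Rightarrow> nat)" "(Z \<circ> \<rho>) \<longlonglongrightarrow> l"
    using K(1) Z(1) unfolding compact_def by metis
  have lim: "(\<lambda>n. Z (\<rho> n)) \<longlonglongrightarrow> l" using l(3) by (simp add: comp_def)
  \<comment> \<open>The minimal value is at most \<open>r0\<close>, \<open>g\<close> is at least
    \<open>m\<close> on the ball, and \<open>v\<close> pairs to at most \<open>norm v\<close> there;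
    \<open>n \<le> \<rho> n\<close> lowers the factor to \<open>n\<close>.\<close>
  have un: "real n * ((snd (Z (\<rho> n)) - u) \<bullet> (snd (Z (\<rho> n)) - u)) \<le> r0 - m + norm v" for n
  proof -
    let ?y = "Z (\<rho> n)"
    have "norm (fst ?y - x) \<le> 1"
      using Z(1)[of "\<rho> n"] dist_fst_le[of z ?y] by (simp add: K_def z_def dist_norm norm_minus_commute)
    then have "v \<bullet> (fst ?y - x) \<le> norm v"
      using norm_cauchy_schwarz[of v "fst ?y - x"] mult_left_le[of "norm (fst ?y - x)" "norm v"] by simp
    moreover have "real n * ((snd ?y - u) \<bullet> (snd ?y - u)) \<le> real (\<rho> n) * ((snd ?y - u) \<bullet> (snd ?y - u))"
      using seq_suble[OF l(2), of n] by (intro mult_right_mono) auto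
    moreover have "0 \<le> (fst ?y - x) \<bullet> (fst ?y - x)" by simp
    ultimately show ?thesis using up[of "\<rho> n"] lo[of "\<rho> n"] unfolding s_def by linarith
  qed
  have "(snd l - u) \<bullet> (snd l - u) \<le> 0"
  proof (rule LIMSEQ_le)
    show "(\<lambda>n. (snd (Z (\<rho> n)) - u) \<bullet> (snd (Z (\<rho> n)) - u)) \<longlonglongrightarrow> (snd l - u) \<bullet> (snd l - u)"
      by (intro tendsto_intros lim)
    show "(\<lambda>n. (r0 - m + norm v) / real n) \<longlonglongrightarrow> 0" by (rule lim_const_over_n)
    show "\<exists>N. \<forall>n\<ge>N. (snd (Z (\<rho> n)) - u) \<bullet> (snd (Z (\<rho> n)) - u) \<le> (r0 - m + norm v) / real n"
      using un by (intro exI[of _ 1]) (auto simp: field_simps)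
  qed
  then have "snd l - u = 0" using inner_ge_zero[of "snd l - u"] by (metis inner_eq_zero_iff order_antisym)
  then have lu: "snd l = u" by simp
  let ?b = "\<lambda>y. r0 + v \<bullet> (fst y - x) - (fst y - x) \<bullet> (fst y - x)"
  have Gb: "G (\<rho> n) \<le> ?b (Z (\<rho> n))" for n
    using up[of "\<rho> n"] mult_nonneg_nonneg[OF of_nat_0_le_iff[of "\<rho> n"] inner_ge_zero[of "snd (Z (\<rho> n)) - u"]]
    unfolding s_def by linarith
  have blim: "(\<lambda>n. ?b (Z (\<rho> n))) \<longlonglongrightarrow> ?b l" by (intro tendsto_intros lim)
  have sub: "ereal (r0 + v \<bullet> (fst l - x)) \<le> g l"
    using v lu r0 unfolding convex_subdiff_def z_def
    by (metis (mono_tags, lifting) mem_Collect_eq plus_ereal.simps(1) prod.collapse)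
  have evG: "\<forall>\<^sub>F n in sequentially. c < G (\<rho> n)" if "ereal c < g l" for c
  proof -
    have "\<forall>\<^sub>F n in sequentially. ereal c < g (Z (\<rho> n))"
      using eventually_compose_filterlim[OF lsc_funD[OF lsc that] lim] .
    then show ?thesis by (simp add: G)
  qed
  have "fst l = x"
  proof (rule ccontr)
    assume "fst l \<noteq> x"
    then have "?b l < r0 + v \<bullet> (fst l - x)" by simp
    \<comment> \<open>\<open>c\<close> lies between the limit of the upper bounds on
      \<open>G\<close> and the lower bound on \<open>g l\<close> from the subgradient inequality;
      lower semicontinuity then puts \<open>G\<close> above \<open>c\<close>.\<close>
    then obtain c where c: "?b l < c" "c < r0 + v \<bullet> (fst l - x)" using dense by blast
    have "ereal c < g l" using c(2) sub by (metis less_ereal.simps(1) order_less_le_trans)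
    then have "\<forall>\<^sub>F n in sequentially. c < G (\<rho> n)" by (rule evG)
    moreover have "\<forall>\<^sub>F n in sequentially. ?b (Z (\<rho> n)) < c" using order_tendstoD(2)[OF blim c(1)] .
    ultimately have "\<forall>\<^sub>F n in sequentially. False"
      by eventually_elim (use Gb in \<open>meson less_trans not_le\<close>)
    then show False by simp
  qed
  with lu have lz: "l = z" by (simp add: z_def prod_eq_iff)
  \<comment> \<open>Values must converge as well, since the base points in
    \<open>limiting_normals\<close> are points of the epigraph.\<close>
  have Glim: "(\<lambda>n. G (\<rho> n)) \<longlonglongrightarrow> r0"
  proof (rule order_tendstoI)
    fix c assume "c < r0" then show "\<forall>\<^sub>F n in sequentially. c < G (\<rho> n)" by (intro evG) (simp add: lz r0)
  next
    fix c assume "r0 < c"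
    then have "?b l < c" by (simp add: lz z_def)
    from order_tendstoD(2)[OF blim this] show "\<forall>\<^sub>F n in sequentially. G (\<rho> n) < c"
      by eventually_elim (use Gb in \<open>meson le_less_trans\<close>)
  qed
  \<comment> \<open>Discarding initial terms puts the minimisers in the open ball, where minimality
    over \<open>K\<close> is local minimality.\<close>
  obtain N where N: "\<And>n. n \<ge> N \<Longrightarrow> Z (\<rho> n) \<in> ball z 1"
    using order_tendstoD(2)[OF tendsto_dist[OF tendsto_const[of z] lim[unfolded lz]], of 1]
    unfolding eventually_sequentially by auto
  define k where "k n = \<rho> (n + N)" for n
  have Zk: "Z (k n) \<in> ball z 1" for n using N by (simp add: k_def)
  have Zk_lim: "(\<lambda>n. Z (k n)) \<longlonglongrightarrow> z" unfolding k_def using LIMSEQ_ignore_initial_segment[OF lim] lz by simp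
  have Gk_lim: "(\<lambda>n. G (k n)) \<longlonglongrightarrow> r0" unfolding k_def using LIMSEQ_ignore_initial_segment[OF Glim] .
  \<comment> \<open>\<open>(p n, w n)\<close> is minus the gradient of the penalty
    \<open>s (k n)\<close> at the minimiser.\<close>
  define p where "p n = v - 2 *\<^sub>R (fst (Z (k n)) - x)" for n
  define w where "w n = - ((2 * real (k n)) *\<^sub>R (snd (Z (k n)) - u))" for n
  have sg: "(p n, w n) \<in> regular_subdiff g (Z (k n))" for n
  proof -
    have "- (- (p n, w n)) \<in> regular_subdiff g (Z (k n))"
    proof (rule local_min_imp_regular_subdiff)
      show "\<bar>g (Z (k n))\<bar> \<noteq> \<infinity>" by (simp add: G)
      show "(s (k n) has_derivative (\<lambda>h. h \<bullet> - (p n, w n))) (at (Z (k n)))"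
        unfolding s_def p_def w_def
        by (auto intro!: derivative_eq_intros simp: inner_prod_def fun_eq_iff algebra_simps inner_commute)
      have "\<forall>\<^sub>F y in nhds (Z (k n)). y \<in> ball z 1" using Zk by (intro eventually_nhds_in_open) auto
      then show "\<forall>\<^sub>F y in nhds (Z (k n)). g (Z (k n)) + ereal (s (k n) (Z (k n))) \<le> g y + ereal (s (k n) y)"
        by eventually_elim (rule Z(2), simp add: K_def)
    qed
    then show ?thesis by simp
  qed
  \<comment> \<open>Scaled so that the vertical factor and the norm of the \<open>u\<close>
    component add up to 1: a subsequence converges even if \<open>w\<close> is unbounded, and its
    limit is not zero.\<close>
  define lm where "lm n = 1 / (1 + norm (w n))" for n
  have lam: "0 < lm n" "lm n \<le> 1" "lm n + norm (lm n *\<^sub>R w n) = 1" for n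
  proof -
    have "0 < 1 + norm (w n)" by (simp add: add_pos_nonneg)
    then show "0 < lm n" "lm n \<le> 1" "lm n + norm (lm n *\<^sub>R w n) = 1" by (simp_all add: lm_def field_simps)
  qed
  have in_cball: "(lm n, lm n *\<^sub>R w n) \<in> cball 0 1 \<times> cball 0 1" for n
    using lam[of n] by (auto simp del: norm_scaleR)
  have "compact (cball (0::real) 1 \<times> cball (0::'b) 1)" by (intro compact_Times compact_cball)
  then obtain q \<sigma> where q: "strict_mono (\<sigma> :: nat \<Rightarrow> nat)" "((\<lambda>n. (lm n, lm n *\<^sub>R w n)) \<circ> \<sigma>) \<longlonglongrightarrow> q"
    using in_cball unfolding compact_def by (auto dest!: spec[of _ "\<lambda>n. (lm n, lm n *\<^sub>R w n)"])
  obtain lam' \<omega> where q': "q = (lam', \<omega>)" by (cases q)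
  have l1: "(\<lambda>n. lm (\<sigma> n)) \<longlonglongrightarrow> lam'" and l2: "(\<lambda>n. lm (\<sigma> n) *\<^sub>R w (\<sigma> n)) \<longlonglongrightarrow> \<omega>"
    using tendsto_fst[OF q(2)] tendsto_snd[OF q(2)] by (simp_all add: q' comp_def)
  have Z\<sigma>: "(\<lambda>n. Z (k (\<sigma> n))) \<longlonglongrightarrow> z" and G\<sigma>: "(\<lambda>n. G (k (\<sigma> n))) \<longlonglongrightarrow> r0"
    using LIMSEQ_subseq_LIMSEQ[OF Zk_lim q(1)] LIMSEQ_subseq_LIMSEQ[OF Gk_lim q(1)] by (simp_all add: comp_def)
  have "(\<lambda>n. v - 2 *\<^sub>R (fst (Z (k (\<sigma> n))) - x)) \<longlonglongrightarrow> v - 2 *\<^sub>R (fst z - x)"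
    by (intro tendsto_intros Z\<sigma>)
  then have p_lim: "(\<lambda>n. p (\<sigma> n)) \<longlonglongrightarrow> v" by (simp add: p_def z_def)
  have lam_nonneg: "0 \<le> lam'"
    using LIMSEQ_le_const[OF l1] lam(1) less_imp_le by blast
  have "(\<lambda>n. lm (\<sigma> n) + norm (lm (\<sigma> n) *\<^sub>R w (\<sigma> n))) \<longlonglongrightarrow> lam' + norm \<omega>"
    by (intro tendsto_intros l1 l2)
  then have one: "lam' + norm \<omega> = 1" unfolding lam(3) using LIMSEQ_const_iff by metis
  have "((lam' *\<^sub>R v, \<omega>), - lam') \<in> limiting_normals (epi g) (z, real_of_ereal (g z))"
    unfolding limiting_normals_def
  proof (intro CollectI exI conjI allI)
    show "(\<lambda>n. (Z (k (\<sigma> n)), G (k (\<sigma> n)))) \<longlonglongrightarrow> (z, real_of_ereal (g z))"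
      unfolding r0 real_of_ereal.simps by (intro tendsto_Pair Z\<sigma> G\<sigma>)
    show "(\<lambda>n. ((lm (\<sigma> n) *\<^sub>R p (\<sigma> n), lm (\<sigma> n) *\<^sub>R w (\<sigma> n)), - lm (\<sigma> n))) \<longlonglongrightarrow> ((lam' *\<^sub>R v, \<omega>), - lam')"
      by (intro tendsto_Pair tendsto_scaleR tendsto_minus l1 l2 p_lim)
    show "(Z (k (\<sigma> n)), G (k (\<sigma> n))) \<in> epi g" for n by (simp add: epi_def G)
    fix n
    have "lm (\<sigma> n) *\<^sub>R ((p (\<sigma> n), w (\<sigma> n)), -1) \<in> regular_normals (epi g) (Z (k (\<sigma> n)), real_of_ereal (g (Z (k (\<sigma> n)))))"
      by (intro regular_normals_scale regular_subdiff_imp_regular_normal sg less_imp_le[OF lam(1)])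
    then show "((lm (\<sigma> n) *\<^sub>R p (\<sigma> n), lm (\<sigma> n) *\<^sub>R w (\<sigma> n)), - lm (\<sigma> n))
        \<in> regular_normals (epi g) (Z (k (\<sigma> n)), G (k (\<sigma> n)))" by (simp add: G)
  qed
  then have nrm: "((lam' *\<^sub>R v, \<omega>), - lam') \<in> regular_normals (epi g) (z, real_of_ereal (g z))"
    using reg unfolding regular_fun_at_def clarke_regular_def z_def by simp
  have eq: "limiting_subdiff g z = regular_subdiff g z"
    using limiting_subdiff_eq_regular_subdiff reg z_def by simp
  show ?thesis
  proof (cases "lam' = 0")
    case False
    then have "(1 / lam') *\<^sub>R ((lam' *\<^sub>R v, \<omega>), - lam') \<in> regular_normals (epi g) (z, real_of_ereal (g z))"
      using lam_nonneg by (intro regular_normals_scale nrm) simp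
    then have "((v, (1 / lam') *\<^sub>R \<omega>), -1) \<in> regular_normals (epi g) (z, real_of_ereal (g z))"
      using False by simp
    then have "(v, (1 / lam') *\<^sub>R \<omega>) \<in> regular_subdiff g z"
      by (intro regular_normal_imp_regular_subdiff fin)
    then show ?thesis using eq z_def by auto
  next
    case True
    obtain a where a: "a \<in> limiting_subdiff g z" using ne z_def by auto
    then have "(a, -1) + ((lam' *\<^sub>R v, \<omega>), - lam') \<in> regular_normals (epi g) (z, real_of_ereal (g z))"
      using eq by (intro regular_normals_add nrm regular_subdiff_imp_regular_normal) simp
    then have "(a + (0, \<omega>), -1) \<in> regular_normals (epi g) (z, real_of_ereal (g z))"
      using True by (simp add: zero_prod_def)
    then have "a + (0, \<omega>) \<in> limiting_subdiff g z"
      unfolding eq by (intro regular_normal_imp_regular_subdiff fin)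
    with a have h: "a + (0, \<omega>) \<in> affine hull (limiting_subdiff g z)" "a \<in> affine hull (limiting_subdiff g z)"
      by (auto intro: hull_inc)
    have "(a + (0, \<omega>)) - a \<in> parallel_subspace (limiting_subdiff g z)"
      unfolding parallel_subspace_def mem_Collect_eq
      by (rule exI[of _ "a + (0, \<omega>)"], rule exI[of _ a]) (use h in simp)
    then have "\<omega> = 0" using par unfolding z_def[symmetric] by simp
    then show ?thesis using one True by simp
  qed
qed

section \<open>Submanifold charts and the Weingarten map\<close>

lemma linear_blinfun_apply: "linear (blinfun_apply A)"
  by (rule bounded_linear.linear[OF blinfun.bounded_linear_right])

text \<open>Paired with a normal of \<open>S\<close>, the function vanishes locally, so the
  derivative lies in the double orthogonal complement of \<open>S\<close>. With
  \<open>S = {0}\<close> this differentiates identities.\<close>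

lemma has_derivative_in_subspace:
  fixes q :: "'a::real_normed_vector \<Rightarrow> 'b::euclidean_space"
  assumes q: "(q has_derivative q') (at x)" and S: "subspace S" and ev: "\<forall>\<^sub>F y in nhds x. q y \<in> S"
  shows "q' w \<in> S"
proof -
  have "n \<bullet> q' w = 0" if "n \<in> orthogonal_comp S" for n
  proof -
    have n: "n \<bullet> y = 0" if "y \<in> S" for y
      using \<open>n \<in> orthogonal_comp S\<close> that by (auto simp: orthogonal_comp_def orthogonal_def inner_commute)
    have "((\<lambda>y. n \<bullet> q y) has_derivative (\<lambda>w. n \<bullet> q' w)) (at x)"
      by (intro has_derivative_inner_right q)
    moreover have "((\<lambda>y. n \<bullet> q y) has_derivative (\<lambda>w. 0)) (at x)"
    proof (rule has_derivative_transform_eventually[OF has_derivative_const])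
      show "\<forall>\<^sub>F y in at x. 0 = n \<bullet> q y"
        unfolding eventually_at_filter by (rule eventually_mono[OF ev]) (simp add: n)
      show "0 = n \<bullet> q x" using eventually_nhds_x_imp_x[OF ev] by (simp add: n)
    qed simp
    ultimately show ?thesis using has_derivative_unique by (metis (no_types, lifting))
  qed
  then have "q' w \<in> orthogonal_comp (orthogonal_comp S)"
    by (simp add: orthogonal_comp_def orthogonal_def)
  then show ?thesis using orthogonal_comp_self[OF S] by simp
qed

text \<open>The line through \<open>p\<close> in direction \<open>a\<close> stays in
  \<open>S\<close>, where \<open>q\<close> vanishes. In a chart this differentiates identities that
  hold along \<open>M\<close> only.\<close>

lemma has_derivative_zero_along_subspace:
  fixes q :: "'a::real_normed_vector \<Rightarrow> real"
  assumes q: "(q has_derivative q') (at p)" and S: "subspace S" "p \<in> S" "a \<in> S"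
    and ev: "\<forall>\<^sub>F y in nhds p. y \<in> S \<longrightarrow> q y = 0"
  shows "q' a = 0"
proof -
  have lin: "((\<lambda>s::real. p + s *\<^sub>R a) has_derivative (\<lambda>s. s *\<^sub>R a)) (at 0)"
    by (auto intro!: derivative_eq_intros)
  have q0: "(q has_derivative q') (at (p + 0 *\<^sub>R a))" using q by simp
  have "((\<lambda>s::real. q (p + s *\<^sub>R a)) has_derivative (\<lambda>s. q' (s *\<^sub>R a))) (at 0)"
    using has_derivative_compose[OF lin q0] .
  moreover have "\<forall>\<^sub>F s in nhds (0::real). q (p + s *\<^sub>R a) \<in> {0}"
  proof -
    have "filterlim (\<lambda>s::real. p + s *\<^sub>R a) (nhds (p + 0 *\<^sub>R a)) (nhds 0)" by (intro tendsto_intros filterlim_ident)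
    then have "filterlim (\<lambda>s::real. p + s *\<^sub>R a) (nhds p) (nhds 0)" by simp
    from eventually_compose_filterlim[OF ev this] show ?thesis
      by eventually_elim (use S subspace_add subspace_scale in blast)
  qed
  ultimately have "q' (1 *\<^sub>R a) \<in> {0}"
    by (intro has_derivative_in_subspace[where w = "1::real" and q' = "\<lambda>s. q' (s *\<^sub>R a)"])
      (auto intro: subspace_single_0)
  then show ?thesis by simp
qed

text \<open>Derivatives are carried as bounded linear functions, so that dependence on the base
  point is continuity in operator norm. \<open>\<Psi>''\<close> encodes the curvature of
  \<open>M\<close>; C^1 normal fields are built from \<open>\<Phi>'\<close>.\<close>

locale C2_chart =
  fixes M V V' :: "'a::euclidean_space set" and \<Phi> \<Psi> :: "'a \<Rightarrow> 'a" and E :: "'a set"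
    and \<Phi>' \<Psi>' :: "'a \<Rightarrow> 'a \<Rightarrow>\<^sub>L 'a" and \<Psi>'' :: "'a \<Rightarrow> 'a \<Rightarrow>\<^sub>L 'a \<Rightarrow>\<^sub>L 'a"
  assumes open_V: "open V" and open_V': "open V'"
    and homeo: "homeomorphism V V' \<Phi> \<Psi>"
    and \<Phi>': "\<And>y. y \<in> V \<Longrightarrow> (\<Phi> has_derivative blinfun_apply (\<Phi>' y)) (at y)"
    and C1_\<Phi>': "C1_on V \<Phi>'"
    and \<Psi>': "\<And>p. p \<in> V' \<Longrightarrow> (\<Psi> has_derivative blinfun_apply (\<Psi>' p)) (at p)"
    and \<Psi>'': "\<And>p. p \<in> V' \<Longrightarrow> (\<Psi>' has_derivative blinfun_apply (\<Psi>'' p)) (at p)"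
    and cont_\<Psi>'': "continuous_on V' \<Psi>''"
    and subspace_E: "subspace E"
    and image_M: "\<Phi> ` (M \<inter> V) = E \<inter> V'"

lemma C2_submanifold_chart:
  fixes M :: "'a::euclidean_space set"
  assumes "C2_submanifold M" "x \<in> M"
  obtains V V' \<Phi> \<Psi> E \<Phi>' \<Psi>' \<Psi>'' where "C2_chart M V V' \<Phi> \<Psi> E \<Phi>' \<Psi>' \<Psi>''" "x \<in> V"
proof -
  obtain V V' E and \<Phi> \<Psi> :: "'a \<Rightarrow> 'a" where
    c: "open V" "x \<in> V" "open V'" "homeomorphism V V' \<Phi> \<Psi>" "C2_on V \<Phi>" "C2_on V' \<Psi>"
      "subspace E" "\<Phi> ` (M \<inter> V) = E \<inter> V'"
    using assms unfolding C2_submanifold_def by metis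
  obtain \<Phi>' where p: "\<And>y. y \<in> V \<Longrightarrow> (\<Phi> has_derivative blinfun_apply (\<Phi>' y)) (at y)" "C1_on V \<Phi>'"
    by (rule C2_onE[OF c(5)]) blast
  obtain \<Psi>' where q: "\<And>y. y \<in> V' \<Longrightarrow> (\<Psi> has_derivative blinfun_apply (\<Psi>' y)) (at y)" "C1_on V' \<Psi>'"
    by (rule C2_onE[OF c(6)]) blast
  obtain \<Psi>'' where r: "\<And>y. y \<in> V' \<Longrightarrow> (\<Psi>' has_derivative blinfun_apply (\<Psi>'' y)) (at y)" "continuous_on V' \<Psi>''"
    by (rule C1_onE[OF q(2)]) blast
  show thesis
    by (rule that[of V V' \<Phi> \<Psi> E \<Phi>' \<Psi>' \<Psi>'']) (unfold_locales, use c p q r in auto)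
qed

context C2_chart
begin

lemma \<Phi>_in: "y \<in> V \<Longrightarrow> \<Phi> y \<in> V'" and \<Psi>_in: "p \<in> V' \<Longrightarrow> \<Psi> p \<in> V"
  and \<Psi>\<Phi>: "y \<in> V \<Longrightarrow> \<Psi> (\<Phi> y) = y" and \<Phi>\<Psi>: "p \<in> V' \<Longrightarrow> \<Phi> (\<Psi> p) = p"
  using homeo unfolding homeomorphism_def by auto

lemma \<Phi>_in_E: "y \<in> M \<Longrightarrow> y \<in> V \<Longrightarrow> \<Phi> y \<in> E"
  using image_M by blast

lemma \<Psi>_in_M:
  assumes "p \<in> V'" "p \<in> E"
  shows "\<Psi> p \<in> M"
proof -
  obtain y where "y \<in> M" "y \<in> V" "p = \<Phi> y" using image_M assms by blast
  then show ?thesis using \<Psi>\<Phi> by simp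
qed

lemma \<Psi>'_\<Phi>':
  assumes "y \<in> V"
  shows "\<Psi>' (\<Phi> y) (\<Phi>' y v) = v"
proof -
  have "((\<lambda>y. \<Psi> (\<Phi> y)) has_derivative (\<lambda>v. \<Psi>' (\<Phi> y) (\<Phi>' y v))) (at y)"
    by (rule has_derivative_compose[OF \<Phi>'[OF assms] \<Psi>'[OF \<Phi>_in[OF assms]]])
  moreover have "((\<lambda>y. \<Psi> (\<Phi> y)) has_derivative (\<lambda>v. v)) (at y)"
    by (rule has_derivative_transform_within_open[OF has_derivative_ident open_V assms]) (simp add: \<Psi>\<Phi>)
  ultimately show ?thesis using has_derivative_unique by (metis (no_types, lifting))
qed

lemma \<Phi>'_\<Psi>':
  assumes "y \<in> V"
  shows "\<Phi>' y (\<Psi>' (\<Phi> y) a) = a"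
proof -
  have y: "(\<Phi> has_derivative \<Phi>' y) (at (\<Psi> (\<Phi> y)))" using \<Phi>'[OF assms] \<Psi>\<Phi>[OF assms] by simp
  have "((\<lambda>p. \<Phi> (\<Psi> p)) has_derivative (\<lambda>a. \<Phi>' y (\<Psi>' (\<Phi> y) a))) (at (\<Phi> y))"
    by (rule has_derivative_compose[OF \<Psi>'[OF \<Phi>_in[OF assms]] y])
  moreover have "((\<lambda>p. \<Phi> (\<Psi> p)) has_derivative (\<lambda>v. v)) (at (\<Phi> y))"
    by (rule has_derivative_transform_within_open[OF has_derivative_ident open_V' \<Phi>_in[OF assms]]) (simp add: \<Phi>\<Psi>)
  ultimately show ?thesis using has_derivative_unique by (metis (no_types, lifting))
qed

lemma line_in_V':
  assumes "p \<in> V'"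
  obtains e :: real where "0 < e" "\<And>s. \<bar>s\<bar> < e \<Longrightarrow> p + s *\<^sub>R a \<in> V'"
proof -
  have "filterlim (\<lambda>s::real. p + s *\<^sub>R a) (nhds (p + 0 *\<^sub>R a)) (nhds 0)" by (intro tendsto_intros filterlim_ident)
  moreover have "\<forall>\<^sub>F y in nhds (p + 0 *\<^sub>R a). y \<in> V'"
    using assms open_V' by (simp add: eventually_nhds_in_open)
  ultimately have "\<forall>\<^sub>F s in nhds (0::real). p + s *\<^sub>R a \<in> V'" by (rule eventually_compose_filterlim[rotated])
  then show thesis using that unfolding eventually_nhds_metric by (auto simp: dist_real_def)
qed

lemma curve_has_vector_derivative:
  assumes "p + s *\<^sub>R a \<in> V'"
  shows "((\<lambda>s. \<Psi> (p + s *\<^sub>R a)) has_vector_derivative \<Psi>' (p + s *\<^sub>R a) a) (at s)"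
proof -
  have "((\<lambda>s::real. p + s *\<^sub>R a) has_derivative (\<lambda>h. h *\<^sub>R a)) (at s)"
    by (auto intro!: derivative_eq_intros)
  from has_derivative_compose[OF this \<Psi>'[OF assms]] show ?thesis
    by (simp add: has_vector_derivative_def blinfun.scaleR_right)
qed

text \<open>A curve in \<open>M\<close> is mapped by \<open>\<Phi>\<close> into \<open>E\<close>, so
  its velocity is too; conversely \<open>\<Psi>\<close> maps straight lines in \<open>E\<close> to
  curves in \<open>M\<close>. In particular the velocities form a subspace.\<close>

lemma tangent_space_eq:
  assumes x: "x \<in> M" "x \<in> V"
  shows "tangent_space M x = \<Psi>' (\<Phi> x) ` E"
proof (intro equalityI subsetI)
  fix v assume "v \<in> tangent_space M x"
  then obtain c e where c: "0 < e" "c ` {-e<..<e} \<subseteq> M" "c 0 = x" "(c has_vector_derivative v) (at (0::real))"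
    unfolding tangent_space_def by blast
  have d: "(c has_derivative (\<lambda>s. s *\<^sub>R v)) (at 0)" using c(4) by (simp add: has_vector_derivative_def)
  have "(\<Phi> has_derivative \<Phi>' x) (at (c 0))" using \<Phi>' x c(3) by simp
  from has_derivative_compose[OF d this]
  have d2: "((\<lambda>s. \<Phi> (c s)) has_derivative (\<lambda>s. \<Phi>' x (s *\<^sub>R v))) (at 0)" .
  have "isCont c 0" using has_derivative_continuous[OF d] .
  then have lim: "filterlim c (nhds x) (nhds 0)"
    using c(3) unfolding isCont_def tendsto_at_iff_tendsto_nhds by simp
  have "\<forall>\<^sub>F s in nhds 0. c s \<in> V"
    by (rule eventually_compose_filterlim[OF _ lim]) (use open_V x eventually_nhds_in_open in blast)
  moreover have "\<forall>\<^sub>F s in nhds 0. s \<in> {-e<..<e}" using c(1) by (intro eventually_nhds_in_open) auto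
  ultimately have "\<forall>\<^sub>F s in nhds 0. \<Phi> (c s) \<in> E"
    by eventually_elim (use c(2) \<Phi>_in_E in blast)
  from has_derivative_in_subspace[OF d2 subspace_E this, of 1] have "\<Phi>' x v \<in> E" by simp
  then show "v \<in> \<Psi>' (\<Phi> x) ` E" using \<Psi>'_\<Phi>'[OF x(2)] by (metis imageI)
next
  fix v assume "v \<in> \<Psi>' (\<Phi> x) ` E"
  then obtain a where a: "a \<in> E" "v = \<Psi>' (\<Phi> x) a" by blast
  obtain e where e: "0 < (e::real)" "\<And>s. \<bar>s\<bar> < e \<Longrightarrow> \<Phi> x + s *\<^sub>R a \<in> V'"
    using line_in_V'[OF \<Phi>_in[OF x(2)]] by blast
  let ?c = "\<lambda>s. \<Psi> (\<Phi> x + s *\<^sub>R a)"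
  have in': "\<Phi> x + s *\<^sub>R a \<in> V'" if "s \<in> {-e<..<e}" for s using that e(2) by (simp add: abs_less_iff)
  have "?c C1_differentiable_on {-e<..<e}"
    unfolding C1_differentiable_on_def
  proof (intro exI conjI ballI)
    show "(?c has_vector_derivative \<Psi>' (\<Phi> x + s *\<^sub>R a) a) (at s)" if "s \<in> {-e<..<e}" for s
      using curve_has_vector_derivative in' that by blast
    have "continuous_on V' \<Psi>'"
      using \<Psi>'' by (meson continuous_at_imp_continuous_on has_derivative_continuous)
    then have "continuous_on {-e<..<e} (\<lambda>s. \<Psi>' (\<Phi> x + s *\<^sub>R a))"
      by (rule continuous_on_compose2) (auto intro!: continuous_intros in')
    then show "continuous_on {-e<..<e} (\<lambda>s. \<Psi>' (\<Phi> x + s *\<^sub>R a) a)"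
      by (rule bounded_linear.continuous_on[OF blinfun.bounded_linear_left])
  qed
  moreover have "?c ` {-e<..<e} \<subseteq> M"
    using in' \<Psi>_in_M a(1) \<Phi>_in_E[OF x] subspace_E subspace_add subspace_scale by blast
  moreover have "(?c has_vector_derivative v) (at 0)"
    using curve_has_vector_derivative[of "\<Phi> x" 0 a] in'[of 0] e(1) a(2) by simp
  moreover have "?c 0 = x" using \<Psi>\<Phi> x by simp
  ultimately show "v \<in> tangent_space M x" unfolding tangent_space_def using e(1) by blast
qed

lemma tangent_in: "x \<in> M \<Longrightarrow> x \<in> V \<Longrightarrow> a \<in> E \<Longrightarrow> \<Psi>' (\<Phi> x) a \<in> tangent_space M x"
  using tangent_space_eq by blast

lemma \<Phi>'_tangent_in_E: "x \<in> M \<Longrightarrow> x \<in> V \<Longrightarrow> t \<in> tangent_space M x \<Longrightarrow> \<Phi>' x t \<in> E"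
  using tangent_space_eq \<Phi>'_\<Psi>' by auto

lemma subspace_tangent: "x \<in> M \<Longrightarrow> x \<in> V \<Longrightarrow> subspace (tangent_space M x)"
  using tangent_space_eq linear_subspace_image[OF linear_blinfun_apply subspace_E] by simp

lemma normal_iff:
  assumes "x \<in> M" "x \<in> V"
  shows "w \<in> normal_space M x \<longleftrightarrow> (\<forall>a\<in>E. w \<bullet> \<Psi>' (\<Phi> x) a = 0)"
  unfolding normal_space_def tangent_space_eq[OF assms]
  by (auto simp: orthogonal_comp_def orthogonal_def inner_commute)

text \<open>The transpose of \<open>\<Phi>' y\<close> applied to \<open>w\<close>, in coordinates so
  that it is visibly linear in \<open>\<Phi>' y\<close>. For \<open>w\<close> orthogonal to
  \<open>E\<close> it is a normal field along \<open>M\<close>.\<close>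

definition normal_field :: "'a \<Rightarrow> 'a \<Rightarrow> 'a" where
  "normal_field w y = (\<Sum>b\<in>Basis. (\<Phi>' y b \<bullet> w) *\<^sub>R b)"

lemma inner_normal_field: "normal_field w y \<bullet> v = \<Phi>' y v \<bullet> w"
proof -
  have "\<Phi>' y v \<bullet> w = \<Phi>' y (\<Sum>b\<in>Basis. (v \<bullet> b) *\<^sub>R b) \<bullet> w" by (simp add: euclidean_representation)
  also have "\<dots> = normal_field w y \<bullet> v"
    by (simp add: normal_field_def blinfun.sum_right blinfun.scaleR_right inner_sum_left inner_commute[of v] mult.commute)
  finally show ?thesis by simp
qed

lemma C1_on_normal_field: "C1_on V (normal_field w)"
proof -
  have "bounded_linear (\<lambda>A. \<Sum>b\<in>Basis. (blinfun_apply A b \<bullet> w) *\<^sub>R (b::'a))"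
    by (intro bounded_linear_intros blinfun.bounded_linear_left)
  from C1_on_bounded_linear[OF C1_\<Phi>' this] show ?thesis unfolding normal_field_def .
qed

lemma normal_field_normal:
  assumes "w \<in> orthogonal_comp E" "y \<in> M" "y \<in> V"
  shows "normal_field w y \<in> normal_space M y"
  using assms by (simp add: normal_iff inner_normal_field \<Phi>'_\<Psi>' orthogonal_comp_def orthogonal_def)

lemma normal_field_onto:
  assumes x: "x \<in> M" "x \<in> V" and w: "w \<in> normal_space M x"
  obtains w' where "w' \<in> orthogonal_comp E" "normal_field w' x = w"
proof -
  \<comment> \<open>Since \<open>\<Psi>' (\<Phi> x)\<close> is a left inverse of
    \<open>\<Phi>' x\<close>, its transpose is a right inverse of the transpose of
    \<open>\<Phi>' x\<close>.\<close>
  let ?w = "adjoint (\<Psi>' (\<Phi> x)) w"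
  have adj: "a \<bullet> ?w = \<Psi>' (\<Phi> x) a \<bullet> w" for a by (rule adjoint_works[OF linear_blinfun_apply])
  show thesis
  proof (rule that[of ?w])
    show "?w \<in> orthogonal_comp E"
      using w by (simp add: normal_iff[OF x] orthogonal_comp_def orthogonal_def adj inner_commute)
    have "normal_field ?w x \<bullet> v = w \<bullet> v" for v
      unfolding inner_normal_field adj \<Psi>'_\<Phi>'[OF x(2)] by (rule inner_commute)
    then show "normal_field ?w x = w" using vector_eq_rdot by blast
  qed
qed

lemma normal_extension_exists:
  assumes "x \<in> M" "x \<in> V" "w \<in> normal_space M x"
  shows "\<exists>W. normal_extension M x w W"
proof -
  obtain w' where "w' \<in> orthogonal_comp E" "normal_field w' x = w" using normal_field_onto assms by blast
  then show ?thesis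
    unfolding normal_extension_def
    using open_V assms C1_on_normal_field normal_field_normal by blast
qed

section \<open>Projections, Weingarten map and Riemannian derivatives in a chart\<close>

lemma tproj_in: "x \<in> M \<Longrightarrow> x \<in> V \<Longrightarrow> tproj M x v \<in> tangent_space M x"
  unfolding tproj_def by (intro closest_point_subspace_in subspace_tangent)

lemma tproj_inner: "x \<in> M \<Longrightarrow> x \<in> V \<Longrightarrow> t \<in> tangent_space M x \<Longrightarrow> tproj M x v \<bullet> t = v \<bullet> t"
  unfolding tproj_def by (intro closest_point_subspace_inner subspace_tangent)

lemma tproj_id: "t \<in> tangent_space M x \<Longrightarrow> tproj M x t = t"
  unfolding tproj_def by (rule closest_point_self)

lemma linear_tproj: "x \<in> M \<Longrightarrow> x \<in> V \<Longrightarrow> linear (tproj M x)"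
  unfolding tproj_def by (intro linear_closest_point_subspace subspace_tangent)

lemma nproj_eq: "x \<in> M \<Longrightarrow> x \<in> V \<Longrightarrow> nproj M x v = v - tproj M x v"
  unfolding tproj_def nproj_def normal_space_def
  by (intro closest_point_orthogonal_comp subspace_tangent)

lemma nproj_in: "nproj M x v \<in> normal_space M x"
  unfolding nproj_def normal_space_def by (intro closest_point_subspace_in subspace_orthogonal_comp)

lemma tangent_eqI:
  assumes x: "x \<in> M" "x \<in> V" and "s \<in> tangent_space M x" "t \<in> tangent_space M x"
    and "\<And>b. b \<in> E \<Longrightarrow> s \<bullet> \<Psi>' (\<Phi> x) b = t \<bullet> \<Psi>' (\<Phi> x) b"
  shows "s = t"
proof -
  have d: "s - t \<in> tangent_space M x" using assms subspace_tangent subspace_diff by blast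
  then obtain b where b: "b \<in> E" "s - t = \<Psi>' (\<Phi> x) b" using tangent_space_eq[OF x] by blast
  have "(s - t) \<bullet> \<Psi>' (\<Phi> x) b = 0" using assms(5)[OF b(1)] by (simp add: inner_diff_left)
  then have "(s - t) \<bullet> (s - t) = 0" using b(2) by metis
  then show ?thesis by simp
qed

text \<open>A normal field \<open>W\<close> satisfies
  \<open>W (\<Psi> p) \<bullet> \<Psi>' p b = 0\<close> for \<open>p\<close> in \<open>E\<close>;
  the product rule in a direction of \<open>E\<close> trades the derivative of \<open>W\<close> for
  the second derivative of \<open>\<Psi>\<close>. The result no longer contains \<open>W\<close>, so
  the operator is independent of the field chosen by \<open>SOME\<close>.\<close>

lemma weingarten_works:
  assumes x: "x \<in> M" "x \<in> V" and w: "w \<in> normal_space M x"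
  shows "linear (\<lambda>v. weingarten M x v w)" and "weingarten M x v w \<in> tangent_space M x"
    and "b \<in> E \<Longrightarrow> weingarten M x v w \<bullet> \<Psi>' (\<Phi> x) b = w \<bullet> \<Psi>'' (\<Phi> x) (\<Phi>' x (tproj M x v)) b"
proof -
  define W where "W = (SOME W. normal_extension M x w W)"
  have "normal_extension M x w W" unfolding W_def using someI_ex normal_extension_exists assms by metis
  then obtain O' where W: "W x = w" "open O'" "x \<in> O'" "C1_on O' W" "\<And>y. y \<in> M \<Longrightarrow> y \<in> O' \<Longrightarrow> W y \<in> normal_space M y"
    unfolding normal_extension_def by blast
  obtain W' where W': "(W has_derivative blinfun_apply W') (at x)" using C1_onE[OF W(4)] W(3) by metis
  have eq: "weingarten M x v w = - tproj M x (W' (tproj M x v))" for v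
    unfolding weingarten_def W_def[symmetric] frechet_derivative_at[OF W', symmetric] ..
  show "linear (\<lambda>v. weingarten M x v w)"
    unfolding eq
    using linear_compose_neg[OF linear_compose[OF linear_compose[OF linear_tproj[OF x] linear_blinfun_apply] linear_tproj[OF x]]]
    by (simp add: comp_def)
  show "weingarten M x v w \<in> tangent_space M x"
    unfolding eq using subspace_neg[OF subspace_tangent[OF x] tproj_in[OF x]] .
  assume b: "b \<in> E"
  define a where "a = \<Phi>' x (tproj M x v)"
  have a: "a \<in> E" unfolding a_def using \<Phi>'_tangent_in_E[OF x tproj_in[OF x]] .
  have ta: "\<Psi>' (\<Phi> x) a = tproj M x v" unfolding a_def using \<Psi>'_\<Phi>'[OF x(2)] .
  have p: "\<Phi> x \<in> V'" using \<Phi>_in x by blast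
  have "(W has_derivative W') (at (\<Psi> (\<Phi> x)))" using W' \<Psi>\<Phi> x by simp
  from has_derivative_compose[OF \<Psi>'[OF p] this]
  have "((\<lambda>p. W (\<Psi> p)) has_derivative (\<lambda>h. W' (\<Psi>' (\<Phi> x) h))) (at (\<Phi> x))" .
  moreover have "((\<lambda>p. \<Psi>' p b) has_derivative (\<lambda>h. \<Psi>'' (\<Phi> x) h b)) (at (\<Phi> x))"
    using bounded_linear.has_derivative[OF blinfun.bounded_linear_left \<Psi>''[OF p]] .
  ultimately have "((\<lambda>p. W (\<Psi> p) \<bullet> \<Psi>' p b) has_derivative
      (\<lambda>h. W (\<Psi> (\<Phi> x)) \<bullet> \<Psi>'' (\<Phi> x) h b + W' (\<Psi>' (\<Phi> x) h) \<bullet> \<Psi>' (\<Phi> x) b)) (at (\<Phi> x))"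
    by (rule has_derivative_inner)
  then have "W (\<Psi> (\<Phi> x)) \<bullet> \<Psi>'' (\<Phi> x) a b + W' (\<Psi>' (\<Phi> x) a) \<bullet> \<Psi>' (\<Phi> x) b = 0"
  proof (rule has_derivative_zero_along_subspace[OF _ subspace_E \<Phi>_in_E[OF x] a])
    have "isCont \<Psi> (\<Phi> x)" using \<Psi>'[OF p] has_derivative_continuous by blast
    then have lim: "filterlim \<Psi> (nhds x) (nhds (\<Phi> x))"
      unfolding isCont_def tendsto_at_iff_tendsto_nhds using \<Psi>\<Phi> x by simp
    have "\<forall>\<^sub>F q in nhds (\<Phi> x). \<Psi> q \<in> O'"
      by (rule eventually_compose_filterlim[OF eventually_nhds_in_open lim]) (use W in auto)
    moreover have "\<forall>\<^sub>F q in nhds (\<Phi> x). q \<in> V'" using p open_V' by (intro eventually_nhds_in_open)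
    ultimately show "\<forall>\<^sub>F q in nhds (\<Phi> x). q \<in> E \<longrightarrow> W (\<Psi> q) \<bullet> \<Psi>' q b = 0"
    proof eventually_elim
      case (elim q)
      show ?case
      proof
        assume "q \<in> E"
        then have "\<Psi> q \<in> M" "\<Psi> q \<in> V" using elim \<Psi>_in_M \<Psi>_in by auto
        then have "W (\<Psi> q) \<bullet> \<Psi>' (\<Phi> (\<Psi> q)) b = 0" using W(5) elim(1) b normal_iff by blast
        then show "W (\<Psi> q) \<bullet> \<Psi>' q b = 0" using \<Phi>\<Psi> elim by simp
      qed
    qed
  qed
  then have "- (W' (tproj M x v) \<bullet> \<Psi>' (\<Phi> x) b) = w \<bullet> \<Psi>'' (\<Phi> x) a b"
    using W(1) \<Psi>\<Phi>[OF x(2)] by (simp add: ta)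
  then show "weingarten M x v w \<bullet> \<Psi>' (\<Phi> x) b = w \<bullet> \<Psi>'' (\<Phi> x) (\<Phi>' x (tproj M x v)) b"
    unfolding eq a_def[symmetric] using tproj_inner[OF x tangent_in[OF x b]] by simp
qed

text \<open>Two extensions agree along \<open>M\<close>, so the derivative of \<open>p \<mapsto> \<nabla>h\<^sub>i (\<Psi> p) \<bullet> \<Psi>' p b\<close> along \<open>E\<close> is the
  same for both.\<close>

lemma C2_extensions_agree:
  assumes x: "x \<in> M" "x \<in> V" and h1: "is_C2_extension M h x h1" and h2: "is_C2_extension M h x h2"
  shows "grad h1 x - grad h2 x \<in> normal_space M x"
    and "a \<in> E \<Longrightarrow> b \<in> E \<Longrightarrow>
      hess h1 x (\<Psi>' (\<Phi> x) a) \<bullet> \<Psi>' (\<Phi> x) b + grad h1 x \<bullet> \<Psi>'' (\<Phi> x) a b =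
      hess h2 x (\<Psi>' (\<Phi> x) a) \<bullet> \<Psi>' (\<Phi> x) b + grad h2 x \<bullet> \<Psi>'' (\<Phi> x) a b"
proof -
  obtain O1 O2 where O1: "open O1" "x \<in> O1" "C2_on O1 h1" "\<And>y. y \<in> M \<Longrightarrow> y \<in> O1 \<Longrightarrow> h y = ereal (h1 y)"
    and O2: "open O2" "x \<in> O2" "C2_on O2 h2" "\<And>y. y \<in> M \<Longrightarrow> y \<in> O2 \<Longrightarrow> h y = ereal (h2 y)"
    using h1 h2 unfolding is_C2_extension_def by blast
  have p: "\<Phi> x \<in> V'" using \<Phi>_in x by blast
  define O' where "O' = V' \<inter> \<Psi> -` (O1 \<inter> O2)"
  have "open O'"
    unfolding O'_def
    by (rule continuous_open_preimage) (use homeo open_V' O1(1) O2(1) in \<open>auto simp: homeomorphism_def\<close>)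
  have pO: "\<Phi> x \<in> O'" using p O1 O2 \<Psi>\<Phi> x by (simp add: O'_def)
  have zero: "(grad h1 (\<Psi> q) - grad h2 (\<Psi> q)) \<bullet> \<Psi>' q b = 0" if q: "q \<in> O'" "q \<in> E" and b: "b \<in> E" for q b
  proof -
    have qV: "q \<in> V'" and q12: "\<Psi> q \<in> O1" "\<Psi> q \<in> O2" using q by (auto simp: O'_def)
    have d: "((\<lambda>q. h1 (\<Psi> q) - h2 (\<Psi> q)) has_derivative
       (\<lambda>h. \<Psi>' q h \<bullet> grad h1 (\<Psi> q) - \<Psi>' q h \<bullet> grad h2 (\<Psi> q))) (at q)"
      by (intro has_derivative_diff has_derivative_compose[OF \<Psi>'[OF qV]] C2_on_has_derivative_grad[OF O1(3)]
          C2_on_has_derivative_grad[OF O2(3)] q12)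
    have "\<forall>\<^sub>F q in nhds q. q \<in> O'" using q \<open>open O'\<close> by (intro eventually_nhds_in_open)
    then have "\<forall>\<^sub>F q in nhds q. q \<in> E \<longrightarrow> h1 (\<Psi> q) - h2 (\<Psi> q) = 0"
    proof eventually_elim
      case (elim r)
      then show ?case using O1(4)[of "\<Psi> r"] O2(4)[of "\<Psi> r"] \<Psi>_in_M[of r] by (auto simp: O'_def)
    qed
    from has_derivative_zero_along_subspace[OF d subspace_E q(2) b this]
    show ?thesis by (simp add: inner_diff_right inner_commute)
  qed
  have pE: "\<Phi> x \<in> E" using \<Phi>_in_E x by blast
  show "grad h1 x - grad h2 x \<in> normal_space M x"
    unfolding normal_iff[OF x] using zero[OF pO pE] \<Psi>\<Phi>[OF x(2)] by simp
  assume a: "a \<in> E" and b: "b \<in> E"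
  obtain H1 where H1: "hess h1 x = blinfun_apply H1" "(grad h1 has_derivative blinfun_apply H1) (at (\<Psi> (\<Phi> x)))"
    using C2_on_hess[OF O1(3,1)] O1(2) \<Psi>\<Phi>[OF x(2)] by metis
  obtain H2 where H2: "hess h2 x = blinfun_apply H2" "(grad h2 has_derivative blinfun_apply H2) (at (\<Psi> (\<Phi> x)))"
    using C2_on_hess[OF O2(3,1)] O2(2) \<Psi>\<Phi>[OF x(2)] by metis
  have d1: "((\<lambda>p. grad h1 (\<Psi> p) - grad h2 (\<Psi> p)) has_derivative
      (\<lambda>h. H1 (\<Psi>' (\<Phi> x) h) - H2 (\<Psi>' (\<Phi> x) h))) (at (\<Phi> x))"
    by (intro has_derivative_diff has_derivative_compose[OF \<Psi>'[OF p]] H1 H2)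
  have "((\<lambda>p. \<Psi>' p b) has_derivative (\<lambda>h. \<Psi>'' (\<Phi> x) h b)) (at (\<Phi> x))"
    using bounded_linear.has_derivative[OF blinfun.bounded_linear_left \<Psi>''[OF p]] .
  from has_derivative_inner[OF d1 this]
  have "(grad h1 (\<Psi> (\<Phi> x)) - grad h2 (\<Psi> (\<Phi> x))) \<bullet> \<Psi>'' (\<Phi> x) a b +
      (H1 (\<Psi>' (\<Phi> x) a) - H2 (\<Psi>' (\<Phi> x) a)) \<bullet> \<Psi>' (\<Phi> x) b = 0"
  proof (rule has_derivative_zero_along_subspace[OF _ subspace_E pE a])
    have "\<forall>\<^sub>F q in nhds (\<Phi> x). q \<in> O'" using pO \<open>open O'\<close> by (intro eventually_nhds_in_open)
    then show "\<forall>\<^sub>F q in nhds (\<Phi> x). q \<in> E \<longrightarrow> (grad h1 (\<Psi> q) - grad h2 (\<Psi> q)) \<bullet> \<Psi>' q b = 0"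
      by eventually_elim (use zero b in blast)
  qed
  then show "hess h1 x (\<Psi>' (\<Phi> x) a) \<bullet> \<Psi>' (\<Phi> x) b + grad h1 x \<bullet> \<Psi>'' (\<Phi> x) a b =
      hess h2 x (\<Psi>' (\<Phi> x) a) \<bullet> \<Psi>' (\<Phi> x) b + grad h2 x \<bullet> \<Psi>'' (\<Phi> x) a b"
    using \<Psi>\<Phi>[OF x(2)] by (simp add: H1(1) H2(1) inner_diff_left)
qed

lemma C2_extension_works: "is_C2_extension M h x ht \<Longrightarrow> is_C2_extension M h x (C2_extension M h x)"
  unfolding C2_extension_def by (rule someI[where P = "is_C2_extension M h x"])

lemma tproj_normal: "x \<in> M \<Longrightarrow> x \<in> V \<Longrightarrow> w \<in> normal_space M x \<Longrightarrow> tproj M x w = 0"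
  unfolding tproj_def
  by (intro closest_point_subspace_unique subspace_tangent)
    (auto simp: subspace_0[OF subspace_tangent] normal_space_def orthogonal_comp_def orthogonal_def inner_commute)

lemma rgrad_eq:
  assumes x: "x \<in> M" "x \<in> V" and h: "is_C2_extension M h x ht"
  shows "rgrad M h x = tproj M x (grad ht x)"
proof -
  interpret P: linear "tproj M x" by (rule linear_tproj[OF x])
  have "tproj M x (grad (C2_extension M h x) x - grad ht x) = 0"
    by (intro tproj_normal[OF x] C2_extensions_agree(1)[OF x C2_extension_works[OF h] h])
  then show ?thesis unfolding rgrad_def by (simp add: P.diff)
qed

text \<open>Replaces the extension chosen by \<open>SOME\<close> with any convenient
  \<open>ht\<close>. The Euclidean Hessian and the normal gradient each depend on the extension;
  their sum in this bilinear form does not.\<close>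

lemma rhess_works:
  assumes x: "x \<in> M" "x \<in> V" and h: "is_C2_extension M h x ht"
  shows "linear (rhess M h x)" and "rhess M h x v \<in> tangent_space M x"
    and "b \<in> E \<Longrightarrow> rhess M h x v \<bullet> \<Psi>' (\<Phi> x) b =
      hess ht x (tproj M x v) \<bullet> \<Psi>' (\<Phi> x) b
      + nproj M x (grad ht x) \<bullet> \<Psi>'' (\<Phi> x) (\<Phi>' x (tproj M x v)) b"
proof -
  define hc where "hc = C2_extension M h x"
  have hc: "is_C2_extension M h x hc" unfolding hc_def by (rule C2_extension_works[OF h])
  have eq: "rhess M h x v = tproj M x (hess hc x (tproj M x v)) + weingarten M x v (nproj M x (grad hc x))" for v
    unfolding rhess_def hc_def ..
  obtain O' where "open O'" "x \<in> O'" "C2_on O' hc" using hc unfolding is_C2_extension_def by blast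
  then obtain H where H: "hess hc x = blinfun_apply H" using C2_on_hess by metis
  note w = weingarten_works[OF x nproj_in]
  have "linear (\<lambda>v. tproj M x (H (tproj M x v)))"
    using linear_compose[OF linear_compose[OF linear_tproj[OF x] linear_blinfun_apply] linear_tproj[OF x]]
    by (simp add: comp_def)
  then show "linear (rhess M h x)"
    unfolding eq H by (intro linear_compose_add w(1))
  show "rhess M h x v \<in> tangent_space M x"
    unfolding eq by (intro subspace_add subspace_tangent x tproj_in w(2))
  assume b: "b \<in> E"
  define a where "a = \<Phi>' x (tproj M x v)"
  have a: "a \<in> E" unfolding a_def using \<Phi>'_tangent_in_E[OF x tproj_in[OF x]] .
  have ta: "\<Psi>' (\<Phi> x) a = tproj M x v" unfolding a_def using \<Psi>'_\<Phi>'[OF x(2)] .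
  interpret P: linear "tproj M x" by (rule linear_tproj[OF x])
  \<comment> \<open>The two gradients differ by a normal vector, which the normal projection leaves
    unchanged.\<close>
  have n: "nproj M x (grad hc x) = nproj M x (grad ht x) + (grad hc x - grad ht x)"
    using tproj_normal[OF x C2_extensions_agree(1)[OF x hc h]] by (simp add: nproj_eq[OF x] P.diff)
  have "rhess M h x v \<bullet> \<Psi>' (\<Phi> x) b = hess hc x (\<Psi>' (\<Phi> x) a) \<bullet> \<Psi>' (\<Phi> x) b
      + nproj M x (grad hc x) \<bullet> \<Psi>'' (\<Phi> x) a b"
    unfolding eq inner_add_left w(3)[OF b] a_def[symmetric] ta
    using tproj_inner[OF x tangent_in[OF x b]] by simp
  also have "\<dots> = hess ht x (\<Psi>' (\<Phi> x) a) \<bullet> \<Psi>' (\<Phi> x) b + nproj M x (grad ht x) \<bullet> \<Psi>'' (\<Phi> x) a b"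
    using C2_extensions_agree(2)[OF x hc h a b] by (simp add: n inner_add_left inner_diff_left)
  finally show "rhess M h x v \<bullet> \<Psi>' (\<Phi> x) b = hess ht x (tproj M x v) \<bullet> \<Psi>' (\<Phi> x) b
      + nproj M x (grad ht x) \<bullet> \<Psi>'' (\<Phi> x) (\<Phi>' x (tproj M x v)) b"
    unfolding a_def[symmetric] ta .
qed

lemma tendsto_charts:
  assumes "x0 \<in> V" "(X \<longlongrightarrow> x0) F"
  shows "((\<lambda>i. \<Phi> (X i)) \<longlongrightarrow> \<Phi> x0) F" "((\<lambda>i. \<Phi>' (X i)) \<longlongrightarrow> \<Phi>' x0) F"
    "((\<lambda>i. \<Psi>' (\<Phi> (X i))) \<longlongrightarrow> \<Psi>' (\<Phi> x0)) F" "((\<lambda>i. \<Psi>'' (\<Phi> (X i))) \<longlongrightarrow> \<Psi>'' (\<Phi> x0)) F"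
proof -
  have c: "isCont \<Phi> x0" "isCont \<Phi>' x0" "isCont \<Psi>' (\<Phi> x0)" "isCont \<Psi>'' (\<Phi> x0)"
    using \<Phi>'[OF assms(1)] \<Psi>''[OF \<Phi>_in[OF assms(1)]] has_derivative_continuous apply blast
    using C1_on_imp_continuous_on[OF C1_\<Phi>'] assms(1) open_V continuous_on_eq_continuous_at apply blast
    using \<Psi>''[OF \<Phi>_in[OF assms(1)]] has_derivative_continuous apply blast
    using cont_\<Psi>'' \<Phi>_in[OF assms(1)] open_V' continuous_on_eq_continuous_at by blast
  show 1: "((\<lambda>i. \<Phi> (X i)) \<longlongrightarrow> \<Phi> x0) F" by (rule isCont_tendsto_compose[OF c(1) assms(2)])
  show "((\<lambda>i. \<Phi>' (X i)) \<longlongrightarrow> \<Phi>' x0) F" by (rule isCont_tendsto_compose[OF c(2) assms(2)])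
  show "((\<lambda>i. \<Psi>' (\<Phi> (X i))) \<longlongrightarrow> \<Psi>' (\<Phi> x0)) F" by (rule isCont_tendsto_compose[OF c(3) 1])
  show "((\<lambda>i. \<Psi>'' (\<Phi> (X i))) \<longlongrightarrow> \<Psi>'' (\<Phi> x0)) F" by (rule isCont_tendsto_compose[OF c(4) 1])
qed

text \<open>The tangential and the normal part of \<open>k0\<close> extend to the fields
  \<open>\<Psi>' (\<Phi> x) e\<close> and \<open>normal_field w x\<close>, tangent and normal at
  every nearby point of \<open>M\<close>. The projection fixes the first and kills the second, so
  its error is the projection of a vector tending to 0.\<close>

lemma tendsto_tproj:
  assumes x0: "x0 \<in> M" "x0 \<in> V" and X: "(X \<longlongrightarrow> x0) F" and XM: "\<forall>\<^sub>F i in F. X i \<in> M"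
    and k: "(k \<longlongrightarrow> k0) F"
  shows "((\<lambda>i. tproj M (X i) (k i)) \<longlongrightarrow> tproj M x0 k0) F"
proof -
  have XV: "\<forall>\<^sub>F i in F. X i \<in> V" using topological_tendstoD[OF X open_V x0(2)] .
  note ch = tendsto_charts[OF x0(2) X]
  obtain e where e: "e \<in> E" "tproj M x0 k0 = \<Psi>' (\<Phi> x0) e" using tproj_in[OF x0] tangent_space_eq[OF x0] by blast
  obtain w where w: "w \<in> orthogonal_comp E" "normal_field w x0 = nproj M x0 k0"
    using normal_field_onto[OF x0 nproj_in] by blast
  have t: "((\<lambda>i. \<Psi>' (\<Phi> (X i)) e) \<longlongrightarrow> tproj M x0 k0) F" unfolding e(2) by (intro tendsto_intros ch)
  have n: "((\<lambda>i. normal_field w (X i)) \<longlongrightarrow> k0 - tproj M x0 k0) F"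
    unfolding nproj_eq[OF x0, symmetric] w(2)[symmetric] unfolding normal_field_def by (intro tendsto_intros ch)
  have "((\<lambda>i. k i - \<Psi>' (\<Phi> (X i)) e - normal_field w (X i)) \<longlongrightarrow> k0 - tproj M x0 k0 - (k0 - tproj M x0 k0)) F"
    by (intro tendsto_intros k t n)
  then have r: "((\<lambda>i. k i - \<Psi>' (\<Phi> (X i)) e - normal_field w (X i)) \<longlongrightarrow> 0) F" by simp
  have "((\<lambda>i. tproj M (X i) (k i) - \<Psi>' (\<Phi> (X i)) e) \<longlongrightarrow> 0) F"
  proof (rule Lim_null_comparison[OF _ tendsto_norm_zero[OF r]])
    show "\<forall>\<^sub>F i in F. norm (tproj M (X i) (k i) - \<Psi>' (\<Phi> (X i)) e)
        \<le> norm (k i - \<Psi>' (\<Phi> (X i)) e - normal_field w (X i))"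
      using XM XV
    proof eventually_elim
      case (elim i)
      interpret P: linear "tproj M (X i)" by (rule linear_tproj[OF elim])
      have "tproj M (X i) (k i - \<Psi>' (\<Phi> (X i)) e - normal_field w (X i)) = tproj M (X i) (k i) - \<Psi>' (\<Phi> (X i)) e"
        by (simp add: P.diff tproj_id[OF tangent_in[OF elim e(1)]] tproj_normal[OF elim normal_field_normal[OF w(1) elim]])
      then show ?case
        using norm_closest_point_subspace_le[OF subspace_tangent[OF elim]] unfolding tproj_def by metis
    qed
  qed
  from tendsto_add[OF this t] show ?thesis by simp
qed

end

section \<open>First and second order conditions along the manifold\<close>

context C2_chart
begin

text \<open>Along the curves \<open>s \<mapsto> \<Psi> (\<Phi> x + s *\<^sub>R a)\<close> in
  \<open>M\<close>, \<open>h y - b \<bullet> y\<close> is minimal at \<open>x\<close>. Their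
  acceleration \<open>\<Psi>'' (\<Phi> x) a a\<close> accounts for the term in the normal vector
  \<open>grad h x - b\<close>.\<close>

lemma order_conditions_along_chart:
  assumes x: "x \<in> M" "x \<in> V" and O': "open O'" "x \<in> O'" "C2_on O' h"
    and min: "\<And>y. y \<in> M \<Longrightarrow> y \<in> O' \<Longrightarrow> h x + b \<bullet> (y - x) \<le> h y"
  shows "grad h x - b \<in> normal_space M x"
    and "a \<in> E \<Longrightarrow> 0 \<le> hess h x (\<Psi>' (\<Phi> x) a) \<bullet> \<Psi>' (\<Phi> x) a + (grad h x - b) \<bullet> \<Psi>'' (\<Phi> x) a a"
proof -
  have p: "\<Phi> x \<in> V'" using \<Phi>_in x by blast
  have pE: "\<Phi> x \<in> E" using \<Phi>_in_E x by blast
  obtain H where H: "hess h x = blinfun_apply H" "(grad h has_derivative blinfun_apply H) (at x)"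
    using C2_on_hess[OF O'(3,1)] O'(2) by metis
  have *: "(grad h x - b) \<bullet> \<Psi>' (\<Phi> x) a = 0 \<and>
      0 \<le> H (\<Psi>' (\<Phi> x) a) \<bullet> \<Psi>' (\<Phi> x) a + (grad h x - b) \<bullet> \<Psi>'' (\<Phi> x) a a" if a: "a \<in> E" for a
  proof -
    let ?c = "\<lambda>s. \<Psi> (\<Phi> x + s *\<^sub>R a)"
    obtain e1 where e1: "0 < (e1::real)" "\<And>s. \<bar>s\<bar> < e1 \<Longrightarrow> \<Phi> x + s *\<^sub>R a \<in> V'"
      using line_in_V'[OF p] by blast
    have c0: "?c 0 = x" using \<Psi>\<Phi> x by simp
    have cd: "(?c has_vector_derivative \<Psi>' (\<Phi> x + s *\<^sub>R a) a) (at s)" if "\<bar>s\<bar> < e1" for s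
      using curve_has_vector_derivative e1(2)[OF that] .
    have "isCont ?c 0" using cd[of 0] e1(1) has_vector_derivative_continuous by (metis abs_zero)
    then have "filterlim ?c (nhds (?c 0)) (nhds 0)"
      unfolding isCont_def by (rule tendsto_at_iff_tendsto_nhds[of ?c 0, THEN iffD1])
    then have "filterlim ?c (nhds x) (nhds 0)" unfolding c0 .
    then have "\<forall>\<^sub>F s in nhds 0. ?c s \<in> O'"
      by (rule eventually_compose_filterlim[rotated]) (use O' in \<open>intro eventually_nhds_in_open\<close>)
    then obtain e2 where e2: "0 < e2" "\<And>s. \<bar>s\<bar> < e2 \<Longrightarrow> ?c s \<in> O'"
      unfolding eventually_nhds_metric by (auto simp: dist_real_def)
    define e where "e = min e1 e2"
    have e: "0 < e" "e \<le> e1" "e \<le> e2" using e1 e2 by (auto simp: e_def)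
    let ?q = "\<lambda>s. h (?c s) - b \<bullet> ?c s"
    let ?q' = "\<lambda>s. (grad h (?c s) - b) \<bullet> \<Psi>' (\<Phi> x + s *\<^sub>R a) a"
    let ?D = "H (\<Psi>' (\<Phi> x) a) \<bullet> \<Psi>' (\<Phi> x) a + (grad h x - b) \<bullet> \<Psi>'' (\<Phi> x) a a"
    have q: "(?q has_real_derivative ?q' s) (at s)" if "\<bar>s\<bar> < e" for s
    proof -
      have d: "(?c has_derivative (\<lambda>r. r *\<^sub>R \<Psi>' (\<Phi> x + s *\<^sub>R a) a)) (at s)"
        using cd[of s] that e unfolding has_vector_derivative_def by simp
      have "?c s \<in> O'" using e2(2) that e by simp
      from has_derivative_compose[OF d C2_on_has_derivative_grad[OF O'(3) this]]
      have "(?q has_derivative (\<lambda>r. (r *\<^sub>R \<Psi>' (\<Phi> x + s *\<^sub>R a) a) \<bullet> grad h (?c s)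
          - b \<bullet> (r *\<^sub>R \<Psi>' (\<Phi> x + s *\<^sub>R a) a))) (at s)"
        by (intro has_derivative_diff has_derivative_inner_right d)
      then show ?thesis
        unfolding has_field_derivative_def
        by (rule has_derivative_eq_rhs) (simp add: fun_eq_iff inner_diff_left inner_commute algebra_simps)
    qed
    have q': "(?q' has_real_derivative ?D) (at 0)"
    proof -
      have d: "(?c has_derivative (\<lambda>r. r *\<^sub>R \<Psi>' (\<Phi> x) a)) (at 0)"
        using cd[of 0] e1 unfolding has_vector_derivative_def by simp
      have "(grad h has_derivative H) (at (?c 0))" using H(2) c0 by simp
      from has_derivative_compose[OF d this]
      have g: "((\<lambda>s. grad h (?c s) - b) has_derivative (\<lambda>r. H (r *\<^sub>R \<Psi>' (\<Phi> x) a))) (at 0)"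
        using has_derivative_diff[OF _ has_derivative_const] by fastforce
      have l: "((\<lambda>s::real. \<Phi> x + s *\<^sub>R a) has_derivative (\<lambda>r. r *\<^sub>R a)) (at 0)"
        by (auto intro!: derivative_eq_intros)
      have "(\<Psi>' has_derivative \<Psi>'' (\<Phi> x)) (at (\<Phi> x + 0 *\<^sub>R a))" using \<Psi>''[OF p] by simp
      from bounded_linear.has_derivative[OF blinfun.bounded_linear_left has_derivative_compose[OF l this]]
      have "((\<lambda>s. \<Psi>' (\<Phi> x + s *\<^sub>R a) a) has_derivative (\<lambda>r. \<Psi>'' (\<Phi> x) (r *\<^sub>R a) a)) (at 0)" .
      from has_derivative_inner[OF g this]
      show ?thesis
        unfolding has_field_derivative_def
        by (rule has_derivative_eq_rhs)
          (simp add: fun_eq_iff \<Psi>\<Phi>[OF x(2)] blinfun.scaleR_right blinfun.scaleR_left algebra_simps)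
    qed
    have qmin: "?q 0 \<le> ?q s" if "\<bar>s\<bar> < e" for s
    proof -
      have "\<Phi> x + s *\<^sub>R a \<in> V'" "?c s \<in> O'" using e1(2) e2(2) that e by auto
      moreover have "\<Phi> x + s *\<^sub>R a \<in> E" using pE a subspace_E subspace_add subspace_scale by blast
      ultimately have "h x + b \<bullet> (?c s - x) \<le> h (?c s)" using min \<Psi>_in_M by blast
      then show ?thesis unfolding c0 by (simp add: inner_diff_right)
    qed
    show ?thesis
      using second_derivative_local_min_nonneg[OF e(1) q q' qmin] c0 by simp
  qed
  then show "grad h x - b \<in> normal_space M x" by (simp add: normal_iff[OF x])
  show "a \<in> E \<Longrightarrow> 0 \<le> hess h x (\<Psi>' (\<Phi> x) a) \<bullet> \<Psi>' (\<Phi> x) a + (grad h x - b) \<bullet> \<Psi>'' (\<Phi> x) a a"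
    using * H(1) by simp
qed

lemma convex_subgradient_order_conditions:
  assumes x: "x \<in> M" "x \<in> V" and ht: "is_C2_extension M h x ht" and b: "b \<in> convex_subdiff h x"
  shows "grad ht x - b \<in> normal_space M x"
    and "a \<in> E \<Longrightarrow> 0 \<le> hess ht x (\<Psi>' (\<Phi> x) a) \<bullet> \<Psi>' (\<Phi> x) a + (grad ht x - b) \<bullet> \<Psi>'' (\<Phi> x) a a"
proof -
  obtain O' where O': "open O'" "x \<in> O'" "C2_on O' ht" "\<And>y. y \<in> M \<Longrightarrow> y \<in> O' \<Longrightarrow> h y = ereal (ht y)"
    using ht unfolding is_C2_extension_def by blast
  have "ht x + b \<bullet> (y - x) \<le> ht y" if "y \<in> M" "y \<in> O'" for y
  proof -
    have "h x + ereal (b \<bullet> (y - x)) \<le> h y" using b unfolding convex_subdiff_def by blast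
    then show ?thesis using O'(4)[OF that] O'(4)[OF x(1) O'(2)] by simp
  qed
  from order_conditions_along_chart[OF x O'(1-3) this]
  show "grad ht x - b \<in> normal_space M x"
    "a \<in> E \<Longrightarrow> 0 \<le> hess ht x (\<Psi>' (\<Phi> x) a) \<bullet> \<Psi>' (\<Phi> x) a + (grad ht x - b) \<bullet> \<Psi>'' (\<Phi> x) a a"
    by blast+
qed

end

section \<open>The composite problem\<close>

lemma convex_convex_subdiff: "convex (convex_subdiff h x)"
proof (cases "\<bar>h x\<bar> = \<infinity>")
  case False
  then obtain r where r: "h x = ereal r" by (cases "h x") auto
  have "convex_subdiff h x = (\<Inter>y. {v. ereal (r + v \<bullet> (y - x)) \<le> h y})"
    by (auto simp: convex_subdiff_def r)
  also have "convex \<dots>"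
  proof (intro convex_INT)
    fix y
    show "convex {v. ereal (r + v \<bullet> (y - x)) \<le> h y}"
    proof (cases "h y")
      case (real s)
      have "{v. ereal (r + v \<bullet> (y - x)) \<le> h y} = {v. (y - x) \<bullet> v \<le> s - r}"
        by (auto simp: real inner_commute algebra_simps)
      then show ?thesis by (simp add: convex_halfspace_le)
    qed auto
  qed
  finally show ?thesis .
qed (auto simp: convex_subdiff_def)

lemma closed_convex_subdiff: "closed (convex_subdiff h x)"
proof (cases "\<bar>h x\<bar> = \<infinity>")
  case False
  then obtain r where r: "h x = ereal r" by (cases "h x") auto
  have "convex_subdiff h x = (\<Inter>y. {v. ereal (r + v \<bullet> (y - x)) \<le> h y})"
    by (auto simp: convex_subdiff_def r)
  also have "closed \<dots>"
  proof (intro closed_INT ballI)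
    fix y
    show "closed {v. ereal (r + v \<bullet> (y - x)) \<le> h y}"
    proof (cases "h y")
      case (real s)
      have "{v. ereal (r + v \<bullet> (y - x)) \<le> h y} = {v. (y - x) \<bullet> v \<le> s - r}"
        by (auto simp: real inner_commute algebra_simps)
      then show ?thesis by (simp add: closed_halfspace_le)
    qed auto
  qed
  finally show ?thesis .
qed (auto simp: convex_subdiff_def)

text \<open>Fermat's rule for \<open>f\<close> perturbed by \<open>- f\<close>: every point
  minimises the constant sum, so the gradient is a regular subgradient, and convexity makes it a
  global one.\<close>

lemma grad_in_convex_subdiff:
  assumes f: "convex_on UNIV f" "(f has_derivative f') (at x)"
  shows "grad f x \<in> convex_subdiff (\<lambda>x. ereal (f x)) x"
proof -
  have d: "((\<lambda>y. - f y) has_derivative (\<lambda>k. k \<bullet> - grad f x)) (at x)"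
    using has_derivative_minus[OF has_derivative_grad[OF f(2)]] by simp
  have "- (- grad f x) \<in> regular_subdiff (\<lambda>x. ereal (f x)) x"
    by (rule local_min_imp_regular_subdiff[OF _ d]) auto
  moreover have "convex_fun (\<lambda>x. ereal (f x))"
    unfolding convex_fun_def
  proof (rule convexI)
    fix a b :: "'a \<times> real" and s t :: real
    assume a: "a \<in> epi (\<lambda>x. ereal (f x))" "b \<in> epi (\<lambda>x. ereal (f x))" and st: "0 \<le> s" "0 \<le> t" "s + t = 1"
    then have "s * f (fst a) + t * f (fst b) \<le> s * snd a + t * snd b"
      by (intro add_mono mult_left_mono) (auto simp: epi_def)
    moreover have "f (s *\<^sub>R fst a + t *\<^sub>R fst b) \<le> s * f (fst a) + t * f (fst b)"
      using f(1) st by (auto simp: convex_on_def)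
    ultimately show "s *\<^sub>R a + t *\<^sub>R b \<in> epi (\<lambda>x. ereal (f x))"
      by (simp add: epi_def case_prod_beta)
  qed
  ultimately show ?thesis using regular_subdiff_subset_convex_subdiff by fastforce
qed

text \<open>If \<open>v\<close> is a subgradient of the sum, \<open>x\<close> minimises
  \<open>g\<close> plus the smooth function \<open>f y - v \<bullet> y\<close>; Fermat's rule yields
  a regular subgradient of \<open>g\<close>, global by convexity. The converse adds two subgradient
  inequalities.\<close>

lemma convex_subdiff_add_smooth:
  assumes f: "convex_on UNIV f" "(f has_derivative f') (at x)"
    and g: "convex_fun g" "\<And>y. g y \<noteq> -\<infinity>"
  shows "v \<in> convex_subdiff (\<lambda>x. ereal (f x) + g x) x \<longleftrightarrow> v - grad f x \<in> convex_subdiff g x"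
proof
  assume v: "v \<in> convex_subdiff (\<lambda>x. ereal (f x) + g x) x"
  then have fin: "\<bar>g x\<bar> \<noteq> \<infinity>" unfolding convex_subdiff_def by (cases "g x") auto
  have d: "((\<lambda>y. f y - v \<bullet> y) has_derivative (\<lambda>k. k \<bullet> (grad f x - v))) (at x)"
    using has_derivative_diff[OF has_derivative_grad[OF f(2)] has_derivative_inner_right[OF has_derivative_ident]]
    by (rule has_derivative_eq_rhs) (simp add: fun_eq_iff inner_diff_right inner_commute)
  have "- (grad f x - v) \<in> regular_subdiff g x"
  proof (rule local_min_imp_regular_subdiff[where h = g, OF fin d], rule always_eventually, rule allI)
    fix y
    have "ereal (f x) + g x + ereal (v \<bullet> (y - x)) \<le> ereal (f y) + g y"
      using v unfolding convex_subdiff_def by blast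
    then show "g x + ereal (f x - v \<bullet> x) \<le> g y + ereal (f y - v \<bullet> y)"
      using fin by (cases "g x"; cases "g y") (auto simp: inner_diff_right)
  qed
  then show "v - grad f x \<in> convex_subdiff g x"
    using regular_subdiff_subset_convex_subdiff[OF g] by auto
next
  assume v: "v - grad f x \<in> convex_subdiff g x"
  then have fin: "\<bar>g x\<bar> \<noteq> \<infinity>" unfolding convex_subdiff_def by simp
  have "ereal (f x) + g x + ereal (v \<bullet> (y - x)) \<le> ereal (f y) + g y" for y
  proof -
    have "g x + ereal ((v - grad f x) \<bullet> (y - x)) \<le> g y" using v unfolding convex_subdiff_def by blast
    moreover have "ereal (f x) + ereal (grad f x \<bullet> (y - x)) \<le> ereal (f y)"
      using grad_in_convex_subdiff[OF f] unfolding convex_subdiff_def by blast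
    ultimately show ?thesis using fin by (cases "g x"; cases "g y") (auto simp: inner_diff_left)
  qed
  then show "v \<in> convex_subdiff (\<lambda>x. ereal (f x) + g x) x" using fin unfolding convex_subdiff_def by auto
qed

text \<open>Reduces a claim about a neighbourhood to the exclusion of a sequence of counterexamples,
  to which compactness applies.\<close>

lemma open_neighbourhood_by_sequences:
  fixes z :: "'a::metric_space"
  assumes "\<And>zs. \<lbrakk>\<And>n::nat. zs n \<in> S; \<And>n. \<not> P (zs n); zs \<longlonglongrightarrow> z\<rbrakk> \<Longrightarrow> False"
  obtains O' where "open O'" "z \<in> O'" "\<And>y. y \<in> O' \<Longrightarrow> y \<in> S \<Longrightarrow> P y"
proof (rule ccontr)
  assume "\<not> thesis"
  then have "\<exists>y. y \<in> ball z (inverse (Suc n)) \<and> y \<in> S \<and> \<not> P y" for n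
    using that[OF open_ball, of z "inverse (real (Suc n))"] by auto
  then obtain zs where zs: "\<And>n. zs n \<in> ball z (inverse (Suc n)) \<and> zs n \<in> S \<and> \<not> P (zs n)" by metis
  have "zs \<longlonglongrightarrow> z"
  proof (rule metric_tendsto_imp_tendsto[OF LIMSEQ_inverse_real_of_nat])
    have "dist (zs n) z \<le> dist (inverse (real (Suc n))) 0" for n
      using less_imp_le[of "dist z (zs n)" "inverse (real (Suc n))"] zs[of n]
      by (simp add: dist_commute dist_real_def)
    then show "\<forall>\<^sub>F n in sequentially. dist (zs n) z \<le> dist (inverse (real (Suc n))) 0" by simp
  qed
  then show False using assms zs by blast
qed

text \<open>Reduces convergence in operator norm to convergence at the basis vectors.\<close>

lemma onorm_le_sum_Basis:
  fixes f :: "'a::euclidean_space \<Rightarrow> 'b::real_normed_vector"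
  assumes "linear f"
  shows "onorm f \<le> (\<Sum>i\<in>Basis. norm (f i))"
proof (rule onorm_bound)
  interpret linear f by fact
  fix x
  have "norm (f x) = norm (\<Sum>i\<in>Basis. (x \<bullet> i) *\<^sub>R f i)"
    by (metis (no_types, lifting) euclidean_representation scale sum sum.cong)
  also have "\<dots> \<le> (\<Sum>i\<in>Basis. norm (f i) * norm x)"
  proof (rule sum_norm_le)
    fix i :: 'a assume "i \<in> Basis"
    then show "norm ((x \<bullet> i) *\<^sub>R f i) \<le> norm (f i) * norm x"
      using mult_left_mono[OF Basis_le_norm[of i x] norm_ge_zero[of "f i"]] by (simp add: mult.commute)
  qed
  finally show "norm (f x) \<le> (\<Sum>i\<in>Basis. norm (f i)) * norm x" by (simp add: sum_distrib_right)
qed (simp add: sum_nonneg)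

text \<open>Since \<open>\<Omega>\<close> is open, moving \<open>u\<close> along \<open>w\<close> is
  a curve in the product, so \<open>(0, w)\<close> is tangent and a normal \<open>(n, w)\<close>
  pairs with it to \<open>w \<bullet> w\<close>. For the second part, the first component of a curve
  in the product is a curve in \<open>M\<close>.\<close>

lemma normal_space_Times:
  fixes M :: "'a::euclidean_space set" and \<Omega> :: "'b::euclidean_space set"
  assumes "open \<Omega>" "x \<in> M" "u \<in> \<Omega>"
  shows "(n, w) \<in> normal_space (M \<times> \<Omega>) (x, u) \<Longrightarrow> w = 0"
    and "n \<in> normal_space M x \<Longrightarrow> (n, 0) \<in> normal_space (M \<times> \<Omega>) (x, u)"
proof -
  assume nw: "(n, w) \<in> normal_space (M \<times> \<Omega>) (x, u)"
  have "filterlim (\<lambda>s::real. u + s *\<^sub>R w) (nhds (u + 0 *\<^sub>R w)) (nhds 0)"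
    by (intro tendsto_intros filterlim_ident)
  moreover have "\<forall>\<^sub>F y in nhds (u + 0 *\<^sub>R w). y \<in> \<Omega>" using assms by (simp add: eventually_nhds_in_open)
  ultimately have "\<forall>\<^sub>F s in nhds (0::real). u + s *\<^sub>R w \<in> \<Omega>" by (rule eventually_compose_filterlim[rotated])
  then obtain e where e: "0 < e" "\<And>s. \<bar>s\<bar> < e \<Longrightarrow> u + s *\<^sub>R w \<in> \<Omega>"
    unfolding eventually_nhds_metric by (auto simp: dist_real_def)
  let ?c = "\<lambda>s::real. (x, u + s *\<^sub>R w)"
  have d: "(?c has_vector_derivative (0, w)) (at s)" for s
    by (auto intro!: derivative_eq_intros)
  have "(0, w) \<in> tangent_space (M \<times> \<Omega>) (x, u)"
    unfolding tangent_space_def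
  proof (intro CollectI exI conjI)
    show "?c C1_differentiable_on {-e<..<e}"
      unfolding C1_differentiable_on_def using d by (intro exI[of _ "\<lambda>_. (0, w)"]) auto
    show "?c ` {-e<..<e} \<subseteq> M \<times> \<Omega>" using e(2) assms(2) by (auto simp: abs_less_iff)
  qed (use e d in auto)
  then have "(0, w) \<bullet> (n, w) = 0"
    using nw unfolding normal_space_def orthogonal_comp_def orthogonal_def by blast
  then show "w = 0" by simp
next
  assume n: "n \<in> normal_space M x"
  show "(n, 0) \<in> normal_space (M \<times> \<Omega>) (x, u)"
    unfolding normal_space_def orthogonal_comp_def orthogonal_def
  proof (intro CollectI ballI)
    fix t assume "t \<in> tangent_space (M \<times> \<Omega>) (x, u)"
    then obtain c e where c: "0 < e" "c C1_differentiable_on {-e<..<e}" "c ` {-e<..<e} \<subseteq> M \<times> \<Omega>"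
      "c 0 = (x, u)" "(c has_vector_derivative t) (at (0::real))"
      unfolding tangent_space_def by blast
    obtain D where D: "\<And>s. s \<in> {-e<..<e} \<Longrightarrow> (c has_vector_derivative D s) (at s)" "continuous_on {-e<..<e} D"
      using c(2) unfolding C1_differentiable_on_def by blast
    have d: "((\<lambda>s. fst (c s)) has_vector_derivative fst v) (at s)"
      if "(c has_vector_derivative v) (at s)" for v s
      using has_derivative_fst[OF that[unfolded has_vector_derivative_def]]
      unfolding has_vector_derivative_def by simp
    have "fst t \<in> tangent_space M x"
      unfolding tangent_space_def
    proof (intro CollectI exI conjI)
      show "(\<lambda>s. fst (c s)) C1_differentiable_on {-e<..<e}"
        unfolding C1_differentiable_on_def
        using d D(1) continuous_on_fst[OF D(2)] by (intro exI[of _ "\<lambda>s. fst (D s)"]) auto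
      show "(\<lambda>s. fst (c s)) ` {-e<..<e} \<subseteq> M" using c(3) by force
    qed (use c d in auto)
    then have "fst t \<bullet> n = 0" using n unfolding normal_space_def orthogonal_comp_def orthogonal_def by blast
    then show "t \<bullet> (n, 0) = 0" by (simp add: inner_prod_def)
  qed
qed

text \<open>A neighbourhood \<open>N\<close> on which the variational questions are settled:
  \<open>nu_normal\<close> records the vanishing normal residual and \<open>pd_f\<close> a bound
  uniform in the point, leaving calculus and linear algebra. \<open>gh\<close> extends
  \<open>g\<close> jointly in both variables, so one extension serves all \<open>u\<close>.\<close>

locale CPSO_chart = C2_chart M V V' \<Phi> \<Psi> E \<Phi>' \<Psi>' \<Psi>''
  for M V V' :: "'a::euclidean_space set" and \<Phi> \<Psi> E \<Phi>' \<Psi>' \<Psi>'' +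
  fixes f gh :: "'a \<times> 'b::euclidean_space \<Rightarrow> real" and g :: "'a \<times> 'b \<Rightarrow> ereal" and N :: "('a \<times> 'b) set"
    and Hf Hg :: "'a \<times> 'b \<Rightarrow> ('a \<times> 'b) \<Rightarrow>\<^sub>L 'a" and c :: real
  assumes open_N: "open N" and N_V: "\<And>x u. (x, u) \<in> N \<Longrightarrow> x \<in> V"
    and C2_f: "C2_on N f" and C2_gh: "C2_on N gh"
    and g_eq: "\<And>x u. (x, u) \<in> N \<Longrightarrow> x \<in> M \<Longrightarrow> g (x, u) = ereal (gh (x, u))"
    and hess_f: "\<And>x u. (x, u) \<in> N \<Longrightarrow> hess (\<lambda>x. f (x, u)) x = (\<lambda>v. Hf (x, u) (v, 0))"
    and der_f: "\<And>z. z \<in> N \<Longrightarrow> ((\<lambda>z. grad (\<lambda>x. f (x, snd z)) (fst z)) has_derivative Hf z) (at z)"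
    and der_f_u: "\<And>x u. (x, u) \<in> N \<Longrightarrow>
      ((\<lambda>u. grad (\<lambda>x. f (x, u)) x) has_derivative (\<lambda>w. Hf (x, u) (0, w))) (at u)"
    and cont_Hf: "continuous_on N Hf"
    and hess_g: "\<And>x u. (x, u) \<in> N \<Longrightarrow> hess (\<lambda>x. gh (x, u)) x = (\<lambda>v. Hg (x, u) (v, 0))"
    and der_g: "\<And>z. z \<in> N \<Longrightarrow> ((\<lambda>z. grad (\<lambda>x. gh (x, snd z)) (fst z)) has_derivative Hg z) (at z)"
    and der_g_u: "\<And>x u. (x, u) \<in> N \<Longrightarrow>
      ((\<lambda>u. grad (\<lambda>x. gh (x, u)) x) has_derivative (\<lambda>w. Hg (x, u) (0, w))) (at u)"
    and cont_Hg: "continuous_on N Hg"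
    and nu_sub: "\<And>x u. (x, u) \<in> N \<Longrightarrow> x \<in> M \<Longrightarrow> nu f g x u \<in> convex_subdiff (\<lambda>x. g (x, u)) x"
    and nu_normal: "\<And>x u. (x, u) \<in> N \<Longrightarrow> x \<in> M \<Longrightarrow>
      nproj M x (nu f g x u + grad (\<lambda>x. f (x, u)) x) = 0"
    and c_pos: "0 < c"
    and pd_f: "\<And>x u t. (x, u) \<in> N \<Longrightarrow> x \<in> M \<Longrightarrow> t \<in> tangent_space M x \<Longrightarrow>
      c * (t \<bullet> t) \<le> Hf (x, u) (t, 0) \<bullet> t"
begin

section \<open>The operators \<open>Q\<close>, \<open>R\<close>, \<open>S\<close> and the Hessian of
  \<open>F\<close> on the adapted neighbourhood\<close>

definition gF :: "'a \<times> 'b \<Rightarrow> 'a" where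
  "gF z = grad (\<lambda>x. f (x, snd z)) (fst z) + grad (\<lambda>x. gh (x, snd z)) (fst z)"

definition HF :: "'a \<times> 'b \<Rightarrow> ('a \<times> 'b) \<Rightarrow>\<^sub>L 'a" where
  "HF z = Hf z + Hg z"

definition RH :: "'a \<Rightarrow> 'b \<Rightarrow> 'a \<Rightarrow> 'a" where
  "RH x u = rhess M (\<lambda>x. Fsum f g (x, u)) x"

lemma HF_apply: "HF z v = Hf z v + Hg z v"
  by (simp add: HF_def plus_blinfun.rep_eq)

lemma der_gF: "z \<in> N \<Longrightarrow> (gF has_derivative HF z) (at z)"
  unfolding gF_def[abs_def] HF_apply[abs_def] by (intro has_derivative_add der_f der_g)

lemma open_slice_N: "open {x. (x, u) \<in> N}"
proof -
  have "{x. (x, u) \<in> N} = (\<lambda>x. (x, u)) -` N" by auto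
  then show ?thesis by (auto intro!: continuous_open_vimage open_N continuous_intros)
qed

lemma open_slice_N2: "open {u. (x, u) \<in> N}"
proof -
  have "{u. (x, u) \<in> N} = (\<lambda>u. (x, u)) -` N" by auto
  then show ?thesis by (auto intro!: continuous_open_vimage open_N continuous_intros)
qed

lemma g_extension:
  assumes "(x, u) \<in> N"
  shows "is_C2_extension M (\<lambda>x. g (x, u)) x (\<lambda>x. gh (x, u))"
  unfolding is_C2_extension_def
  by (intro exI[of _ "{x. (x, u) \<in> N}"] conjI open_slice_N C2_on_slice C2_gh) (use assms g_eq in auto)

lemma F_extension:
  assumes "(x, u) \<in> N"
  shows "is_C2_extension M (\<lambda>x. Fsum f g (x, u)) x (\<lambda>x. f (x, u) + gh (x, u))"
  unfolding is_C2_extension_def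
  by (intro exI[of _ "{x. (x, u) \<in> N}"] conjI open_slice_N C2_on_add C2_on_slice C2_gh C2_f)
    (use assms g_eq in \<open>auto simp: Fsum_def\<close>)

lemma grad_F:
  assumes "(x, u) \<in> N"
  shows "grad (\<lambda>x. f (x, u) + gh (x, u)) x = gF (x, u)"
proof -
  have x: "x \<in> {x. (x, u) \<in> N}" using assms by simp
  from grad_add[OF C2_on_has_derivative_grad[OF C2_on_slice[OF C2_f] x] C2_on_has_derivative_grad[OF C2_on_slice[OF C2_gh] x]]
  show ?thesis by (simp add: gF_def)
qed

lemma hess_F:
  assumes "(x, u) \<in> N"
  shows "hess (\<lambda>x. f (x, u) + gh (x, u)) x = (\<lambda>v. HF (x, u) (v, 0))"
proof -
  have "((\<lambda>x. (x, u)) has_derivative (\<lambda>v. (v, 0))) (at x)"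
    by (auto intro!: derivative_eq_intros)
  from has_derivative_compose[OF this der_gF[OF assms]]
  have "((\<lambda>x. gF (x, u)) has_derivative (\<lambda>v. HF (x, u) (v, 0))) (at x)" .
  then have "(grad (\<lambda>x. f (x, u) + gh (x, u)) has_derivative (\<lambda>v. HF (x, u) (v, 0))) (at x)"
    by (rule has_derivative_transform_within_open[OF _ open_slice_N[of u]]) (use assms grad_F in auto)
  then show ?thesis unfolding hess_def by (metis frechet_derivative_at)
qed

lemma RH_works:
  assumes z: "(x, u) \<in> N" "x \<in> M"
  shows "linear (RH x u)" and "RH x u v \<in> tangent_space M x"
    and "b \<in> E \<Longrightarrow> RH x u v \<bullet> \<Psi>' (\<Phi> x) b = HF (x, u) (tproj M x v, 0) \<bullet> \<Psi>' (\<Phi> x) b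
      + nproj M x (gF (x, u)) \<bullet> \<Psi>'' (\<Phi> x) (\<Phi>' x (tproj M x v)) b"
  using rhess_works[OF z(2) N_V[OF z(1)] F_extension[OF z(1)]]
  by (auto simp: RH_def grad_F[OF z(1)] hess_F[OF z(1)])

lemma psd_g:
  assumes z: "(x, u) \<in> N" "x \<in> M" and t: "t \<in> tangent_space M x"
  shows "0 \<le> Hg (x, u) (t, 0) \<bullet> t
    + (nproj M x (grad (\<lambda>x. gh (x, u)) x) - nproj M x (nu f g x u)) \<bullet> \<Psi>'' (\<Phi> x) (\<Phi>' x t) (\<Phi>' x t)"
proof -
  have x: "x \<in> M" "x \<in> V" using z N_V by auto
  interpret P: linear "tproj M x" by (rule linear_tproj[OF x])
  note o = convex_subgradient_order_conditions[OF x g_extension[OF z(1)] nu_sub[OF z]]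
  have "nproj M x (grad (\<lambda>x. gh (x, u)) x) - nproj M x (nu f g x u) = grad (\<lambda>x. gh (x, u)) x - nu f g x u"
    using tproj_normal[OF x o(1)] by (simp add: nproj_eq[OF x] P.diff)
  then show ?thesis
    using o(2)[OF \<Phi>'_tangent_in_E[OF x t]] by (simp add: \<Psi>'_\<Phi>'[OF x(2)] hess_g[OF z(1)])
qed

text \<open>The curvature term of the Hessian of \<open>F\<close> thus coincides with that of
  \<open>Qt\<close>, which is built from \<open>g\<close> and \<open>nu\<close> alone; the identity
  between the two operators is therefore exact on all of \<open>N\<close>.\<close>

lemma nproj_gF:
  assumes z: "(x, u) \<in> N" "x \<in> M"
  shows "nproj M x (gF (x, u)) = nproj M x (grad (\<lambda>x. gh (x, u)) x) - nproj M x (nu f g x u)"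
proof -
  have x: "x \<in> M" "x \<in> V" using z N_V by auto
  interpret P: linear "tproj M x" by (rule linear_tproj[OF x])
  show ?thesis using nu_normal[OF z] by (simp add: nproj_eq[OF x] P.add gF_def algebra_simps)
qed

lemma RH_pos_def:
  assumes z: "(x, u) \<in> N" "x \<in> M" and t: "t \<in> tangent_space M x"
  shows "c * (t \<bullet> t) \<le> RH x u t \<bullet> t"
proof -
  have x: "x \<in> M" "x \<in> V" using z N_V by auto
  have "RH x u t \<bullet> t = HF (x, u) (t, 0) \<bullet> t + nproj M x (gF (x, u)) \<bullet> \<Psi>'' (\<Phi> x) (\<Phi>' x t) (\<Phi>' x t)"
    using RH_works(3)[OF z \<Phi>'_tangent_in_E[OF x t], of t] by (simp add: \<Psi>'_\<Phi>'[OF x(2)] tproj_id[OF t])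
  then show ?thesis
    using psd_g[OF z t] pd_f[OF z t] by (simp add: HF_apply nproj_gF[OF z] inner_add_left)
qed

lemma RH_pseudoinverse:
  assumes z: "(x, u) \<in> N" "x \<in> M"
  shows "linear (pseudoinverse (RH x u))" and "pseudoinverse (RH x u) v \<in> tangent_space M x"
    and "RH x u (pseudoinverse (RH x u) v) = tproj M x v"
proof -
  have x: "x \<in> M" "x \<in> V" using z N_V by auto
  have P: "RH x u (tproj M x v) = RH x u v" for v
    unfolding RH_def rhess_def weingarten_def by (simp add: tproj_id[OF tproj_in[OF x]])
  have "\<forall>v\<in>tangent_space M x. RH x u v = 0 \<longrightarrow> v = 0"
  proof (intro ballI impI)
    fix v assume v: "v \<in> tangent_space M x" "RH x u v = 0"
    have "c * (v \<bullet> v) \<le> 0" using RH_pos_def[OF z v(1)] v(2) by simp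
    then show "v = 0" using c_pos by (metis inner_gt_zero_iff mult_pos_pos not_le)
  qed
  note ps = pseudoinverse_on_subspace[OF subspace_tangent[OF x] RH_works(1,2)[OF z] P[unfolded tproj_def] this]
  show "linear (pseudoinverse (RH x u))" "pseudoinverse (RH x u) v \<in> tangent_space M x"
    "RH x u (pseudoinverse (RH x u) v) = tproj M x v"
    unfolding tproj_def by (fact ps)+
qed

lemma Qt_works:
  assumes z: "(x, u) \<in> N" "x \<in> M" and \<alpha>: "0 < \<alpha>"
  defines "Q \<equiv> Qt M f g \<alpha> x u"
  shows "Q v - tproj M x (tproj M x v - \<alpha> *\<^sub>R Hf (x, u) (tproj M x v, 0)) = \<alpha> *\<^sub>R RH x u v"
    and "linear Q" and "Q v \<in> tangent_space M x"
    and "linear (pseudoinverse Q)" and "pseudoinverse Q v \<in> tangent_space M x"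
    and "Q (pseudoinverse Q v) = tproj M x v" and "pseudoinverse Q (Q v) = tproj M x v"
    and "pseudoinverse Q (tproj M x v) = pseudoinverse Q v"
proof -
  have x: "x \<in> M" "x \<in> V" using z N_V by auto
  interpret P: linear "tproj M x" by (rule linear_tproj[OF x])
  note w = weingarten_works[OF x nproj_in]
  note r = rhess_works[OF x g_extension[OF z(1)]]
  have Q_eq: "Q = (\<lambda>v. tproj M x v - \<alpha> *\<^sub>R weingarten M x v (nproj M x (nu f g x u))
     + \<alpha> *\<^sub>R rhess M (\<lambda>x. g (x, u)) x v)" by (simp add: Q_def Qt_def fun_eq_iff)
  show lin: "linear Q"
    unfolding Q_eq
    by (intro linear_compose_add linear_compose_sub linear_compose_scale_right w(1) r(1) P.linear_axioms)
  show inT: "Q v \<in> tangent_space M x" for v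
    unfolding Q_eq
    by (intro subspace_add subspace_diff subspace_scale subspace_tangent x w(2) r(2) tproj_in)
  have QP: "Q (tproj M x v) = Q v" for v
    unfolding Q_eq rhess_def weingarten_def by (simp add: tproj_id[OF tproj_in[OF x]])
  \<comment> \<open>In coordinates the Weingarten term of \<open>nu\<close> and the normal part in
    the Riemannian Hessian of \<open>g\<close> enter through the same second derivative of
    \<open>\<Psi>\<close> and merge.\<close>
  have inner: "Q v \<bullet> \<Psi>' (\<Phi> x) b = v \<bullet> \<Psi>' (\<Phi> x) b + \<alpha> * (Hg (x, u) (tproj M x v, 0) \<bullet> \<Psi>' (\<Phi> x) b
      + (nproj M x (grad (\<lambda>x. gh (x, u)) x) - nproj M x (nu f g x u)) \<bullet> \<Psi>'' (\<Phi> x) (\<Phi>' x (tproj M x v)) b)"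
    if b: "b \<in> E" for b v
    unfolding Q_eq using w(3)[OF b] r(3)[OF b] tproj_inner[OF x tangent_in[OF x b]]
    by (simp add: inner_add_left inner_diff_left hess_g[OF z(1)] algebra_simps)
  show "Q v - tproj M x (tproj M x v - \<alpha> *\<^sub>R Hf (x, u) (tproj M x v, 0)) = \<alpha> *\<^sub>R RH x u v"
  proof (rule tangent_eqI[OF x])
    show "Q v - tproj M x (tproj M x v - \<alpha> *\<^sub>R Hf (x, u) (tproj M x v, 0)) \<in> tangent_space M x"
      by (intro subspace_diff subspace_tangent x inT tproj_in)
    show "\<alpha> *\<^sub>R RH x u v \<in> tangent_space M x"
      by (intro subspace_scale subspace_tangent x RH_works(2) z)
    fix b assume b: "b \<in> E"
    show "(Q v - tproj M x (tproj M x v - \<alpha> *\<^sub>R Hf (x, u) (tproj M x v, 0))) \<bullet> \<Psi>' (\<Phi> x) b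
        = (\<alpha> *\<^sub>R RH x u v) \<bullet> \<Psi>' (\<Phi> x) b"
    proof -
      have "RH x u v \<bullet> \<Psi>' (\<Phi> x) b = Hf (x, u) (tproj M x v, 0) \<bullet> \<Psi>' (\<Phi> x) b
          + Hg (x, u) (tproj M x v, 0) \<bullet> \<Psi>' (\<Phi> x) b
          + (nproj M x (grad (\<lambda>x. gh (x, u)) x) - nproj M x (nu f g x u)) \<bullet> \<Psi>'' (\<Phi> x) (\<Phi>' x (tproj M x v)) b"
        unfolding RH_works(3)[OF z b] nproj_gF[OF z] HF_apply inner_add_left ..
      moreover have "tproj M x (tproj M x v - \<alpha> *\<^sub>R Hf (x, u) (tproj M x v, 0)) \<bullet> \<Psi>' (\<Phi> x) b
          = v \<bullet> \<Psi>' (\<Phi> x) b - \<alpha> * (Hf (x, u) (tproj M x v, 0) \<bullet> \<Psi>' (\<Phi> x) b)"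
        by (simp add: tproj_inner[OF x tangent_in[OF x b]] inner_diff_left)
      ultimately show ?thesis
        unfolding inner_diff_left[of "Q v"] inner_scaleR_left inner[OF b] by (simp only: distrib_left)
    qed
  qed
  have "\<forall>v\<in>tangent_space M x. Q v = 0 \<longrightarrow> v = 0"
  proof (intro ballI impI)
    fix v assume v: "v \<in> tangent_space M x" "Q v = 0"
    have "Q v \<bullet> v = v \<bullet> v + \<alpha> * (Hg (x, u) (v, 0) \<bullet> v
      + (nproj M x (grad (\<lambda>x. gh (x, u)) x) - nproj M x (nu f g x u)) \<bullet> \<Psi>'' (\<Phi> x) (\<Phi>' x v) (\<Phi>' x v))"
      using inner[OF \<Phi>'_tangent_in_E[OF x v(1)], of v] by (simp add: \<Psi>'_\<Phi>'[OF x(2)] tproj_id[OF v(1)])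
    moreover have "0 \<le> \<alpha> * (Hg (x, u) (v, 0) \<bullet> v
      + (nproj M x (grad (\<lambda>x. gh (x, u)) x) - nproj M x (nu f g x u)) \<bullet> \<Psi>'' (\<Phi> x) (\<Phi>' x v) (\<Phi>' x v))"
      using psd_g[OF z v(1)] \<alpha> by simp
    ultimately have "v \<bullet> v \<le> 0" using v(2) by simp
    then show "v = 0" by (metis inner_gt_zero_iff not_le)
  qed
  note ps = pseudoinverse_on_subspace[OF subspace_tangent[OF x] lin inT QP[unfolded tproj_def] this]
  show "linear (pseudoinverse Q)" "pseudoinverse Q v \<in> tangent_space M x"
    "Q (pseudoinverse Q v) = tproj M x v" "pseudoinverse Q (Q v) = tproj M x v"
    "pseudoinverse Q (tproj M x v) = pseudoinverse Q v"
    unfolding tproj_def by (fact ps)+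
qed

lemma mixed_grad_has_derivative:
  assumes z: "(x, u) \<in> N" "x \<in> M"
  shows "(mixed_grad M f g x has_derivative (\<lambda>w. Hf (x, u) (0, w) + tproj M x (Hg (x, u) (0, w)))) (at u)"
proof -
  have x: "x \<in> M" "x \<in> V" using z N_V by auto
  have bl: "bounded_linear (tproj M x)" using linear_tproj[OF x] linear_conv_bounded_linear by blast
  have "((\<lambda>u. grad (\<lambda>x. f (x, u)) x + tproj M x (grad (\<lambda>x. gh (x, u)) x)) has_derivative
      (\<lambda>w. Hf (x, u) (0, w) + tproj M x (Hg (x, u) (0, w)))) (at u)"
    by (intro has_derivative_add der_f_u z bounded_linear.has_derivative[OF bl der_g_u])
  then show ?thesis
    by (rule has_derivative_transform_within_open[OF _ open_slice_N2[of x]])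
      (use z rgrad_eq[OF x g_extension] in \<open>auto simp: mixed_grad_def\<close>)
qed

lemma rgrad_F_has_derivative:
  assumes z: "(x, u) \<in> N" "x \<in> M"
  shows "((\<lambda>u. rgrad M (\<lambda>x. Fsum f g (x, u)) x) has_derivative (\<lambda>w. tproj M x (HF (x, u) (0, w)))) (at u)"
proof -
  have x: "x \<in> M" "x \<in> V" using z N_V by auto
  have bl: "bounded_linear (tproj M x)" using linear_tproj[OF x] linear_conv_bounded_linear by blast
  have "((\<lambda>u. tproj M x (grad (\<lambda>x. f (x, u)) x + grad (\<lambda>x. gh (x, u)) x)) has_derivative
      (\<lambda>w. tproj M x (HF (x, u) (0, w)))) (at u)"
    unfolding HF_apply by (intro bounded_linear.has_derivative[OF bl] has_derivative_add der_f_u der_g_u z)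
  then show ?thesis
    by (rule has_derivative_transform_within_open[OF _ open_slice_N2[of x]])
      (use z rgrad_eq[OF x F_extension] grad_F in \<open>auto simp: gF_def\<close>)
qed

text \<open>A vector in the kernel of the operator to be inverted is tangent, and the identity in
  \<open>Qt_works\<close> shows that the Hessian of \<open>F\<close> kills it; so it is zero, and
  injectivity gives bijectivity in finite dimension. The inverse is then evaluated by exhibiting the
  preimage.\<close>

lemma phit_works:
  assumes z: "(x, u) \<in> N" "x \<in> M" and \<alpha>: "0 < \<alpha>"
  shows "phit_well_defined M f g \<alpha> x u"
    and "phit M f g \<alpha> x u = (\<lambda>w. - pseudoinverse (RH x u) (tproj M x (HF (x, u) (0, w))))"
proof -
  have x: "x \<in> M" "x \<in> V" using z N_V by auto
  interpret P: linear "tproj M x" by (rule linear_tproj[OF x])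
  note Q = Qt_works[OF z \<alpha>]
  interpret B: linear "pseudoinverse (Qt M f g \<alpha> x u)" by (rule Q(4))
  note H = RH_pseudoinverse[OF z]
  interpret H: linear "pseudoinverse (RH x u)" by (rule H(1))
  interpret RH: linear "RH x u" by (rule RH_works(1)[OF z])
  let ?B = "pseudoinverse (Qt M f g \<alpha> x u)"
  let ?K = "\<lambda>v. v - Rt M f g \<alpha> x u (tproj M x v)"
  have K: "?K v = v - ?B (tproj M x v - \<alpha> *\<^sub>R Hf (x, u) (tproj M x v, 0))" for v
    by (simp add: Rt_def hess_f[OF z(1)])
  have pair: "(a + b, 0) = (a, 0) + (b, 0::'b)" "(r *\<^sub>R a, 0) = r *\<^sub>R (a, 0::'b)" for a b :: 'a and r
    by simp_all
  have linK: "linear ?K"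
    unfolding K
    by (rule linearI)
      (simp_all add: P.add P.scale B.add B.diff B.scale pair blinfun.add_right blinfun.scaleR_right
        algebra_simps del: add_Pair scaleR_Pair)
  have injK: "v = 0" if "?K v = 0" for v
  proof -
    have v: "v = ?B (tproj M x v - \<alpha> *\<^sub>R Hf (x, u) (tproj M x v, 0))" using that unfolding K by simp
    then have vT: "v \<in> tangent_space M x" using Q(5) by metis
    have "Qt M f g \<alpha> x u v = tproj M x (tproj M x v - \<alpha> *\<^sub>R Hf (x, u) (tproj M x v, 0))"
      using v Q(6) by metis
    then have "\<alpha> *\<^sub>R RH x u v = 0" using Q(1)[of v] by simp
    then have "c * (v \<bullet> v) \<le> 0" using RH_pos_def[OF z vT] \<alpha> by simp
    then show ?thesis using c_pos by (metis inner_gt_zero_iff mult_pos_pos not_le)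
  qed
  have inj: "inj ?K" using linear_injective_0[OF linK] injK by blast
  then have bij: "bij ?K" using linear_injective_imp_surjective[OF linK] by (simp add: bij_def)
  \<comment> \<open>\<open>mixed_grad\<close> leaves the gradient of \<open>f\<close> unprojected;
    as the pseudoinverse factors through the tangential projection, the full mixed derivative
    \<open>HF\<close> may be inserted.\<close>
  have St: "St M f g \<alpha> x u w = - (\<alpha> *\<^sub>R ?B (HF (x, u) (0, w)))" for w
  proof -
    let ?D = "Hf (x, u) (0, w) + tproj M x (Hg (x, u) (0, w))"
    have "tproj M x ?D = tproj M x (HF (x, u) (0, w))"
      by (simp add: HF_apply P.add tproj_id[OF tproj_in[OF x]])
    then have "?B ?D = ?B (HF (x, u) (0, w))" using Q(8) by metis
    then show ?thesis
      unfolding St_def frechet_derivative_at[OF mixed_grad_has_derivative[OF z], symmetric] by simp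
  qed
  show phit: "phit M f g \<alpha> x u = (\<lambda>w. - pseudoinverse (RH x u) (tproj M x (HF (x, u) (0, w))))"
  proof
    fix w
    define k where "k = HF (x, u) (0, w)"
    \<comment> \<open>The candidate preimage. As \<open>y\<close> is tangent, the identity in
      \<open>Qt_works\<close> gives \<open>?K y = ?B (\<alpha> *\<^sub>R RH x u y)\<close>, and this
      factor \<alpha> matches the one in \<open>St\<close>.\<close>
    define y where "y = - pseudoinverse (RH x u) (tproj M x k)"
    have yT: "y \<in> tangent_space M x"
      unfolding y_def using subspace_neg[OF subspace_tangent[OF x] H(2)] .
    have RHy: "RH x u y = - tproj M x k"
      unfolding y_def using H(3) by (simp add: RH.neg tproj_id[OF tproj_in[OF x]])
    let ?r = "y - \<alpha> *\<^sub>R Hf (x, u) (y, 0)"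
    have "?K y = y - ?B ?r" using K[of y] by (simp only: tproj_id[OF yT])
    also have "\<dots> = ?B (Qt M f g \<alpha> x u y) - ?B (tproj M x ?r)"
      using Q(7)[of y] Q(8)[of ?r] by (simp only: tproj_id[OF yT])
    also have "\<dots> = ?B (Qt M f g \<alpha> x u y - tproj M x ?r)" by (simp only: B.diff)
    also have "\<dots> = ?B (\<alpha> *\<^sub>R RH x u y)" using Q(1)[of y] by (simp only: tproj_id[OF yT])
    also have "\<dots> = - (\<alpha> *\<^sub>R ?B k)" unfolding RHy using Q(8) by (simp add: B.scale B.neg)
    also have "\<dots> = St M f g \<alpha> x u w" unfolding St k_def ..
    finally have e: "?K y = St M f g \<alpha> x u w" .
    have "inv ?K (?K y) = y" by (rule inv_f_f[OF inj])
    then have "phit M f g \<alpha> x u w = y" unfolding phit_def e .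
    then show "phit M f g \<alpha> x u w = - pseudoinverse (RH x u) (tproj M x (HF (x, u) (0, w)))"
      unfolding y_def k_def .
  qed
  have pair2: "(0, a + b) = (0::'a, a) + (0, b)" "(0, r *\<^sub>R a) = r *\<^sub>R (0::'a, a)" for a b :: 'b and r
    by simp_all
  have "linear (phit M f g \<alpha> x u)"
    unfolding phit
    by (rule linearI)
      (simp_all add: P.add P.scale H.add H.scale pair2 blinfun.add_right blinfun.scaleR_right del: add_Pair scaleR_Pair)
  moreover have "convex_subdiff (\<lambda>x. g (x, u)) x \<noteq> {}" using nu_sub[OF z] by blast
  moreover have "mixed_grad M f g x differentiable (at u)"
    using mixed_grad_has_derivative[OF z] unfolding differentiable_def by blast
  ultimately show "phit_well_defined M f g \<alpha> x u"
    unfolding phit_well_defined_def using linK bij g_extension[OF z(1)] by blast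
qed

text \<open>At the zero normal vector \<open>weingarten\<close> still refers to a chosen extension,
  which may be a nonzero field; the pairing formula shows that the operator vanishes.\<close>

lemma Wcorr_eq_0:
  assumes z: "(x, u) \<in> N" "x \<in> M"
  shows "Wcorr M f g \<alpha> x u v = 0"
proof -
  have x: "x \<in> M" "x \<in> V" using z N_V by auto
  have n: "0 \<in> normal_space M x" by (simp add: normal_iff[OF x])
  have "weingarten M x v 0 = 0"
    by (rule tangent_eqI[OF x weingarten_works(2)[OF x n]])
      (simp_all add: subspace_0[OF subspace_tangent[OF x]] weingarten_works(3)[OF x n])
  then show ?thesis by (simp add: Wcorr_def nu_normal[OF z])
qed

lemma phit_formula:
  assumes z: "(x, u) \<in> N" "x \<in> M" and \<alpha>: "0 < \<alpha>"
  shows "phit M f g \<alpha> x u = (\<lambda>w. - pseudoinverse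
      (\<lambda>v. rhess M (\<lambda>x. Fsum f g (x, u)) x v + Wcorr M f g \<alpha> x u v)
      (frechet_derivative (\<lambda>u. rgrad M (\<lambda>x. Fsum f g (x, u)) x) (at u) w))"
  unfolding phit_works(2)[OF assms] Wcorr_eq_0[OF z]
    frechet_derivative_at[OF rgrad_F_has_derivative[OF z], symmetric]
  by (simp add: RH_def)

end

section \<open>The linear equation for the approximate derivative and its stability\<close>

context CPSO_chart
begin

text \<open>A description without pseudoinverses: \<open>phit\<close> is the unique tangent solution
  of a linear equation tested against coordinate vectors. Uniqueness comes from the lower bound
  \<open>c\<close>.\<close>

lemma phit_characterization:
  assumes z: "(x, u) \<in> N" "x \<in> M" and \<alpha>: "0 < \<alpha>"
  shows "phit M f g \<alpha> x u w \<in> tangent_space M x"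
    and "b \<in> E \<Longrightarrow> RH x u (phit M f g \<alpha> x u w) \<bullet> \<Psi>' (\<Phi> x) b = - (HF (x, u) (0, w) \<bullet> \<Psi>' (\<Phi> x) b)"
    and "y \<in> tangent_space M x \<Longrightarrow>
      (\<And>b. b \<in> E \<Longrightarrow> RH x u y \<bullet> \<Psi>' (\<Phi> x) b = - (HF (x, u) (0, w) \<bullet> \<Psi>' (\<Phi> x) b)) \<Longrightarrow>
      phit M f g \<alpha> x u w = y"
proof -
  have x: "x \<in> M" "x \<in> V" using z N_V by auto
  interpret RH: linear "RH x u" by (rule RH_works(1)[OF z])
  let ?p = "phit M f g \<alpha> x u w"
  note H = RH_pseudoinverse[OF z]
  have p: "?p = - pseudoinverse (RH x u) (tproj M x (HF (x, u) (0, w)))"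
    using phit_works(2)[OF z \<alpha>] by (rule fun_cong)
  show pT: "?p \<in> tangent_space M x"
    unfolding p using subspace_neg[OF subspace_tangent[OF x] H(2)] .
  have RHp: "RH x u ?p = - tproj M x (HF (x, u) (0, w))"
    unfolding p using H(3) by (simp add: RH.neg tproj_id[OF tproj_in[OF x]])
  have *: "RH x u ?p \<bullet> \<Psi>' (\<Phi> x) b = - (HF (x, u) (0, w) \<bullet> \<Psi>' (\<Phi> x) b)" if "b \<in> E" for b
    unfolding RHp using tproj_inner[OF x tangent_in[OF x that]] by simp
  then show "b \<in> E \<Longrightarrow> RH x u ?p \<bullet> \<Psi>' (\<Phi> x) b = - (HF (x, u) (0, w) \<bullet> \<Psi>' (\<Phi> x) b)" .
  assume y: "y \<in> tangent_space M x"
    "\<And>b. b \<in> E \<Longrightarrow> RH x u y \<bullet> \<Psi>' (\<Phi> x) b = - (HF (x, u) (0, w) \<bullet> \<Psi>' (\<Phi> x) b)"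
  have "RH x u ?p = RH x u y"
    by (rule tangent_eqI[OF x RH_works(2)[OF z] RH_works(2)[OF z]]) (simp add: * y(2))
  then have "c * ((?p - y) \<bullet> (?p - y)) \<le> 0"
    using RH_pos_def[OF z subspace_diff[OF subspace_tangent[OF x] pT y(1)]] by (simp add: RH.diff)
  then have "?p - y = 0" using c_pos by (metis inner_gt_zero_iff mult_pos_pos not_le)
  then show "?p = y" by simp
qed

text \<open>By \<open>phit_characterization\<close> it suffices that the derivative of \<psi> is
  tangent and solves the same equation.\<close>

lemma phit_eq_derivative_of_minimizers:
  assumes U: "open U" "C1_on U \<psi>" "u \<in> U" "\<And>v. v \<in> U \<Longrightarrow> \<psi> v \<in> M"
    and min: "\<And>v y. v \<in> U \<Longrightarrow> y \<in> M \<Longrightarrow> y \<noteq> \<psi> v \<Longrightarrow> Fsum f g (\<psi> v, v) < Fsum f g (y, v)"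
    and z: "(\<psi> u, u) \<in> N" and \<alpha>: "0 < \<alpha>"
  shows "phit M f g \<alpha> (\<psi> u) u w = frechet_derivative \<psi> (at u) w"
proof -
  have x: "\<psi> u \<in> M" "\<psi> u \<in> V" using z N_V U by auto
  obtain D where D: "(\<psi> has_derivative blinfun_apply D) (at u)" using C1_onE[OF U(2)] U(3) by metis
  have fd: "frechet_derivative \<psi> (at u) = blinfun_apply D" using frechet_derivative_at[OF D] by simp
  have pair: "((\<lambda>v. (\<psi> v, v)) has_derivative (\<lambda>w. (D w, w))) (at u)"
    by (intro has_derivative_Pair D has_derivative_ident)
  have "isCont (\<lambda>v. (\<psi> v, v)) u" using has_derivative_continuous[OF pair] .
  then have "filterlim (\<lambda>v. (\<psi> v, v)) (nhds (\<psi> u, u)) (nhds u)"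
    unfolding isCont_def by (rule tendsto_at_iff_tendsto_nhds[of "\<lambda>v. (\<psi> v, v)" u, THEN iffD1])
  then have evN: "\<forall>\<^sub>F v in nhds u. (\<psi> v, v) \<in> N"
    by (rule eventually_compose_filterlim[rotated]) (use z open_N in \<open>intro eventually_nhds_in_open\<close>)
  have evU: "\<forall>\<^sub>F v in nhds u. v \<in> U" using U by (intro eventually_nhds_in_open)
  \<comment> \<open>The first order condition with zero functional: along \<open>M\<close> and near
    the point, \<open>F\<close> is the smooth function \<open>f + gh\<close>.\<close>
  have stat: "gF (\<psi> v, v) \<in> normal_space M (\<psi> v)" if v: "(\<psi> v, v) \<in> N" "v \<in> U" for v
  proof -
    have xv: "\<psi> v \<in> M" "\<psi> v \<in> V" using v N_V U by auto
    have "f (\<psi> v, v) + gh (\<psi> v, v) + 0 \<bullet> (y - \<psi> v) \<le> f (y, v) + gh (y, v)" if y: "y \<in> M" "y \<in> {x. (x, v) \<in> N}" for y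
    proof (cases "y = \<psi> v")
      case False
      then have "Fsum f g (\<psi> v, v) < Fsum f g (y, v)" using min v y by blast
      then show ?thesis using g_eq[of y v] g_eq[OF v(1) xv(1)] y by (simp add: Fsum_def)
    qed simp
    from order_conditions_along_chart(1)[OF xv open_slice_N _ C2_on_add[OF C2_on_slice[OF C2_f] C2_on_slice[OF C2_gh]] this]
    show ?thesis using v grad_F[OF v(1)] by simp
  qed
  have "((\<lambda>v. \<Phi> (\<psi> v)) has_derivative (\<lambda>w. \<Phi>' (\<psi> u) (D w))) (at u)"
    by (rule has_derivative_compose[OF D \<Phi>'[OF x(2)]])
  note d\<Phi> = this
  \<comment> \<open>In coordinates \<psi> runs in \<open>E\<close>, so its derivative does too;
    hence the derivative of \<psi> is tangent.\<close>
  have "\<forall>\<^sub>F v in nhds u. \<Phi> (\<psi> v) \<in> E"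
    using evN evU by eventually_elim (use \<Phi>_in_E U(4) N_V in blast)
  then have DE: "\<Phi>' (\<psi> u) (D w) \<in> E" for w by (rule has_derivative_in_subspace[OF d\<Phi> subspace_E])
  then have DT: "D w \<in> tangent_space M (\<psi> u)" using tangent_in[OF x DE[of w]] \<Psi>'_\<Phi>'[OF x(2)] by simp
  have "RH (\<psi> u) u (D w) \<bullet> \<Psi>' (\<Phi> (\<psi> u)) b = - (HF (\<psi> u, u) (0, w) \<bullet> \<Psi>' (\<Phi> (\<psi> u)) b)" if b: "b \<in> E" for b
  proof -
    have d1: "((\<lambda>v. gF (\<psi> v, v)) has_derivative (\<lambda>w. HF (\<psi> u, u) (D w, w))) (at u)"
      by (rule has_derivative_compose[OF pair der_gF[OF z]])
    have d2: "((\<lambda>v. \<Psi>' (\<Phi> (\<psi> v)) b) has_derivative (\<lambda>w. \<Psi>'' (\<Phi> (\<psi> u)) (\<Phi>' (\<psi> u) (D w)) b)) (at u)"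
      by (rule bounded_linear.has_derivative[OF blinfun.bounded_linear_left
            has_derivative_compose[OF d\<Phi> \<Psi>''[OF \<Phi>_in[OF x(2)]]]])
    have "\<forall>\<^sub>F v in nhds u. gF (\<psi> v, v) \<bullet> \<Psi>' (\<Phi> (\<psi> v)) b \<in> {0}"
      using evN evU
    proof eventually_elim
      case (elim v)
      then have "\<psi> v \<in> M" "\<psi> v \<in> V" using N_V U by auto
      then show ?case using stat[OF elim] b normal_iff by auto
    qed
    from has_derivative_in_subspace[OF has_derivative_inner[OF d1 d2] subspace_single_0 this, of w]
    have 0: "gF (\<psi> u, u) \<bullet> \<Psi>'' (\<Phi> (\<psi> u)) (\<Phi>' (\<psi> u) (D w)) b + HF (\<psi> u, u) (D w, w) \<bullet> \<Psi>' (\<Phi> (\<psi> u)) b = 0"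
      by simp
    have "(D w, w) = (D w, 0) + (0, w)" by simp
    then have "HF (\<psi> u, u) (D w, w) = HF (\<psi> u, u) (D w, 0) + HF (\<psi> u, u) (0, w)"
      by (metis blinfun.add_right)
    \<comment> \<open>At a stationary point the whole gradient is normal, so the curvature term from
      the product rule is the one in the Riemannian Hessian.\<close>
    moreover have "nproj M (\<psi> u) (gF (\<psi> u, u)) = gF (\<psi> u, u)"
      using tproj_normal[OF x stat[OF z U(3)]] by (simp add: nproj_eq[OF x])
    ultimately show ?thesis
      using 0 RH_works(3)[OF z x(1) b, of "D w"] by (simp add: tproj_id[OF DT] inner_add_left)
  qed
  from phit_characterization(3)[OF z x(1) \<alpha> DT this] show ?thesis by (simp add: fd)
qed

text \<open>The value at \<open>x0\<close> is transported to nearby points with fixed chart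
  coordinates \<open>a\<close>; the residual of the linear equation at the transported vector tends
  to 0. The lower bound \<open>c\<close>, the same at all points, converts the residual into a bound
  on the distance to the true solution.\<close>

lemma tendsto_phit:
  assumes z: "(x0, u) \<in> N" "x0 \<in> M" and \<alpha>: "0 < \<alpha>"
  shows "((\<lambda>x. phit M f g \<alpha> x u w) \<longlongrightarrow> phit M f g \<alpha> x0 u w) (inf (nhds x0) (principal M))"
proof -
  let ?F = "inf (nhds x0) (principal M)"
  let ?y = "\<lambda>x. phit M f g \<alpha> x u w"
  have x0: "x0 \<in> M" "x0 \<in> V" using z N_V by auto
  have id: "((\<lambda>x. x) \<longlongrightarrow> x0) ?F" by (rule tendsto_mono[OF inf_le1 filterlim_ident])
  have evM: "\<forall>\<^sub>F x in ?F. x \<in> M" by (simp add: eventually_inf_principal)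
  have evN: "\<forall>\<^sub>F x in ?F. (x, u) \<in> N"
    using topological_tendstoD[OF id open_slice_N[of u]] z by simp
  have pr: "((\<lambda>x. (x, u)) \<longlongrightarrow> (x0, u)) ?F" by (intro tendsto_Pair id tendsto_const)
  have "isCont HF (x0, u)"
    using continuous_on_add[OF cont_Hf cont_Hg] z(1) open_N
    unfolding HF_def[abs_def] by (simp add: continuous_on_eq_continuous_at)
  from isCont_tendsto_compose[OF this pr] have HFl: "((\<lambda>x. HF (x, u)) \<longlongrightarrow> HF (x0, u)) ?F" .
  have "isCont gF (x0, u)" using has_derivative_continuous[OF der_gF[OF z(1)]] .
  from isCont_tendsto_compose[OF this pr] have gFl: "((\<lambda>x. gF (x, u)) \<longlongrightarrow> gF (x0, u)) ?F" .
  have "((\<lambda>x. gF (x, u) - tproj M x (gF (x, u))) \<longlongrightarrow> gF (x0, u) - tproj M x0 (gF (x0, u))) ?F"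
    by (intro tendsto_diff gFl tendsto_tproj[OF x0 id evM])
  moreover have "\<forall>\<^sub>F x in ?F. gF (x, u) - tproj M x (gF (x, u)) = nproj M x (gF (x, u))"
    using evM evN by eventually_elim (simp add: nproj_eq N_V)
  ultimately have nl: "((\<lambda>x. nproj M x (gF (x, u))) \<longlongrightarrow> nproj M x0 (gF (x0, u))) ?F"
    unfolding nproj_eq[OF x0] by (rule Lim_transform_eventually)
  note ch = tendsto_charts[OF x0(2) id]
  define a where "a = \<Phi>' x0 (?y x0)"
  have aE: "a \<in> E" unfolding a_def by (rule \<Phi>'_tangent_in_E[OF x0 phit_characterization(1)[OF z \<alpha>]])
  have ay: "\<Psi>' (\<Phi> x0) a = ?y x0" unfolding a_def by (rule \<Psi>'_\<Phi>'[OF x0(2)])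
  define A where "A x = \<Psi>' (\<Phi> x) a" for x
  have Al: "(A \<longlongrightarrow> ?y x0) ?F" unfolding A_def ay[symmetric] by (intro tendsto_intros ch)
  have Al': "(A \<longlongrightarrow> A x0) ?F" using Al by (simp add: A_def[of x0] ay)
  \<comment> \<open>The residual at the transported vector, written out so that each ingredient has
    a limit; for \<open>b\<close> in \<open>E\<close> it is a pairing of \<open>RH x u\<close>
    applied to the error.\<close>
  define R where "R x b = - (HF (x, u) (0, w) \<bullet> \<Psi>' (\<Phi> x) b) - (HF (x, u) (A x, 0) \<bullet> \<Psi>' (\<Phi> x) b
      + nproj M x (gF (x, u)) \<bullet> \<Psi>'' (\<Phi> x) a b)" for x b
  have R_eq: "R x b = RH x u (?y x - A x) \<bullet> \<Psi>' (\<Phi> x) b" if x: "x \<in> M" "(x, u) \<in> N" and b: "b \<in> E" for x b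
  proof -
    have xV: "x \<in> V" using x N_V by blast
    have AT: "A x \<in> tangent_space M x" unfolding A_def by (rule tangent_in[OF x(1) xV aE])
    interpret RH: linear "RH x u" by (rule RH_works(1)[OF x(2,1)])
    have "RH x u (A x) \<bullet> \<Psi>' (\<Phi> x) b = HF (x, u) (A x, 0) \<bullet> \<Psi>' (\<Phi> x) b + nproj M x (gF (x, u)) \<bullet> \<Psi>'' (\<Phi> x) a b"
      using RH_works(3)[OF x(2,1) b, of "A x"] by (simp add: tproj_id[OF AT]) (simp add: A_def \<Phi>'_\<Psi>'[OF xV])
    then show ?thesis
      using phit_characterization(2)[OF x(2,1) \<alpha> b] by (simp add: R_def RH.diff inner_diff_left)
  qed
  have R0: "R x0 b = 0" if "b \<in> E" for b
  proof -
    interpret RH: linear "RH x0 u" by (rule RH_works(1)[OF z])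
    show ?thesis using R_eq[OF z(2,1) that] by (simp add: A_def ay RH.zero)
  qed
  let ?P = "closest_point E"
  interpret P: linear ?P by (rule linear_closest_point_subspace[OF subspace_E])
  \<comment> \<open>The residual is linear in \<open>b\<close>, so it is controlled by its values at
    the projections of the basis vectors, which span \<open>E\<close>.\<close>
  define eps where "eps x = (\<Sum>i\<in>Basis. \<bar>R x (?P i)\<bar>)" for x
  have "(eps \<longlongrightarrow> (\<Sum>i\<in>Basis. \<bar>R x0 (?P i)\<bar>)) ?F"
    unfolding eps_def R_def
    by (intro tendsto_intros HFl nl ch tendsto_Pair Al')
  then have epsl: "(eps \<longlongrightarrow> 0) ?F" by (simp add: R0 closest_point_subspace_in[OF subspace_E])
  have "\<forall>\<^sub>F x in ?F. norm (?y x - A x) \<le> norm (\<Phi>' x) * eps x / c"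
    using evM evN
  proof eventually_elim
    case (elim x)
    have xV: "x \<in> V" using elim N_V by blast
    define t where "t = ?y x - A x"
    have tT: "t \<in> tangent_space M x"
      unfolding t_def A_def
      by (intro subspace_diff subspace_tangent elim xV phit_characterization(1) \<alpha> tangent_in aE)
    define e where "e = \<Phi>' x t"
    have eE: "e \<in> E" unfolding e_def by (rule \<Phi>'_tangent_in_E[OF elim(1) xV tT])
    have te: "t = \<Psi>' (\<Phi> x) e" unfolding e_def by (rule \<Psi>'_\<Phi>'[OF xV, symmetric])
    have "e = ?P e" using closest_point_self[OF eE] by simp
    also have "\<dots> = ?P (\<Sum>i\<in>Basis. (e \<bullet> i) *\<^sub>R i)" by (simp add: euclidean_representation)
    also have "\<dots> = (\<Sum>i\<in>Basis. (e \<bullet> i) *\<^sub>R ?P i)" by (simp add: P.sum P.scale)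
    finally have e_sum: "e = (\<Sum>i\<in>Basis. (e \<bullet> i) *\<^sub>R ?P i)" .
    have "c * (t \<bullet> t) \<le> RH x u t \<bullet> t" by (rule RH_pos_def[OF elim(2,1) tT])
    also have "\<dots> = R x e" using R_eq[OF elim eE] te unfolding t_def by simp
    also have "\<dots> = RH x u t \<bullet> \<Psi>' (\<Phi> x) (\<Sum>i\<in>Basis. (e \<bullet> i) *\<^sub>R ?P i)"
      using R_eq[OF elim eE] e_sum unfolding t_def by simp
    also have "\<dots> = (\<Sum>i\<in>Basis. (e \<bullet> i) * (RH x u t \<bullet> \<Psi>' (\<Phi> x) (?P i)))"
      by (simp add: blinfun.sum_right blinfun.scaleR_right inner_sum_right)
    also have "\<dots> = (\<Sum>i\<in>Basis. (e \<bullet> i) * R x (?P i))"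
      using R_eq[OF elim closest_point_subspace_in[OF subspace_E]] unfolding t_def by simp
    also have "\<dots> \<le> (\<Sum>i\<in>Basis. norm e * \<bar>R x (?P i)\<bar>)"
    proof (rule sum_mono)
      fix i :: 'a assume i: "i \<in> Basis"
      have "(e \<bullet> i) * R x (?P i) \<le> \<bar>e \<bullet> i\<bar> * \<bar>R x (?P i)\<bar>" by (metis abs_ge_self abs_mult)
      also have "\<dots> \<le> norm e * \<bar>R x (?P i)\<bar>" by (intro mult_right_mono Basis_le_norm i abs_ge_zero)
      finally show "(e \<bullet> i) * R x (?P i) \<le> norm e * \<bar>R x (?P i)\<bar>" .
    qed
    also have "\<dots> = norm e * eps x" by (simp add: eps_def sum_distrib_left)
    also have "\<dots> \<le> (norm (\<Phi>' x) * norm t) * eps x"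
      unfolding e_def by (intro mult_right_mono norm_blinfun) (simp add: eps_def sum_nonneg)
    finally have "norm t * (c * norm t) \<le> norm t * (norm (\<Phi>' x) * eps x)"
      by (simp add: dot_square_norm power2_eq_square algebra_simps)
    then have "c * norm t \<le> norm (\<Phi>' x) * eps x \<or> norm t = 0"
      using mult_left_le_imp_le[of "norm t"] norm_ge_zero[of t] by force
    moreover have "0 \<le> norm (\<Phi>' x) * eps x" by (simp add: eps_def sum_nonneg)
    ultimately show ?case unfolding t_def[symmetric] using c_pos by (auto simp: field_simps)
  qed
  moreover have "((\<lambda>x. norm (\<Phi>' x) * eps x / c) \<longlongrightarrow> norm (\<Phi>' x0) * 0 / c) ?F"
    using c_pos by (intro tendsto_intros ch epsl) auto
  ultimately have "((\<lambda>x. ?y x - A x) \<longlongrightarrow> 0) ?F"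
    by (intro Lim_null_comparison[of "\<lambda>x. ?y x - A x"]) auto
  from tendsto_add[OF this Al] show ?thesis by simp
qed

lemma tendsto_onorm_phit:
  assumes z: "(x0, u) \<in> N" "x0 \<in> M" and \<alpha>: "0 < \<alpha>"
  shows "((\<lambda>x. onorm (\<lambda>w. phit M f g \<alpha> x u w - phit M f g \<alpha> x0 u w)) \<longlongrightarrow> 0) (inf (nhds x0) (principal M))"
proof -
  let ?F = "inf (nhds x0) (principal M)"
  have id: "((\<lambda>x. x) \<longlongrightarrow> x0) ?F" by (rule tendsto_mono[OF inf_le1 filterlim_ident])
  have evM: "\<forall>\<^sub>F x in ?F. x \<in> M" by (simp add: eventually_inf_principal)
  have evN: "\<forall>\<^sub>F x in ?F. (x, u) \<in> N"
    using topological_tendstoD[OF id open_slice_N[of u]] z by simp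
  have lin: "linear (phit M f g \<alpha> x u)" if "(x, u) \<in> N" "x \<in> M" for x
    using phit_works(1)[OF that \<alpha>] unfolding phit_well_defined_def by blast
  have "((\<lambda>x. \<Sum>i\<in>Basis. norm (phit M f g \<alpha> x u i - phit M f g \<alpha> x0 u i)) \<longlongrightarrow>
      (\<Sum>i\<in>(Basis::'b set). norm (phit M f g \<alpha> x0 u i - phit M f g \<alpha> x0 u i))) ?F"
    by (intro tendsto_intros tendsto_phit z \<alpha>)
  then have l: "((\<lambda>x. \<Sum>i\<in>Basis. norm (phit M f g \<alpha> x u i - phit M f g \<alpha> x0 u i)) \<longlongrightarrow> 0) ?F" by simp
  show ?thesis
  proof (rule Lim_null_comparison[OF _ l])
    show "\<forall>\<^sub>F x in ?F. norm (onorm (\<lambda>w. phit M f g \<alpha> x u w - phit M f g \<alpha> x0 u w))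
        \<le> (\<Sum>i\<in>Basis. norm (phit M f g \<alpha> x u i - phit M f g \<alpha> x0 u i))"
      using evM evN
    proof eventually_elim
      case (elim x)
      have l: "linear (\<lambda>w. phit M f g \<alpha> x u w - phit M f g \<alpha> x0 u w)"
        by (intro linear_compose_sub lin elim z)
      then have "0 \<le> onorm (\<lambda>w. phit M f g \<alpha> x u w - phit M f g \<alpha> x0 u w)"
        using onorm_pos_le linear_conv_bounded_linear by blast
      then show ?case using onorm_le_sum_Basis[OF l] by simp
    qed
  qed
qed

end

section \<open>Joint and partial subdifferentials, and the neighbourhood of the base point\<close>

lemma partly_smooth_regular:
  assumes "partly_smooth g S" "z \<in> S"
  shows "regular_fun_at g z" and "limiting_subdiff g z \<noteq> {}"
proof -
  have p: "partly_smooth_at g S z" using assms unfolding partly_smooth_def by blast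
  show ne: "limiting_subdiff g z \<noteq> {}" using p unfolding partly_smooth_at_def by blast
  \<comment> \<open>Regularity is available where \<open>g\<close> is finite; a limiting subgradient
    certifies finiteness.\<close>
  then have "\<bar>g z\<bar> \<noteq> \<infinity>" unfolding limiting_subdiff_def by auto
  moreover have "\<forall>\<^sub>F y in nhds z. \<bar>g y\<bar> \<noteq> \<infinity> \<longrightarrow> regular_fun_at g y"
    using p unfolding partly_smooth_at_def by (elim conjE)
  ultimately show "regular_fun_at g z" by (auto dest: eventually_nhds_x_imp_x)
qed

text \<open>The lift applies because the directions of the affine hull of the joint subdifferential
  form the normal space of the product, which contains no nonzero \<open>(0, w)\<close>; the other
  inclusion restricts a joint subgradient to the slice.\<close>

lemma limiting_subdiff_slice:
  fixes g :: "'a::euclidean_space \<times> 'b::euclidean_space \<Rightarrow> ereal"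
  assumes cpso: "CPSO M \<Omega> L f g" and x: "x \<in> M" "u \<in> \<Omega>"
  shows "fst ` limiting_subdiff g (x, u) = convex_subdiff (\<lambda>x. g (x, u)) x"
proof -
  have ps: "partly_smooth g (M \<times> \<Omega>)" and o: "open \<Omega>" and cv: "convex_fun (\<lambda>x. g (x, u))"
    using cpso x unfolding CPSO_def by auto
  have pr: "proper_fun g" "lsc_fun g" using ps unfolding partly_smooth_def by auto
  have nm: "g y \<noteq> -\<infinity>" for y using pr unfolding proper_fun_def by blast
  note r = partly_smooth_regular[OF ps, of "(x, u)"]
  have ns: "normal_space (M \<times> \<Omega>) (x, u) = parallel_subspace (limiting_subdiff g (x, u))"
    using ps x unfolding partly_smooth_def partly_smooth_at_def by blast
  show ?thesis
  proof (intro equalityI subsetI)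
    fix v assume "v \<in> fst ` limiting_subdiff g (x, u)"
    then obtain w where "(v, w) \<in> limiting_subdiff g (x, u)" by force
    then have "v \<in> regular_subdiff (\<lambda>x. g (x, u)) x"
      using regular_subdiff_slice limiting_subdiff_eq_regular_subdiff[OF r(1)] x by blast
    then show "v \<in> convex_subdiff (\<lambda>x. g (x, u)) x"
      using regular_subdiff_subset_convex_subdiff[OF cv] nm by blast
  next
    fix v assume v: "v \<in> convex_subdiff (\<lambda>x. g (x, u)) x"
    have "\<exists>w. (v, w) \<in> limiting_subdiff g (x, u)"
      by (rule convex_subdiff_slice_lifts[OF pr r(1) v r(2)])
        (use x ns normal_space_Times(1)[OF o x] in auto)
    then show "v \<in> fst ` limiting_subdiff g (x, u)" by force
  qed
qed

text \<open>Every normal \<open>n\<close> of \<open>M\<close> gives a direction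
  \<open>(n, 0)\<close> of the joint affine hull, hence a direction of the affine hull of the
  partial subdifferential of \<open>F\<close>. A small one stays in the relative ball around 0
  provided by (ND), whose radius is \<open>e\<close>; subtracting the gradient of \<open>f\<close>
  returns to \<open>g\<close>.\<close>

lemma ND_ball:
  fixes g :: "'a::euclidean_space \<times> 'b::euclidean_space \<Rightarrow> ereal"
  assumes cpso: "CPSO M \<Omega> L f g" and x: "x \<in> M" "u \<in> \<Omega>" and ND: "ND f g x u"
  obtains e where "0 < e" "\<And>n. n \<in> normal_space M x \<Longrightarrow> norm n < e \<Longrightarrow>
    n - grad (\<lambda>x. f (x, u)) x \<in> convex_subdiff (\<lambda>x. g (x, u)) x"
proof -
  define D where "D = convex_subdiff (\<lambda>x. Fsum f g (x, u)) x"
  let ?gf = "grad (\<lambda>x. f (x, u)) x"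
  have ps: "partly_smooth g (M \<times> \<Omega>)" and o: "open \<Omega>" and cv: "convex_fun (\<lambda>x. g (x, u))"
    and cf: "convex_on UNIV (\<lambda>x. f (x, u))" and C2: "C2_on UNIV f"
    using cpso x unfolding CPSO_def by auto
  have nm: "g y \<noteq> -\<infinity>" for y using ps unfolding partly_smooth_def proper_fun_def by blast
  have df: "((\<lambda>x. f (x, u)) has_derivative (\<lambda>v. v \<bullet> ?gf)) (at x)"
    using C2_on_has_derivative_grad[OF C2_on_slice[OF C2]] by simp
  have D: "v \<in> D \<longleftrightarrow> v - ?gf \<in> convex_subdiff (\<lambda>x. g (x, u)) x" for v
    unfolding D_def Fsum_def by (rule convex_subdiff_add_smooth[OF cf df cv nm])
  obtain e where e: "0 \<in> D" "0 < e" "ball 0 e \<inter> affine hull D \<subseteq> D"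
    using ND unfolding ND_def D_def[symmetric] mem_rel_interior_ball by blast
  \<comment> \<open>Shifted by the gradient of \<open>f\<close>, first components of joint
    subgradients lie in \<open>D\<close>; the resulting condition is affine, so it extends from the
    subdifferential to its hull.\<close>
  have sub: "affine hull (limiting_subdiff g (x, u)) \<subseteq> {p. ?gf + fst p \<in> affine hull D}"
  proof (rule hull_minimal)
    show "limiting_subdiff g (x, u) \<subseteq> {p. ?gf + fst p \<in> affine hull D}"
    proof
      fix p assume "p \<in> limiting_subdiff g (x, u)"
      then have "fst p \<in> convex_subdiff (\<lambda>x. g (x, u)) x" using limiting_subdiff_slice[OF cpso x] by blast
      then have "?gf + fst p \<in> D" unfolding D by simp
      then show "p \<in> {p. ?gf + fst p \<in> affine hull D}" using hull_inc by fast
    qed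
    show "affine {p :: 'a \<times> 'b. ?gf + fst p \<in> affine hull D}"
    proof (subst affine_def, intro ballI allI impI)
      fix p q :: "'a \<times> 'b" and s t :: real
      assume pq: "p \<in> {p. ?gf + fst p \<in> affine hull D}" "q \<in> {p. ?gf + fst p \<in> affine hull D}" "s + t = 1"
      have "s *\<^sub>R (?gf + fst p) + t *\<^sub>R (?gf + fst q) \<in> affine hull D"
        using mem_affine[OF affine_affine_hull _ _ pq(3)] pq(1,2) by blast
      moreover have "s *\<^sub>R (?gf + fst p) + t *\<^sub>R (?gf + fst q) = (s + t) *\<^sub>R ?gf + fst (s *\<^sub>R p + t *\<^sub>R q)"
        by (simp add: algebra_simps)
      ultimately show "s *\<^sub>R p + t *\<^sub>R q \<in> {p. ?gf + fst p \<in> affine hull D}" using pq(3) by simp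
    qed
  qed
  have "n - ?gf \<in> convex_subdiff (\<lambda>x. g (x, u)) x" if n: "n \<in> normal_space M x" "norm n < e" for n
  proof -
    have "(n, 0) \<in> parallel_subspace (limiting_subdiff g (x, u))"
      using normal_space_Times(2)[OF o x n(1)] ps x unfolding partly_smooth_def partly_smooth_at_def by blast
    then obtain p q where pq: "(n, 0) = p - q" "p \<in> affine hull (limiting_subdiff g (x, u))"
      "q \<in> affine hull (limiting_subdiff g (x, u))" unfolding parallel_subspace_def by blast
    have "?gf + fst p \<in> affine hull D" "?gf + fst q \<in> affine hull D" "0 \<in> affine hull D"
      using sub pq(2,3) hull_inc[OF e(1)] by auto
    then have "0 + 1 *\<^sub>R ((?gf + fst p) - (?gf + fst q)) \<in> affine hull D"
      by (intro mem_affine_3_minus affine_affine_hull)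
    moreover have "fst p - fst q = n" using pq(1) by (metis fst_conv fst_diff)
    ultimately have "n \<in> D" using e(3) n(2) by auto
    then show ?thesis by (simp add: D)
  qed
  then show thesis using that e(2) by blast
qed

text \<open>If the normal part \<open>r\<close> of \<open>\<nu> + \<nabla>\<^sub>x f\<close> did not vanish near the base point, unit vectors along it
  would accumulate at a normal \<open>d\<close>. By inner semicontinuity, \<open>- (e/2) d - \<nabla>\<^sub>x f\<close> is a limit of nearby
  subgradients \<open>b\<close>, whereas the variational inequality of the projection yields \<open>r \<bullet> (b + \<nabla>\<^sub>x f) > 0\<close>.\<close>

lemma (in C2_chart) nu_residual_tangent:
  fixes g :: "'a \<times> 'b::euclidean_space \<Rightarrow> ereal"
  assumes cpso: "CPSO M \<Omega> L f g" and xs: "xs \<in> M" "xs \<in> V" "us \<in> \<Omega>" and ND: "ND f g xs us"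
    and ext: "\<And>x u. (x, u) \<in> N \<Longrightarrow> x \<in> M \<Longrightarrow> is_C2_extension M (\<lambda>x. g (x, u)) x (\<lambda>x. gh (x, u))"
    and N: "N \<subseteq> V \<times> \<Omega>"
  obtains O' where "open O'" "(xs, us) \<in> O'" "\<And>x u. (x, u) \<in> O' \<Longrightarrow> (x, u) \<in> N \<Longrightarrow> x \<in> M \<Longrightarrow>
    nproj M x (nu f g x u + grad (\<lambda>x. f (x, u)) x) = 0"
proof -
  let ?P = "\<lambda>z. nproj M (fst z) (nu f g (fst z) (snd z) + grad (\<lambda>x. f (x, snd z)) (fst z)) = 0"
  have ps: "partly_smooth g (M \<times> \<Omega>)" and C2: "C2_on UNIV f" using cpso unfolding CPSO_def by auto
  obtain e where e: "0 < e" "\<And>n. n \<in> normal_space M xs \<Longrightarrow> norm n < e \<Longrightarrow>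
    n - grad (\<lambda>x. f (x, us)) xs \<in> convex_subdiff (\<lambda>x. g (x, us)) xs"
    using ND_ball[OF cpso xs(1,3) ND] by blast
  obtain Hf where Hf: "\<And>z. z \<in> UNIV \<Longrightarrow>
      ((\<lambda>z. grad (\<lambda>x. f (x, snd z)) (fst z)) has_derivative blinfun_apply (Hf z)) (at z)"
    by (rule C2_on_slice_hess[OF C2 open_UNIV]) blast
  have gf_cont: "isCont (\<lambda>z. grad (\<lambda>x. f (x, snd z)) (fst z)) (xs, us)"
    using has_derivative_continuous[OF Hf[OF UNIV_I]] .
  show thesis
  proof (rule open_neighbourhood_by_sequences[of "{z \<in> N. fst z \<in> M}" ?P "(xs, us)"])
    fix zs :: "nat \<Rightarrow> 'a \<times> 'b"
    assume zs: "\<And>n. zs n \<in> {z \<in> N. fst z \<in> M}" "\<And>n. \<not> ?P (zs n)" "zs \<longlonglongrightarrow> (xs, us)"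
    define X where "X n = fst (zs n)" for n
    define W where "W n = snd (zs n)" for n
    define G where "G n = grad (\<lambda>x. f (x, W n)) (X n)" for n
    define r where "r n = nproj M (X n) (nu f g (X n) (W n) + G n)" for n
    have XW: "X n \<in> M" "X n \<in> V" "W n \<in> \<Omega>" "(X n, W n) \<in> N" "zs n = (X n, W n)" for n
      using zs(1)[of n] N by (auto simp: X_def W_def)
    have r: "r n \<noteq> 0" "r n \<in> normal_space M (X n)" for n
      using zs(2)[of n] nproj_in by (auto simp: r_def X_def W_def G_def)
    define d where "d n = r n /\<^sub>R norm (r n)" for n
    have d1: "norm (d n) = 1" for n using r(1) by (simp add: d_def)
    have dN: "d n \<in> normal_space M (X n)" for n
      unfolding d_def using r(2) subspace_orthogonal_comp subspace_scale unfolding normal_space_def by blast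
    have ineq: "0 \<le> d n \<bullet> (b + G n)" if b: "b \<in> convex_subdiff (\<lambda>x. g (x, W n)) (X n)" for b n
    proof -
      let ?B = "convex_subdiff (\<lambda>x. g (x, W n)) (X n)"
      let ?nu = "nu f g (X n) (W n)"
      interpret Pr: linear "tproj M (X n)" by (rule linear_tproj[OF XW(1,2)])
      have nuB: "?nu \<in> ?B"
        unfolding nu_def using closest_point_in_set[OF closed_convex_subdiff] b by blast
      have "(- G n - ?nu) \<bullet> (b - ?nu) \<le> 0"
        unfolding nu_def G_def by (rule closest_point_dot[OF convex_convex_subdiff closed_convex_subdiff b])
      then have 1: "0 \<le> (?nu + G n) \<bullet> (b - ?nu)" by (simp add: inner_diff_left inner_add_left)
      note o = convex_subgradient_order_conditions(1)[OF XW(1,2) ext[OF XW(4,1)]]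
      have "b - ?nu = (grad (\<lambda>x. gh (x, W n)) (X n) - ?nu) - (grad (\<lambda>x. gh (x, W n)) (X n) - b)" by simp
      \<comment> \<open>Both subgradients differ from \<open>grad gh\<close> by a normal vector, so
        their difference is normal, and \<open>r n\<close> can replace the whole residual when
        paired with it.\<close>
      then have bN: "b - ?nu \<in> normal_space M (X n)"
        using o[OF b] o[OF nuB] subspace_diff[OF subspace_orthogonal_comp] unfolding normal_space_def by metis
      have T: "tproj M (X n) v \<bullet> w = 0" if "w \<in> normal_space M (X n)" for v w
        using that tproj_in[OF XW(1,2), of n v] unfolding normal_space_def orthogonal_comp_def orthogonal_def by blast
      have rd: "r n \<bullet> w = (?nu + G n) \<bullet> w" if "w \<in> normal_space M (X n)" for w
        unfolding r_def nproj_eq[OF XW(1,2)] using T[OF that] by (simp add: inner_diff_left)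
      have "r n \<bullet> (b - ?nu) \<ge> 0" using 1 rd[OF bN] by simp
      moreover have "r n \<bullet> r n = (?nu + G n) \<bullet> r n" by (rule rd[OF r(2)])
      moreover have "0 \<le> r n \<bullet> r n" by simp
      ultimately have "0 \<le> r n \<bullet> (b + G n)"
        by (simp add: inner_add_right inner_diff_right inner_add_left inner_commute)
      then show ?thesis by (simp add: d_def)
    qed
    have "compact (sphere (0::'a) 1)" by (rule compact_sphere)
    then obtain dl \<rho> where \<rho>: "strict_mono (\<rho> :: nat \<Rightarrow> nat)" "(d \<circ> \<rho>) \<longlonglongrightarrow> dl"
      using d1 unfolding compact_def by (auto dest!: spec[of _ d])
    have dlim: "(\<lambda>n. d (\<rho> n)) \<longlonglongrightarrow> dl" using \<rho>(2) by (simp add: comp_def)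
    have zl: "(\<lambda>n. zs (\<rho> n)) \<longlonglongrightarrow> (xs, us)" using LIMSEQ_subseq_LIMSEQ[OF zs(3) \<rho>(1)] by (simp add: comp_def)
    have Xl: "(\<lambda>n. X (\<rho> n)) \<longlonglongrightarrow> xs" using tendsto_fst[OF zl] by (simp add: X_def)
    have Gl: "(\<lambda>n. G (\<rho> n)) \<longlonglongrightarrow> grad (\<lambda>x. f (x, us)) xs"
      using isCont_tendsto_compose[OF gf_cont zl] by (simp add: G_def X_def W_def)
    have "(\<lambda>n. norm (d (\<rho> n))) \<longlonglongrightarrow> norm dl" by (intro tendsto_norm dlim)
    then have dl1: "norm dl = 1" unfolding d1 using LIMSEQ_const_iff by metis
    \<comment> \<open>Normality passes to the limit since it is tested against vectors depending
      continuously on the point.\<close>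
    have "dl \<bullet> \<Psi>' (\<Phi> xs) a = 0" if a: "a \<in> E" for a
    proof -
      have l: "(\<lambda>n. d (\<rho> n) \<bullet> \<Psi>' (\<Phi> (X (\<rho> n))) a) \<longlonglongrightarrow> dl \<bullet> \<Psi>' (\<Phi> xs) a"
        by (intro tendsto_intros dlim tendsto_charts(3)[OF xs(2) Xl])
      have "d (\<rho> n) \<bullet> \<Psi>' (\<Phi> (X (\<rho> n))) a = 0" for n
        using dN normal_iff[OF XW(1,2)] a by blast
      from LIMSEQ_unique[OF l[unfolded this] tendsto_const] show ?thesis .
    qed
    then have "dl \<in> normal_space M xs" by (simp add: normal_iff[OF xs(1,2)])
    then have "- (e / 2) *\<^sub>R dl \<in> normal_space M xs"
      unfolding normal_space_def using subspace_orthogonal_comp subspace_scale by blast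
    then have "- (e / 2) *\<^sub>R dl - grad (\<lambda>x. f (x, us)) xs \<in> convex_subdiff (\<lambda>x. g (x, us)) xs"
      by (rule e(2)) (use e(1) dl1 in simp)
    then obtain w where w: "(- (e / 2) *\<^sub>R dl - grad (\<lambda>x. f (x, us)) xs, w) \<in> limiting_subdiff g (xs, us)"
      unfolding limiting_subdiff_slice[OF cpso xs(1,3), symmetric] by force
    have cont: "set_continuous_at_within (limiting_subdiff g) (xs, us) (M \<times> \<Omega>)"
      using ps xs unfolding partly_smooth_def partly_smooth_at_def by blast
    have "\<forall>n. zs (\<rho> n) \<in> M \<times> \<Omega>" using XW by auto
    then have "\<exists>vs. (\<forall>\<^sub>F n in sequentially. vs n \<in> limiting_subdiff g (zs (\<rho> n))) \<and>
        vs \<longlonglongrightarrow> (- (e / 2) *\<^sub>R dl - grad (\<lambda>x. f (x, us)) xs, w)"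
      using bspec[OF cont[unfolded set_continuous_at_within_def, THEN conjunct2] w,
          THEN spec[of _ "\<lambda>n. zs (\<rho> n)"]] zl by blast
    then obtain vs where vs: "\<forall>\<^sub>F n in sequentially. vs n \<in> limiting_subdiff g (zs (\<rho> n))"
      "vs \<longlonglongrightarrow> (- (e / 2) *\<^sub>R dl - grad (\<lambda>x. f (x, us)) xs, w)" by blast
    have "\<forall>\<^sub>F n in sequentially. 0 \<le> d (\<rho> n) \<bullet> (fst (vs n) + G (\<rho> n))"
      using vs(1)
    proof eventually_elim
      case (elim n)
      then have "fst (vs n) \<in> fst ` limiting_subdiff g (X (\<rho> n), W (\<rho> n))" unfolding XW(5) by (rule imageI)
      then have "fst (vs n) \<in> convex_subdiff (\<lambda>x. g (x, W (\<rho> n))) (X (\<rho> n))"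
        unfolding limiting_subdiff_slice[OF cpso XW(1,3)] .
      then show ?case by (rule ineq)
    qed
    moreover have "(\<lambda>n. d (\<rho> n) \<bullet> (fst (vs n) + G (\<rho> n))) \<longlonglongrightarrow>
        dl \<bullet> (fst (- (e / 2) *\<^sub>R dl - grad (\<lambda>x. f (x, us)) xs, w) + grad (\<lambda>x. f (x, us)) xs)"
      by (intro tendsto_intros dlim vs(2) Gl)
    ultimately have "0 \<le> dl \<bullet> (fst (- (e / 2) *\<^sub>R dl - grad (\<lambda>x. f (x, us)) xs, w) + grad (\<lambda>x. f (x, us)) xs)"
      by (intro tendsto_lowerbound) auto
    then have "0 \<le> - (e / 2) * (dl \<bullet> dl)" by simp
    then show False using e(1) dl1 by (simp add: dot_square_norm)
  next
    fix O' assume "open O'" "(xs, us) \<in> O'" "\<And>y. y \<in> O' \<Longrightarrow> y \<in> {z \<in> N. fst z \<in> M} \<Longrightarrow> ?P y"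
    then show thesis using that[of O'] by force
  qed
qed

text \<open>Violating unit tangent vectors at nearby points have a limit, tangent at
  \<open>xs\<close> because \<open>\<Phi>'\<close> carries tangency to membership in the closed set
  \<open>E\<close>; the form would be at least \<open>c0\<close> there and at most
  \<open>c0 / 2\<close>.\<close>

lemma (in C2_chart) pos_def_neighbourhood:
  fixes H :: "'a \<times> 'b::euclidean_space \<Rightarrow> ('a \<times> 'b) \<Rightarrow>\<^sub>L 'a"
  assumes xs: "xs \<in> M" "xs \<in> V" and H: "isCont H (xs, us)"
    and pd: "\<And>t. t \<in> tangent_space M xs \<Longrightarrow> t \<noteq> 0 \<Longrightarrow> 0 < H (xs, us) (t, 0) \<bullet> t"
  obtains O' c where "open O'" "(xs, us) \<in> O'" "0 < (c::real)"
    "\<And>x u t. (x, u) \<in> O' \<Longrightarrow> x \<in> M \<Longrightarrow> x \<in> V \<Longrightarrow> t \<in> tangent_space M x \<Longrightarrow> c * (t \<bullet> t) \<le> H (x, u) (t, 0) \<bullet> t"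
proof -
  let ?K = "sphere 0 1 \<inter> tangent_space M xs"
  have comp: "compact ?K" by (intro compact_Int_closed compact_sphere closed_subspace subspace_tangent xs)
  \<comment> \<open>The minimum over the compact set of unit tangent vectors; if the tangent space
    is trivial that set is empty and 1 will do.\<close>
  have "\<exists>c0>0. \<forall>t\<in>?K. c0 \<le> H (xs, us) (t, 0) \<bullet> t"
  proof (cases "?K = {}")
    case False
    have "continuous_on ?K (\<lambda>t. H (xs, us) (t, 0) \<bullet> t)" by (intro continuous_intros)
    from continuous_attains_inf[OF comp False this]
    obtain t0 where t0: "t0 \<in> ?K" "\<forall>t\<in>?K. H (xs, us) (t0, 0) \<bullet> t0 \<le> H (xs, us) (t, 0) \<bullet> t" by blast
    then have "0 < H (xs, us) (t0, 0) \<bullet> t0" by (intro pd) auto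
    then show ?thesis using t0(2) by blast
  qed (auto intro: exI[of _ 1])
  then obtain c0 where c0: "0 < c0" "\<And>t. t \<in> ?K \<Longrightarrow> c0 \<le> H (xs, us) (t, 0) \<bullet> t" by blast
  let ?P = "\<lambda>z. \<forall>t\<in>tangent_space M (fst z). c0 / 2 * (t \<bullet> t) \<le> H z (t, 0) \<bullet> t"
  show thesis
  proof (rule open_neighbourhood_by_sequences[of "{z. fst z \<in> M \<and> fst z \<in> V}" ?P "(xs, us)"])
    fix zs :: "nat \<Rightarrow> 'a \<times> 'b"
    assume zs: "\<And>n. zs n \<in> {z. fst z \<in> M \<and> fst z \<in> V}" "\<And>n. \<not> ?P (zs n)" "zs \<longlonglongrightarrow> (xs, us)"
    have "\<exists>s. s \<in> tangent_space M (fst (zs n)) \<and> norm s = 1 \<and> H (zs n) (s, 0) \<bullet> s \<le> c0 / 2" for n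
    proof -
      obtain t where t: "t \<in> tangent_space M (fst (zs n))" "H (zs n) (t, 0) \<bullet> t < c0 / 2 * (t \<bullet> t)"
        using zs(2)[of n] by (auto simp: not_le)
      have t0: "t \<noteq> 0" using t(2) by (auto simp: zero_prod_def[symmetric])
      define s where "s = t /\<^sub>R norm t"
      have "(s, 0) = inverse (norm t) *\<^sub>R (t, 0::'b)" by (simp add: s_def)
      then have "H (zs n) (s, 0) = inverse (norm t) *\<^sub>R H (zs n) (t, 0)" by (simp only: blinfun.scaleR_right)
      then have "H (zs n) (s, 0) \<bullet> s = (H (zs n) (t, 0) \<bullet> t) / (norm t)\<^sup>2"
        by (simp add: s_def power2_eq_square divide_inverse)
      also have "\<dots> \<le> c0 / 2" using t(2) t0 by (simp add: dot_square_norm field_simps)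
      finally have "H (zs n) (s, 0) \<bullet> s \<le> c0 / 2" .
      moreover have "s \<in> tangent_space M (fst (zs n))"
        unfolding s_def using zs(1)[of n] t(1) subspace_tangent subspace_scale by blast
      ultimately show ?thesis using t0 by (intro exI[of _ s]) (simp add: s_def)
    qed
    then obtain s where s: "\<And>n. s n \<in> tangent_space M (fst (zs n))" "\<And>n. norm (s n) = 1"
      "\<And>n. H (zs n) (s n, 0) \<bullet> s n \<le> c0 / 2" by metis
    have "compact (sphere (0::'a) 1)" by (rule compact_sphere)
    then obtain sl \<rho> where \<rho>: "strict_mono (\<rho> :: nat \<Rightarrow> nat)" "(s \<circ> \<rho>) \<longlonglongrightarrow> sl"
      using s(2) unfolding compact_def by (auto dest!: spec[of _ s])
    have sl: "(\<lambda>n. s (\<rho> n)) \<longlonglongrightarrow> sl" using \<rho>(2) by (simp add: comp_def)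
    have zl: "(\<lambda>n. zs (\<rho> n)) \<longlonglongrightarrow> (xs, us)" using LIMSEQ_subseq_LIMSEQ[OF zs(3) \<rho>(1)] by (simp add: comp_def)
    have Xl: "(\<lambda>n. fst (zs (\<rho> n))) \<longlonglongrightarrow> xs" using tendsto_fst[OF zl] by simp
    have "(\<lambda>n. norm (s (\<rho> n))) \<longlonglongrightarrow> norm sl" by (intro tendsto_norm sl)
    then have sl1: "norm sl = 1" unfolding s(2) using LIMSEQ_const_iff by metis
    have lim: "(\<lambda>n. \<Phi>' (fst (zs (\<rho> n))) (s (\<rho> n))) \<longlonglongrightarrow> \<Phi>' xs sl"
      by (intro tendsto_intros sl tendsto_charts(2)[OF xs(2) Xl])
    have inE: "\<Phi>' (fst (zs (\<rho> n))) (s (\<rho> n)) \<in> E" for n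
      using \<Phi>'_tangent_in_E s(1) zs(1)[of "\<rho> n"] by blast
    have "\<Phi>' xs sl \<in> E" by (rule closed_sequentially[OF closed_subspace[OF subspace_E] inE lim])
    then have "sl \<in> tangent_space M xs" using tangent_in[OF xs] \<Psi>'_\<Phi>'[OF xs(2)] by metis
    then have "c0 \<le> H (xs, us) (sl, 0) \<bullet> sl" using sl1 by (intro c0(2)) auto
    moreover have "H (xs, us) (sl, 0) \<bullet> sl \<le> c0 / 2"
    proof (rule LIMSEQ_le_const2)
      show "(\<lambda>n. H (zs (\<rho> n)) (s (\<rho> n), 0) \<bullet> s (\<rho> n)) \<longlonglongrightarrow> H (xs, us) (sl, 0) \<bullet> sl"
        by (intro tendsto_intros tendsto_Pair sl isCont_tendsto_compose[OF H zl])
    qed (use s(3) in blast)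
    ultimately show False using c0(1) by simp
  next
    fix O' assume "open O'" "(xs, us) \<in> O'" "\<And>y. y \<in> O' \<Longrightarrow> y \<in> {z. fst z \<in> M \<and> fst z \<in> V} \<Longrightarrow> ?P y"
    then show thesis using that[of O' "c0 / 2"] c0(1) by force
  qed
qed

text \<open>\<open>N\<close> combines the domain of the chart and of a joint extension of
  \<open>g\<close>, the neighbourhood from \<open>nu_residual_tangent\<close>, and one on which the
  Hessian of \<open>f\<close> stays positive definite along \<open>M\<close>.\<close>

lemma CPSO_chart_exists:
  fixes M :: "'a::euclidean_space set" and g :: "'a \<times> 'b::euclidean_space \<Rightarrow> ereal"
  assumes cpso: "CPSO M \<Omega> L f g" and xs: "xs \<in> M" "us \<in> \<Omega>"
    and RPD: "RPD_ii M f xs us" and ND: "ND f g xs us"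
  obtains V V' \<Phi> \<Psi> E \<Phi>' \<Psi>' \<Psi>'' gh N Hf Hg c
  where "CPSO_chart M V V' \<Phi> \<Psi> E \<Phi>' \<Psi>' \<Psi>'' f gh g N Hf Hg c" "(xs, us) \<in> N" "N \<subseteq> V \<times> \<Omega>"
proof -
  have ps: "partly_smooth g (M \<times> \<Omega>)" and o: "open \<Omega>" and C2f: "C2_on UNIV f" and sm: "C2_submanifold M"
    using cpso unfolding CPSO_def by auto
  obtain V V' \<Phi> \<Psi> E \<Phi>' \<Psi>' \<Psi>'' where ch: "C2_chart M V V' \<Phi> \<Psi> E \<Phi>' \<Psi>' \<Psi>''" and xV: "xs \<in> V"
    by (rule C2_submanifold_chart[OF sm xs(1)])
  interpret C2_chart M V V' \<Phi> \<Psi> E \<Phi>' \<Psi>' \<Psi>'' by (rule ch)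
  have "\<exists>ht. is_C2_extension (M \<times> \<Omega>) g (xs, us) ht"
    using ps xs unfolding partly_smooth_def partly_smooth_at_def by blast
  then obtain gh V0 where V0: "open V0" "(xs, us) \<in> V0" "C2_on V0 gh"
    "\<And>y. y \<in> M \<times> \<Omega> \<Longrightarrow> y \<in> V0 \<Longrightarrow> g y = ereal (gh y)"
    unfolding is_C2_extension_def by blast
  define N0 where "N0 = V0 \<inter> (V \<times> \<Omega>)"
  have N0: "open N0" "(xs, us) \<in> N0" "N0 \<subseteq> V \<times> \<Omega>" "C2_on N0 f" "C2_on N0 gh"
    using V0 open_V o xs xV C2_on_subset[OF C2f] C2_on_subset[OF V0(3)]
    by (auto simp: N0_def open_Times open_Int)
  have geq: "g (x, u) = ereal (gh (x, u))" if "(x, u) \<in> N0" "x \<in> M" for x u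
    using V0(4)[of "(x, u)"] that by (auto simp: N0_def)
  obtain Hf where Hf:
    "\<And>x u. (x, u) \<in> N0 \<Longrightarrow> hess (\<lambda>x. f (x, u)) x = (\<lambda>v. blinfun_apply (Hf (x, u)) (v, 0))"
    "\<And>z. z \<in> N0 \<Longrightarrow> ((\<lambda>z. grad (\<lambda>x. f (x, snd z)) (fst z)) has_derivative blinfun_apply (Hf z)) (at z)"
    "\<And>x u. (x, u) \<in> N0 \<Longrightarrow>
      ((\<lambda>u. grad (\<lambda>x. f (x, u)) x) has_derivative (\<lambda>w. blinfun_apply (Hf (x, u)) (0, w))) (at u)"
    "continuous_on N0 Hf"
    by (rule C2_on_slice_hess[OF N0(4,1)]) blast
  obtain Hg where Hg:
    "\<And>x u. (x, u) \<in> N0 \<Longrightarrow> hess (\<lambda>x. gh (x, u)) x = (\<lambda>v. blinfun_apply (Hg (x, u)) (v, 0))"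
    "\<And>z. z \<in> N0 \<Longrightarrow> ((\<lambda>z. grad (\<lambda>x. gh (x, snd z)) (fst z)) has_derivative blinfun_apply (Hg z)) (at z)"
    "\<And>x u. (x, u) \<in> N0 \<Longrightarrow>
      ((\<lambda>u. grad (\<lambda>x. gh (x, u)) x) has_derivative (\<lambda>w. blinfun_apply (Hg (x, u)) (0, w))) (at u)"
    "continuous_on N0 Hg"
    by (rule C2_on_slice_hess[OF N0(5,1)]) blast
  have ext: "is_C2_extension M (\<lambda>x. g (x, u)) x (\<lambda>x. gh (x, u))" if "(x, u) \<in> N0" for x u
  proof -
    have "{x. (x, u) \<in> N0} = (\<lambda>x. (x, u)) -` N0" by auto
    then have "open {x. (x, u) \<in> N0}"
      by (auto intro!: continuous_open_vimage N0 continuous_intros)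
    then show ?thesis
      unfolding is_C2_extension_def using C2_on_slice[OF N0(5)] geq that by blast
  qed
  have "\<exists>O1. open O1 \<and> (xs, us) \<in> O1 \<and> (\<forall>x u. (x, u) \<in> O1 \<longrightarrow> (x, u) \<in> N0 \<longrightarrow> x \<in> M \<longrightarrow>
    nproj M x (nu f g x u + grad (\<lambda>x. f (x, u)) x) = 0)"
  proof (rule nu_residual_tangent[OF cpso xs(1) xV xs(2) ND _ N0(3)])
    show "is_C2_extension M (\<lambda>x. g (x, u)) x (\<lambda>x. gh (x, u))" if "(x, u) \<in> N0" "x \<in> M" for x u
      by (rule ext[OF that(1)])
  qed blast
  then obtain O1 where O1: "open O1" "(xs, us) \<in> O1" "\<And>x u. (x, u) \<in> O1 \<Longrightarrow> (x, u) \<in> N0 \<Longrightarrow> x \<in> M \<Longrightarrow>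
    nproj M x (nu f g x u + grad (\<lambda>x. f (x, u)) x) = 0" by blast
  have "isCont Hf (xs, us)" using Hf(4) N0 continuous_on_eq_continuous_at by blast
  moreover have "0 < Hf (xs, us) (t, 0) \<bullet> t" if t: "t \<in> tangent_space M xs" "t \<noteq> 0" for t
    using bspec[OF RPD[unfolded RPD_ii_def pos_def_on_def Hf(1)[OF N0(2)]] t(1)] t(2)
      tproj_inner[OF xs(1) xV t(1)] by simp
  ultimately obtain O2 c where O2: "open O2" "(xs, us) \<in> O2" "0 < (c::real)"
    "\<And>x u t. (x, u) \<in> O2 \<Longrightarrow> x \<in> M \<Longrightarrow> x \<in> V \<Longrightarrow> t \<in> tangent_space M x \<Longrightarrow> c * (t \<bullet> t) \<le> Hf (x, u) (t, 0) \<bullet> t"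
    using pos_def_neighbourhood[OF xs(1) xV] by metis
  define N where "N = N0 \<inter> (O1 \<inter> O2)"
  have N: "open N" "(xs, us) \<in> N" "N \<subseteq> N0" "N \<subseteq> O1" "N \<subseteq> O2" using N0 O1 O2 by (auto simp: N_def)
  have nu_sub: "nu f g x u \<in> convex_subdiff (\<lambda>x. g (x, u)) x" if "(x, u) \<in> N" "x \<in> M" for x u
  proof -
    have u: "u \<in> \<Omega>" using that N N0 by auto
    have "convex_subdiff (\<lambda>x. g (x, u)) x \<noteq> {}"
      using limiting_subdiff_slice[OF cpso that(2) u] partly_smooth_regular(2)[OF ps, of "(x, u)"] that u by blast
    then show ?thesis unfolding nu_def by (rule closest_point_in_set[OF closed_convex_subdiff])
  qed
  have "CPSO_chart M V V' \<Phi> \<Psi> E \<Phi>' \<Psi>' \<Psi>'' f gh g N Hf Hg c"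
  proof (intro CPSO_chart.intro ch CPSO_chart_axioms.intro)
    show "C2_on N f" "C2_on N gh" using C2_on_subset N0 N by blast+
    show "continuous_on N Hf" "continuous_on N Hg" using continuous_on_subset Hf Hg N by blast+
    show "open N" "0 < c" by (fact N(1), fact O2(3))
    fix x u assume xu: "(x, u) \<in> N"
    then have xu': "(x, u) \<in> N0" "(x, u) \<in> O1" "(x, u) \<in> O2" using N by auto
    show xV: "x \<in> V" using xu' N0 by auto
    note Hf(1)[OF xu'(1)] Hf(3)[OF xu'(1)] Hg(1)[OF xu'(1)] Hg(3)[OF xu'(1)]
    then show "hess (\<lambda>x. f (x, u)) x = (\<lambda>v. Hf (x, u) (v, 0))"
      "((\<lambda>u. grad (\<lambda>x. f (x, u)) x) has_derivative (\<lambda>w. Hf (x, u) (0, w))) (at u)"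
      "hess (\<lambda>x. gh (x, u)) x = (\<lambda>v. Hg (x, u) (v, 0))"
      "((\<lambda>u. grad (\<lambda>x. gh (x, u)) x) has_derivative (\<lambda>w. Hg (x, u) (0, w))) (at u)" .
    assume x: "x \<in> M"
    show "g (x, u) = ereal (gh (x, u))" by (rule geq[OF xu'(1) x])
    show "nu f g x u \<in> convex_subdiff (\<lambda>x. g (x, u)) x" by (rule nu_sub[OF xu x])
    show "nproj M x (nu f g x u + grad (\<lambda>x. f (x, u)) x) = 0" by (rule O1(3)[OF xu'(2,1) x])
    show "c * (t \<bullet> t) \<le> Hf (x, u) (t, 0) \<bullet> t" if "t \<in> tangent_space M x" for t
      by (rule O2(4)[OF xu'(3) x xV that])
  next
    fix z assume "z \<in> N"
    then have z: "z \<in> N0" using N by blast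
    show "((\<lambda>z. grad (\<lambda>x. f (x, snd z)) (fst z)) has_derivative Hf z) (at z)"
      "((\<lambda>z. grad (\<lambda>x. gh (x, snd z)) (fst z)) has_derivative Hg z) (at z)"
      by (rule Hf(2)[OF z], rule Hg(2)[OF z])
  qed
  then show thesis using that N N0(3) by blast
qed

theorem mainTheorem6:
  fixes M :: "'a::euclidean_space set" and \<Omega> :: "'b::euclidean_space set"
    and f :: "'a \<times> 'b \<Rightarrow> real" and g :: "'a \<times> 'b \<Rightarrow> ereal"
    and L \<alpha>lo \<alpha>hi :: real
    and xs :: 'a and us :: 'b and U :: "'b set" and \<psi> :: "'b \<Rightarrow> 'a"
  assumes "CPSO M \<Omega> L f g"
    and "0 < L" and "0 < \<alpha>lo" and "\<alpha>lo \<le> \<alpha>hi" and "\<alpha>hi < 2 / L"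
    and "xs \<in> M" and "us \<in> \<Omega>"
    and "RPD_i M f g xs us" and "RPD_ii M f xs us" and "ND f g xs us"
    and "local_solution_map M \<Omega> f g xs us U \<psi>"
  shows "\<exists>U'\<subseteq>U. open U' \<and> us \<in> U' \<and>
    (\<forall>\<alpha>\<in>{\<alpha>lo..\<alpha>hi}. \<exists>V. openin (top_of_set (M \<times> \<Omega>)) V \<and> (xs, us) \<in> V \<and>
       (\<forall>(x, u)\<in>V. phit_well_defined M f g \<alpha> x u) \<and>
       (\<forall>u\<in>U'. (\<psi> u, u) \<in> V \<and>
          ((\<lambda>x. onorm (\<lambda>w. phit M f g \<alpha> x u w - frechet_derivative \<psi> (at u) w))
             \<longlongrightarrow> 0) (inf (nhds (\<psi> u)) (principal M))) \<and>
       (\<forall>(x, u)\<in>V. phit M f g \<alpha> x u =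
          (\<lambda>w. - pseudoinverse
                  (\<lambda>v. rhess M (\<lambda>x. Fsum f g (x, u)) x v + Wcorr M f g \<alpha> x u v)
                  (frechet_derivative (\<lambda>u. rgrad M (\<lambda>x. Fsum f g (x, u)) x) (at u) w))))"
proof -
  obtain V V' \<Phi> \<Psi> E \<Phi>' \<Psi>' \<Psi>'' gh N Hf Hg c
    where ch: "CPSO_chart M V V' \<Phi> \<Psi> E \<Phi>' \<Psi>' \<Psi>'' f gh g N Hf Hg c" and zN: "(xs, us) \<in> N"
      and N_sub: "N \<subseteq> V \<times> \<Omega>"
    by (rule CPSO_chart_exists[OF assms(1,6,7,9,10)])
  interpret CPSO_chart M V V' \<Phi> \<Psi> E \<Phi>' \<Psi>' \<Psi>'' f gh g N Hf Hg c by (rule ch)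
  have U: "open U" "us \<in> U" "U \<subseteq> \<Omega>" "C1_on U \<psi>" "\<psi> us = xs" "\<And>u. u \<in> U \<Longrightarrow> \<psi> u \<in> M"
    "\<And>u y. u \<in> U \<Longrightarrow> y \<in> M \<Longrightarrow> y \<noteq> \<psi> u \<Longrightarrow> Fsum f g (\<psi> u, u) < Fsum f g (y, u)"
    using assms(11) unfolding local_solution_map_def by auto
  \<comment> \<open>Those \<open>u\<close> whose solution pair lies in \<open>N\<close>; open by
    continuity of \<psi>.\<close>
  define U' where "U' = U \<inter> (\<lambda>u. (\<psi> u, u)) -` N"
  have "open U'"
    unfolding U'_def
    by (intro continuous_open_preimage continuous_on_Pair C1_on_imp_continuous_on continuous_on_id U open_N)
  moreover have "us \<in> U'" using U zN by (simp add: U'_def)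
  moreover have "U' \<subseteq> U" by (simp add: U'_def)
  moreover have "\<exists>W. openin (top_of_set (M \<times> \<Omega>)) W \<and> (xs, us) \<in> W \<and>
       (\<forall>(x, u)\<in>W. phit_well_defined M f g \<alpha> x u) \<and>
       (\<forall>u\<in>U'. (\<psi> u, u) \<in> W \<and>
          ((\<lambda>x. onorm (\<lambda>w. phit M f g \<alpha> x u w - frechet_derivative \<psi> (at u) w))
             \<longlongrightarrow> 0) (inf (nhds (\<psi> u)) (principal M))) \<and>
       (\<forall>(x, u)\<in>W. phit M f g \<alpha> x u =
          (\<lambda>w. - pseudoinverse
                  (\<lambda>v. rhess M (\<lambda>x. Fsum f g (x, u)) x v + Wcorr M f g \<alpha> x u v)
                  (frechet_derivative (\<lambda>u. rgrad M (\<lambda>x. Fsum f g (x, u)) x) (at u) w)))"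
    if "\<alpha> \<in> {\<alpha>lo..\<alpha>hi}" for \<alpha>
  \<comment> \<open>\<open>N\<close> was built without reference to \<alpha>, so one neighbourhood
    serves every step size.\<close>
  proof (intro exI[of _ "(M \<times> \<Omega>) \<inter> N"] conjI)
    have \<alpha>: "0 < \<alpha>" using that assms(3) by simp
    show "openin (top_of_set (M \<times> \<Omega>)) ((M \<times> \<Omega>) \<inter> N)" by (rule openin_open_Int[OF open_N])
    show "(xs, us) \<in> (M \<times> \<Omega>) \<inter> N" using assms zN by simp
    show "\<forall>(x, u)\<in>(M \<times> \<Omega>) \<inter> N. phit_well_defined M f g \<alpha> x u"
      using phit_works(1) \<alpha> by auto
    show "\<forall>(x, u)\<in>(M \<times> \<Omega>) \<inter> N. phit M f g \<alpha> x u =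
          (\<lambda>w. - pseudoinverse
                  (\<lambda>v. rhess M (\<lambda>x. Fsum f g (x, u)) x v + Wcorr M f g \<alpha> x u v)
                  (frechet_derivative (\<lambda>u. rgrad M (\<lambda>x. Fsum f g (x, u)) x) (at u) w))"
      using phit_formula \<alpha> by blast
    show "\<forall>u\<in>U'. (\<psi> u, u) \<in> (M \<times> \<Omega>) \<inter> N \<and>
          ((\<lambda>x. onorm (\<lambda>w. phit M f g \<alpha> x u w - frechet_derivative \<psi> (at u) w))
             \<longlongrightarrow> 0) (inf (nhds (\<psi> u)) (principal M))"
    proof (intro ballI conjI)
      fix u assume "u \<in> U'"
      then have u: "u \<in> U" "(\<psi> u, u) \<in> N" by (auto simp: U'_def)
      show "(\<psi> u, u) \<in> (M \<times> \<Omega>) \<inter> N" using u U by auto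
      show "((\<lambda>x. onorm (\<lambda>w. phit M f g \<alpha> x u w - frechet_derivative \<psi> (at u) w))
             \<longlongrightarrow> 0) (inf (nhds (\<psi> u)) (principal M))"
        using tendsto_onorm_phit[OF u(2) U(6)[OF u(1)] \<alpha>]
          phit_eq_derivative_of_minimizers[OF U(1,4) u(1) U(6,7) u(2) \<alpha>] by simp
    qed
  qed
  ultimately show ?thesis by blast
qed

end
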